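(* Let $v$ be a function whose trace and whose full gradient $\nabla v$ have traces in $L^2(\Gamma)$, and let $\tilde v:=v\circ\Phi_h$, with $\nabla\tilde v=(D\Phi_h)^T\,(\nabla v)\circ\Phi_h$ on $\Gamma_h$. Then: (a) $\|v\|_\Gamma\sim\|\tilde v\|_{\Gamma_h}$ and $\|\nabla v\|_\Gamma\sim\|\nabla\tilde v\|_{\Gamma_h}$. (b) For the normal derivatives: $$\|\nabla\tilde v\cdot n_{\Gamma_h}\|_{\Gamma_h}\lesssim h^q\|\nabla v\|_\Gamma+\|\nabla v\cdot n_\Gamma\|_\Gamma,\qquad \|\nabla v\cdot n_\Gamma\|_\Gamma\lesssim h^q\|\nabla\tilde v\|_{\Gamma_h}+\|\nabla\tilde v\cdot n_{\Gamma_h}\|_{\Gamma_h}.$$ (c) For the tangential derivatives: $$\|\nabla_{\Gamma_h}\tilde v\|_{\Gamma_h}\lesssim h^q\|\nabla v\|_\Gamma+\|\nabla_\Gamma v\|_\Gamma,\qquad \|\nabla_\Gamma v\|_\Gamma\lesssim h^q\|\nabla\tilde v\|_{\Gamma_h}+\|\nabla_{\Gamma_h}\tilde v\|_{\Gamma_h}.$$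
   Context: **Geometry.** $d\in\{2,3\}$; $\Omega\subset\mathbb R^d$ is a bounded connected open polygonal (polyhedral) set, $\Omega=\Omega_1\cup\Gamma\cup\Omega_2$ with $\Omega_1,\Omega_2$ connected, $\Gamma=\partial\Omega_1$ a smooth interface with unit normal $n_\Gamma$ pointing from $\Omega_1$ to $\Omega_2$; $\Gamma=\{\phi=0\}$, $\Omega_1=\{\phi<0\}$, $\Omega_2=\{\phi>0\}$ with $\phi\in C^{q+2}$ near $\Gamma$. $P_\Gamma=I-n_\Gamma n_\Gamma^T$, $\nabla_\Gamma=P_\Gamma\nabla$. $\|\cdot\|_M$ is the $L^2(M)$ norm, $\|\cdot\|_{\infty,M}$ the $L^\infty(M)$ norm. **Mesh.** $\mathcal T_h$ is a quasi-uniform simplicial mesh of $\Omega$ of size $h$, independent of $\Gamma$; $V_{h,k}$: continuous piecewise polynomials of order $k$. $\hat\phi\in V_{h,1}$ is the nodal interpolant of $\phi$; $\Gamma^{\rm lin}=\{\hat\phi=0\}$, $\Omega_1^{\rm lin}=\{\hat\phi<0\}$, $\Omega_2^{\rm lin}=\{\hat\phi>0\}$. **Mappings.** $q\in\mathbb N$, $q\geq1$. $\Theta_h\in[V_{h,q}]^d$ and $\Psi$ (continuous on $\Omega$, $C^{q+1}$ on each $T$) are the mesh deformations of Lehrenfeld and Reusken, constructed as follows (with $\nabla\phi\neq0$ on $\Gamma$). Let $\phi_h\in V_{h,q}$ be the nodal interpolant of $\phi$. On cut elements $T$ (those with $T\cap\Gamma^{\rm lin}\neq\emptyset$), $\Psi(x)=x+t(x)\nabla\phi(x)$,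 where $t(x)$ is the number of smallest absolute value with $\phi(x+t(x)\nabla\phi(x))=\hat\phi(x)$; similarly $\Psi_{h,T}(x)=x+t_h(x)\nabla\phi_h|_T(x)$ for $x\in T$, where $t_h(x)$ is the number of smallest absolute value with $\phi_{h,T}(x+t_h(x)\nabla\phi_h|_T(x))=\hat\phi(x)$, $\phi_{h,T}$ being the polynomial on $\mathbb R^d$ that equals $\phi_h$ on $T$; on the union of the cut elements $\Theta_h$ is the continuous piecewise polynomial of order $q$ whose value at each Lagrange node is the average of the values of $\Psi_{h,T}$ there over the cut elements $T$ containing the node. From the boundary of that union the displacements $\Psi-\mathrm{id}$ and $\Theta_h-\mathrm{id}$ are extended continuously by one common linear extension operator (preserving piecewise polynomials of order $q$) to the neighbouring elements, and both maps are the identity on all remaining elements. For $h$ sufficiently small (always assumed) they are homeomorphisms of $\Omega$, with $\Psi(\Gamma^{\rm lin})=\Gamma$, $\Psi(\Omega_i^{\rm lin})=\Omega_i$. Put $\Gamma_h=\Theta_h(\Gamma^{\rm lin})$, $\Omega_{i,h}=\Theta_h(\Omega_i^{\rm lin})$ and $\Phi_h=\Psi\circ\Theta_h^{-1}$, so $\Phi_h(\Gamma_h)=\Gamma$, $\Phi_h(\Omega_{i,h})=\Omega_i$; $\Phi_h$ is continuous on $\Omega$ and $C^{q+1}$ on each $\Theta_h(T)$, $D\Phi_h$ is understood elementwise. $n_{\Gamma_h}$ is the unit normal of $\Gamma_h$ (oriented from $\Omega_{1,h}$ to $\Omega_{2,h}$), $P_{\Gamma_h}=I-n_{\Gamma_h}n_{\Gamma_h}^T$,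 $\nabla_{\Gamma_h}=P_{\Gamma_h}\nabla$. Known property: $\|\Phi_h-\mathrm{id}\|_{\infty,\Omega}+h\|D\Phi_h-I\|_{\infty,\Omega}\lesssim h^{q+1}$. **Constants.** $X\lesssim Y$ means $X\le CY$ with $C$ independent of $h$, of how $\Gamma$ cuts the mesh and of $v$; $X\sim Y$ means $X\lesssim Y\lesssim X$. *)

theory Defs
  imports "HOL-Analysis.Analysis" "HOL-Probability.Essential_Supremum"
begin

section \<open>Hausdorff measure and $L^2$ norms on hypersurfaces\<close>

definition hausdorff_premeasure :: "nat \<Rightarrow> real \<Rightarrow> 'a::metric_space set \<Rightarrow> ennreal" where
  "hausdorff_premeasure s \<delta> A =
     (INF C \<in> {C :: nat \<Rightarrow> 'a set. A \<subseteq> (\<Union>i. C i) \<and> (\<forall>i. bounded (C i) \<and> diameter (C i) \<le> \<delta>)}.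
        \<Sum>i. if C i = {} then 0
             else ennreal (unit_ball_vol (real s) * (diameter (C i) / 2) ^ s))"

definition hausdorff_outer :: "nat \<Rightarrow> 'a::metric_space set \<Rightarrow> ennreal" where
  "hausdorff_outer s A = (SUP \<delta> \<in> {0<..}. hausdorff_premeasure s \<delta> A)"

lemma hausdorff_premeasure_mono: "A \<subseteq> B \<Longrightarrow> hausdorff_premeasure s \<delta> A \<le> hausdorff_premeasure s \<delta> B"
  unfolding hausdorff_premeasure_def by (rule INF_superset_mono) auto

lemma hausdorff_premeasure_antimono:
  "\<delta> \<le> \<delta>' \<Longrightarrow> hausdorff_premeasure s \<delta>' A \<le> hausdorff_premeasure s \<delta> A"
  unfolding hausdorff_premeasure_def
  by (rule INF_superset_mono) (auto intro: order_trans)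

lemma hausdorff_premeasure_empty: "\<delta> > 0 \<Longrightarrow> hausdorff_premeasure s \<delta> {} = 0"
  unfolding hausdorff_premeasure_def
  by (intro antisym INF_lower2[of "\<lambda>_. {}"]) auto

lemma hausdorff_premeasure_UN:
  "hausdorff_premeasure s \<delta> (\<Union>n. A n) \<le> (\<Sum>n. hausdorff_premeasure s \<delta> (A n))"
proof (rule ennreal_le_epsilon)
  let ?O = "hausdorff_premeasure s \<delta>"
  let ?f = "\<lambda>C. if C = {} then 0 else ennreal (unit_ball_vol (real s) * (diameter C / 2) ^ s)"
  fix e :: real assume "0 < e" and fin: "(\<Sum>n. ?O (A n)) < top"
  then have *: "?O (A n) < ?O (A n) + e * (1/2)^Suc n" for n
    by (auto simp add: less_top dest!: ennreal_suminf_lessD)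
  define P where "P n B \<longleftrightarrow> A n \<subseteq> (\<Union>i::nat. B i) \<and> (\<forall>i. bounded (B i) \<and> diameter (B i) \<le> \<delta>) \<and>
      (\<Sum>i. ?f (B i)) < ?O (A n) + e * (1/2)^Suc n" for n B
  have "\<exists>B. P n B" for n
    using *[of n] unfolding hausdorff_premeasure_def[of s \<delta> "A n"] INF_less_iff P_def by auto
  then obtain B where PB: "\<And>n. P n (B n)" by metis
  have B: "A n \<subseteq> (\<Union>i::nat. B n i)" "bounded (B n i)" "diameter (B n i) \<le> \<delta>"
      "(\<Sum>i. ?f (B n i)) < ?O (A n) + e * (1/2)^Suc n" for n i
    using PB[of n] by (simp_all add: P_def)
  define C where "C = case_prod B o prod_decode"
  have gen: "(\<Sum>i. g (C i)) = (\<Sum>n. \<Sum>i. g (B n i))" for g :: "'a set \<Rightarrow> ennreal"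
    using suminf_ennreal_2dimen[of "\<lambda>n. \<Sum>i. g (B n i)" "\<lambda>p. g (case_prod B p)"]
    by (simp add: C_def comp_def)
  have cov: "(\<Union>n. A n) \<subseteq> (\<Union>i. C i)"
    using B(1) by (auto simp add: C_def subset_eq) (metis prod.case prod_encode_inverse)
  have "?O (\<Union>n. A n) \<le> (\<Sum>i. ?f (C i))"
    unfolding hausdorff_premeasure_def[of s \<delta> "\<Union>n. A n"]
    by (rule INF_lower2[of C]) (use cov B in \<open>auto simp: C_def split: prod.splits\<close>)
  also have "\<dots> = (\<Sum>n. \<Sum>i. ?f (B n i))"
    by (rule gen)
  also have "\<dots> \<le> (\<Sum>n. ?O (A n) + e * (1/2) ^ Suc n)"
    using B(4) by (intro suminf_le allI) (auto intro: less_imp_le)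
  also have "... = (\<Sum>n. ?O (A n)) + (\<Sum>n. ennreal e * ennreal ((1/2) ^ Suc n))"
    using \<open>0 < e\<close> by (subst suminf_add[symmetric])
                     (auto simp del: ennreal_suminf_cmult simp add: ennreal_mult[symmetric])
  also have "\<dots> = (\<Sum>n. ?O (A n)) + e"
    unfolding ennreal_suminf_cmult
    by (subst suminf_ennreal_eq[OF zero_le_power power_half_series]) auto
  finally show "?O (\<Union>n. A n) \<le> (\<Sum>n. ?O (A n)) + e" .
qed

lemma hausdorff_premeasure_Un_separated:
  assumes sep: "\<And>x y. x \<in> A \<Longrightarrow> y \<in> B \<Longrightarrow> \<delta> < dist x y"
  shows "hausdorff_premeasure s \<delta> A + hausdorff_premeasure s \<delta> B \<le> hausdorff_premeasure s \<delta> (A \<union> B)"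
  unfolding hausdorff_premeasure_def[of s \<delta> "A \<union> B"]
proof (safe intro!: INF_greatest)
  let ?f = "\<lambda>C. if C = {} then 0 else ennreal (unit_ball_vol (real s) * (diameter C / 2) ^ s)"
  fix C :: "nat \<Rightarrow> 'a set"
  assume cov: "A \<union> B \<subseteq> (\<Union>i. C i)" and C: "\<forall>i. bounded (C i) \<and> diameter (C i) \<le> \<delta>"
  define CA where "CA i = (if C i \<inter> A = {} then {} else C i)" for i
  define CB where "CB i = (if C i \<inter> A = {} then C i else {})" for i
  have disj: "C i \<inter> B = {}" if ne: "C i \<inter> A \<noteq> {}" for i
  proof (rule ccontr)
    assume "C i \<inter> B \<noteq> {}"
    then obtain x y where "x \<in> C i" "x \<in> A" "y \<in> C i" "y \<in> B" using ne by auto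
    then show False
      using sep[of x y] diameter_bounded_bound[of "C i" x y] C[rule_format, of i] by auto
  qed
  have "\<delta> \<ge> 0" using diameter_ge_0[of "C 0"] C[rule_format, of 0] by linarith
  have "hausdorff_premeasure s \<delta> A \<le> (\<Sum>i. ?f (CA i))"
    unfolding hausdorff_premeasure_def
  proof (rule INF_lower2[of CA])
    show "CA \<in> {C. A \<subseteq> (\<Union>i. C i) \<and> (\<forall>i. bounded (C i) \<and> diameter (C i) \<le> \<delta>)}"
      using cov C \<open>\<delta> \<ge> 0\<close> by (fastforce simp: CA_def)
  qed simp
  moreover have "hausdorff_premeasure s \<delta> B \<le> (\<Sum>i. ?f (CB i))"
    unfolding hausdorff_premeasure_def
  proof (rule INF_lower2[of CB])
    show "CB \<in> {C. B \<subseteq> (\<Union>i. C i) \<and> (\<forall>i. bounded (C i) \<and> diameter (C i) \<le> \<delta>)}"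
    proof (intro CollectI conjI allI subsetI)
      fix y assume "y \<in> B"
      then obtain i where "y \<in> C i" using cov by blast
      then have "y \<in> CB i" using disj[of i] \<open>y \<in> B\<close> by (auto simp: CB_def)
      then show "y \<in> (\<Union>i. CB i)" by blast
    qed (use C \<open>\<delta> \<ge> 0\<close> in \<open>auto simp: CB_def\<close>)
  qed simp
  moreover have "(\<Sum>i. ?f (CA i)) + (\<Sum>i. ?f (CB i)) = (\<Sum>i. ?f (CA i) + ?f (CB i))"
    by (rule suminf_add) auto
  moreover have "(\<Sum>i. ?f (CA i) + ?f (CB i)) = (\<Sum>i. ?f (C i))"
    by (rule arg_cong[of _ _ suminf]) (auto simp: CA_def CB_def)
  ultimately show "hausdorff_premeasure s \<delta> A + hausdorff_premeasure s \<delta> B \<le> (\<Sum>i. ?f (C i))"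
    by (metis (no_types, lifting) add_mono)
qed

lemma hausdorff_outer_empty: "hausdorff_outer s {} = 0"
  by (simp add: hausdorff_outer_def hausdorff_premeasure_empty)

lemma hausdorff_outer_mono: "A \<subseteq> B \<Longrightarrow> hausdorff_outer s A \<le> hausdorff_outer s B"
  unfolding hausdorff_outer_def by (rule SUP_subset_mono[OF order_refl]) (rule hausdorff_premeasure_mono)

lemma hausdorff_outer_UN: "hausdorff_outer s (\<Union>n. A n) \<le> (\<Sum>n. hausdorff_outer s (A n))"
  unfolding hausdorff_outer_def[of s "\<Union>n. A n"]
proof (rule SUP_least)
  fix \<delta> :: real assume "\<delta> \<in> {0<..}"
  then have "(\<Sum>n. hausdorff_premeasure s \<delta> (A n)) \<le> (\<Sum>n. hausdorff_outer s (A n))"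
    unfolding hausdorff_outer_def by (intro suminf_le) (auto intro: SUP_upper)
  with hausdorff_premeasure_UN show "hausdorff_premeasure s \<delta> (\<Union>n. A n) \<le> (\<Sum>n. hausdorff_outer s (A n))"
    by (rule order_trans)
qed

lemma outer_measure_space_hausdorff: "outer_measure_space UNIV (hausdorff_outer s)"
  unfolding outer_measure_space_def positive_def increasing_def countably_subadditive_def
  using hausdorff_outer_empty hausdorff_outer_mono hausdorff_outer_UN by blast

lemma hausdorff_outer_Un:
  fixes A B :: "'a::metric_space set"
  shows "hausdorff_outer s (A \<union> B) \<le> hausdorff_outer s A + hausdorff_outer s B"
proof -
  interpret S: sigma_algebra "UNIV :: 'a set" UNIV using sigma_algebra_Pow[of "UNIV :: 'a set"] by (simp only: Pow_UNIV)
  have "subadditive UNIV (hausdorff_outer s :: 'a set \<Rightarrow> ennreal)"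
    using outer_measure_space_hausdorff[of s] unfolding outer_measure_space_def
    by (intro S.countably_subadditive_subadditive) auto
  moreover have "hausdorff_outer s (A \<union> B) = hausdorff_outer s (A \<union> (B - A))" by simp
  ultimately have "hausdorff_outer s (A \<union> B) \<le> hausdorff_outer s A + hausdorff_outer s (B - A)"
    unfolding subadditive_def by (metis Diff_disjoint UNIV_I)
  also have "\<dots> \<le> hausdorff_outer s A + hausdorff_outer s B"
    by (intro add_left_mono hausdorff_outer_mono) auto
  finally show ?thesis .
qed

lemma hausdorff_outer_Un_separated:
  assumes "e > 0" and sep: "\<And>x y. x \<in> A \<Longrightarrow> y \<in> B \<Longrightarrow> e \<le> dist x y"
  shows "hausdorff_outer s A + hausdorff_outer s B \<le> hausdorff_outer s (A \<union> B)"
proof -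
  have "hausdorff_premeasure s \<delta> A + hausdorff_premeasure s \<delta>' B \<le> hausdorff_outer s (A \<union> B)"
    if "\<delta> > 0" "\<delta>' > 0" for \<delta> \<delta>'
  proof -
    define d where "d = min (e/2) (min \<delta> \<delta>')"
    have d: "d > 0" "d < e" "d \<le> \<delta>" "d \<le> \<delta>'" using that assms(1) by (auto simp: d_def)
    have "hausdorff_premeasure s \<delta> A + hausdorff_premeasure s \<delta>' B
        \<le> hausdorff_premeasure s d A + hausdorff_premeasure s d B"
      by (intro add_mono hausdorff_premeasure_antimono d)
    also have "\<dots> \<le> hausdorff_premeasure s d (A \<union> B)"
    proof (rule hausdorff_premeasure_Un_separated)
      show "d < dist x y" if "x \<in> A" "y \<in> B" for x y
        using sep[OF that] d(2) by linarith
    qed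
    also have "\<dots> \<le> hausdorff_outer s (A \<union> B)"
      unfolding hausdorff_outer_def using d(1) by (intro SUP_upper) simp
    finally show ?thesis .
  qed
  note le = this
  have "hausdorff_outer s A + hausdorff_premeasure s \<delta>' B \<le> hausdorff_outer s (A \<union> B)"
    if "\<delta>' > 0" for \<delta>'
  proof -
    have "hausdorff_outer s A + hausdorff_premeasure s \<delta>' B =
        (SUP \<delta>\<in>{0<..}. hausdorff_premeasure s \<delta> A + hausdorff_premeasure s \<delta>' B)"
      unfolding hausdorff_outer_def[of s A] by (rule ennreal_SUP_add_left[symmetric]) auto
    also have "\<dots> \<le> hausdorff_outer s (A \<union> B)" by (rule SUP_least) (use le that in simp)
    finally show ?thesis .
  qed
  note le2 = this
  have "hausdorff_outer s A + hausdorff_outer s B =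
      (SUP \<delta>'\<in>{0<..}. hausdorff_outer s A + hausdorff_premeasure s \<delta>' B)"
    unfolding hausdorff_outer_def[of s B] by (rule ennreal_SUP_add_right) auto
  also have "\<dots> \<le> hausdorff_outer s (A \<union> B)" by (rule SUP_least) (use le2 in simp)
  finally show ?thesis .
qed

lemma hausdorff_outer_closed_split:
  assumes "closed F"
  shows "hausdorff_outer s (X \<inter> F) + hausdorff_outer s (X - F) \<le> hausdorff_outer s X"
proof (cases "F = {} \<or> hausdorff_outer s X = \<infinity>")
  case True
  then show ?thesis by (auto simp: hausdorff_outer_empty)
next
  case False
  let ?H = "hausdorff_outer s"
  have ne: "F \<noteq> {}" and fin: "?H X < \<infinity>" using False by (auto simp: less_top)
  define D where "D n = {x\<in>X. 1 / (real n + 1) \<le> infdist x F}" for n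
  define R where "R n = {x\<in>X. 1 / (real n + 2) \<le> infdist x F \<and> infdist x F < 1 / (real n + 1)}" for n
  have tri: "infdist x F \<le> infdist y F + dist x y" for x y by (rule infdist_triangle)
  have D: "?H (D n) + ?H (X \<inter> F) \<le> ?H X" for n
  proof -
    have "?H (D n) + ?H (X \<inter> F) \<le> ?H (D n \<union> (X \<inter> F))"
    proof (rule hausdorff_outer_Un_separated[of "1 / (real n + 1)"])
      fix x y assume "x \<in> D n" "y \<in> X \<inter> F"
      then show "1 / (real n + 1) \<le> dist x y"
        using tri[of x y] by (auto simp: D_def)
    qed simp
    also have "\<dots> \<le> ?H X" by (rule hausdorff_outer_mono) (auto simp: D_def)
    finally show ?thesis .
  qed
  have R: "(\<Sum>k<n. ?H (R (2 * k + j))) \<le> ?H (\<Union>k<n. R (2 * k + j))" for n j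
  proof (induction n)
    case 0
    then show ?case by simp
  next
    case (Suc n)
    have "(\<Sum>k<Suc n. ?H (R (2 * k + j))) \<le> ?H (\<Union>k<n. R (2 * k + j)) + ?H (R (2 * n + j))"
      using Suc by (simp add: add_right_mono)
    also have "\<dots> \<le> ?H ((\<Union>k<n. R (2 * k + j)) \<union> R (2 * n + j))"
    proof (cases "n = 0")
      case True
      then show ?thesis by (simp add: hausdorff_outer_empty)
    next
      case n: False
      define m where "m = real (2 * n + j)"
      have m: "m \<ge> 2" using n by (simp add: m_def)
      show ?thesis
      proof (rule hausdorff_outer_Un_separated[of "1 / m - 1 / (m + 1)"])
        show "0 < 1 / m - 1 / (m + 1)" using m by (simp add: frac_less2)
      next
        fix x y assume x: "x \<in> (\<Union>k<n. R (2 * k + j))" and y: "y \<in> R (2 * n + j)"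
        from x obtain k where k: "k < n" "1 / (real (2*k+j) + 2) \<le> infdist x F"
          by (auto simp: R_def)
        have "real (2*k+j) + 2 \<le> m" using k(1) by (simp add: m_def)
        then have "1 / m \<le> 1 / (real (2*k+j) + 2)" by (intro divide_left_mono) auto
        moreover have "infdist y F < 1 / (m + 1)" using y by (simp add: R_def m_def)
        ultimately show "1 / m - 1 / (m + 1) \<le> dist x y"
          using k(2) tri[of x y] by linarith
      qed
    qed
    also have "(\<Union>k<n. R (2 * k + j)) \<union> R (2 * n + j) = (\<Union>k<Suc n. R (2 * k + j))"
      by (auto simp: less_Suc_eq)
    finally show ?case .
  qed
  have R': "(\<Sum>k<n. ?H (R (2 * k + j))) \<le> ?H X" for n j
    using R[of j n] by (rule order_trans) (rule hausdorff_outer_mono, auto simp: R_def)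
  have sumR: "(\<Sum>k. ?H (R k)) < \<infinity>"
  proof -
    have "(\<Sum>k<n. ?H (R k)) \<le> ?H X + ?H X" for n
    proof -
      have "(\<Sum>k<n. ?H (R k)) \<le> (\<Sum>k<2*n. ?H (R k))" by (rule sum_mono2) auto
      also have "\<dots> = (\<Sum>k<n. ?H (R (2*k+0))) + (\<Sum>k<n. ?H (R (2*k+1)))"
        by (induction n) (auto simp: algebra_simps)
      also have "\<dots> \<le> ?H X + ?H X" by (intro add_mono R')
      finally show ?thesis .
    qed
    then have "(\<Sum>k. ?H (R k)) \<le> ?H X + ?H X" by (intro suminf_le_const summableI)
    also have "\<dots> < \<infinity>" using fin by simp
    finally show ?thesis .
  qed
  have tail: "?H (X - F) \<le> ?H (D n) + (\<Sum>k. ?H (R (k + n)))" for n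
  proof -
    have "X - F \<subseteq> D n \<union> (\<Union>k. R (k + n))"
    proof
      fix x assume x: "x \<in> X - F"
      then have pos: "infdist x F > 0"
        using assms ne in_closed_iff_infdist_zero[of F x] infdist_nonneg[of x F] by force
      show "x \<in> D n \<union> (\<Union>k. R (k + n))"
      proof (cases "x \<in> D n")
        case nD: False
        obtain N :: nat where N: "inverse (of_nat (Suc N)) < infdist x F"
          using reals_Archimedean[OF pos] by blast
        let ?P = "\<lambda>k. 1 / (real k + 2) \<le> infdist x F"
        have "?P N" 
          using N by (smt (verit) frac_le inverse_eq_divide of_nat_0_le_iff of_nat_Suc)
        define K where "K = (LEAST k. ?P k)"
        have K: "?P K" unfolding K_def by (rule LeastI[of ?P N]) fact
        have up: "infdist x F < 1 / (real K + 1)" if "K \<noteq> 0"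
        proof -
          have "\<not> ?P (K - 1)" using that not_less_Least[of "K - 1" ?P] by (simp add: K_def)
          then show ?thesis using that by (simp add: of_nat_diff add.commute)
        qed
        have nD': "infdist x F < 1 / (real n + 1)" using nD x by (auto simp: D_def)
        have "n \<le> K"
        proof (rule ccontr)
          assume "\<not> n \<le> K"
          then have "real K + 2 \<le> real n + 1" by simp
          then have "1 / (real n + 1) \<le> 1 / (real K + 2)" by (intro divide_left_mono) auto
          then show False using K nD' by linarith
        qed
        moreover have "x \<in> R K"
          using K up nD' x \<open>n \<le> K\<close> by (cases "K = 0") (auto simp: R_def)
        ultimately show ?thesis by (metis UN_iff UNIV_I Un_iff le_add_diff_inverse2)
      qed simp
    qed
    then have "?H (X - F) \<le> ?H (D n \<union> (\<Union>k. R (k + n)))" by (rule hausdorff_outer_mono)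
    also have "\<dots> \<le> ?H (D n) + ?H (\<Union>k. R (k + n))" by (rule hausdorff_outer_Un)
    also have "\<dots> \<le> ?H (D n) + (\<Sum>k. ?H (R (k + n)))" by (intro add_left_mono hausdorff_outer_UN)
    finally show ?thesis .
  qed
  have le: "?H (X \<inter> F) + ?H (X - F) \<le> ?H X + (\<Sum>k. ?H (R (k + n)))" for n
  proof -
    have "?H (X \<inter> F) + ?H (X - F) \<le> ?H (X \<inter> F) + (?H (D n) + (\<Sum>k. ?H (R (k + n))))"
      by (intro add_left_mono tail)
    also have "\<dots> = (?H (D n) + ?H (X \<inter> F)) + (\<Sum>k. ?H (R (k + n)))"
      by (simp add: ac_simps)
    also have "\<dots> \<le> ?H X + (\<Sum>k. ?H (R (k + n)))" by (intro add_right_mono D)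
    finally show ?thesis .
  qed
  have "(\<lambda>n. \<Sum>k. ?H (R (k + n))) \<longlonglongrightarrow> 0"
  proof -
    have finR: "?H (R k) < \<infinity>" for k
      using sumR by (auto simp: less_top dest!: ennreal_suminf_lessD)
    define r where "r k = enn2real (?H (R k))" for k
    have r: "?H (R k) = ennreal (r k)" "0 \<le> r k" for k using finR[of k] by (auto simp: r_def)
    have sm: "summable r"
      using sumR r by (intro summable_suminf_not_top) (auto simp: less_top)
    have "(\<lambda>n. \<Sum>k. r (k + n)) \<longlonglongrightarrow> 0"
    proof -
      have "(\<lambda>n. (\<Sum>k. r k) - (\<Sum>k<n. r k)) \<longlonglongrightarrow> (\<Sum>k. r k) - (\<Sum>k. r k)"
        by (intro tendsto_diff tendsto_const summable_LIMSEQ sm)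
      then show ?thesis by (simp add: suminf_minus_initial_segment[OF sm])
    qed
    then have "(\<lambda>n. ennreal (\<Sum>k. r (k + n))) \<longlonglongrightarrow> ennreal 0" by (rule tendsto_ennrealI)
    moreover have "(\<Sum>k. ?H (R (k + n))) = ennreal (\<Sum>k. r (k + n))" for n
      using r sm by (simp add: suminf_ennreal2 summable_ignore_initial_segment)
    ultimately show ?thesis by simp
  qed
  then have "(\<lambda>n. ?H X + (\<Sum>k. ?H (R (k + n)))) \<longlonglongrightarrow> ?H X + 0"
    by (intro tendsto_add tendsto_const)
  then show ?thesis using le by (intro LIMSEQ_le_const[where X="\<lambda>n. ?H X + (\<Sum>k. ?H (R (k + n)))"]) auto
qed

lemma measure_space_hausdorff: "measure_space UNIV (sets borel) (hausdorff_outer s)"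
proof -
  let ?L = "lambda_system UNIV UNIV (hausdorff_outer s :: 'a set \<Rightarrow> ennreal)"
  interpret S: sigma_algebra "UNIV :: 'a set" UNIV
    using sigma_algebra_Pow[of "UNIV :: 'a set"] by (simp only: Pow_UNIV)
  have L: "measure_space UNIV ?L (hausdorff_outer s)"
    by (rule S.caratheodory_lemma[OF outer_measure_space_hausdorff])
  have cl: "F \<in> ?L" if "closed F" for F :: "'a set"
  proof -
    have "hausdorff_outer s (X \<inter> F) + hausdorff_outer s (X - F) = hausdorff_outer s X" for X :: "'a set"
    proof (rule antisym)
      show "hausdorff_outer s (X \<inter> F) + hausdorff_outer s (X - F) \<le> hausdorff_outer s X"
        using that by (rule hausdorff_outer_closed_split)
      show "hausdorff_outer s X \<le> hausdorff_outer s (X \<inter> F) + hausdorff_outer s (X - F)"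
        using hausdorff_outer_Un[of s "X \<inter> F" "X - F"] by (simp add: Int_Diff_Un)
    qed
    then show ?thesis by (simp add: S.lambda_system_eq)
  qed
  interpret LS: sigma_algebra "UNIV :: 'a set" ?L using L by (simp add: measure_space_def)
  have sub: "sets (borel :: 'a measure) \<subseteq> ?L"
    proof -
    have "sigma_sets UNIV (Collect closed) \<subseteq> ?L"
      using cl by (intro LS.sigma_sets_subset) auto
    then show ?thesis unfolding borel_eq_closed by simp
  qed
  show ?thesis
    using L sub sets.sigma_algebra_axioms[of "borel :: 'a measure"]
    unfolding measure_space_def by (auto simp: positive_def countably_additive_def subset_iff)
qed

text \<open>Completed, so that functions given only up to null sets (normals of piecewise smooth
  surfaces, traces) are measurable.\<close>

definition hausdorff_measure :: "nat \<Rightarrow> 'a::metric_space measure" where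
  "hausdorff_measure s = completion (measure_of UNIV (sets borel) (hausdorff_outer s))"

lemma emeasure_hausdorff_measure:
  assumes "A \<in> sets borel"
  shows "emeasure (hausdorff_measure s) A = hausdorff_outer s A"
proof -
  let ?M = "measure_of UNIV (sets borel) (hausdorff_outer s) :: 'a measure"
  have sets: "sets ?M = sets borel"
    by (metis sets.sigma_sets_eq sets_measure_of space_borel top_greatest Pow_UNIV)
  have "emeasure ?M A = hausdorff_outer s A"
    using measure_space_hausdorff[of s, where ?'a = 'a] assms
    by (intro emeasure_measure_of_sigma) (auto simp: measure_space_def)
  then show ?thesis
    using assms sets by (simp add: hausdorff_measure_def)
qed

definition surface_measure :: "'a::euclidean_space set \<Rightarrow> 'a measure" where
  "surface_measure S = restrict_space (hausdorff_measure (DIM('a) - 1)) S"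

text \<open>The value is \<open>\<infinity>\<close> unless \<open>f\<close> is measurable and square integrable; hence
  \<open>f \<in> L\<^sup>2\<close> is expressed by \<open>L2_norm M f < \<infinity>\<close>.\<close>

definition L2_norm :: "'a measure \<Rightarrow> ('a \<Rightarrow> 'b::real_normed_vector) \<Rightarrow> ennreal" where
  "L2_norm M f =
     (if f \<in> borel_measurable M \<and> (\<integral>\<^sup>+x. ennreal ((norm (f x))\<^sup>2) \<partial>M) < \<infinity>
      then ennreal (sqrt (enn2real (\<integral>\<^sup>+x. ennreal ((norm (f x))\<^sup>2) \<partial>M))) else \<infinity>)"

text \<open>For matrix-valued \<open>f\<close>, \<open>norm\<close> is the Frobenius norm.\<close>

definition Linf_norm :: "'a::euclidean_space set \<Rightarrow> ('a \<Rightarrow> 'b::real_normed_vector) \<Rightarrow> ennreal" where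
  "Linf_norm S f = esssup (lebesgue_on S) (\<lambda>x. ennreal (norm (f x)))"


section \<open>Differentiability, weak gradients and traces\<close>

definition gradient :: "('a::real_inner \<Rightarrow> real) \<Rightarrow> 'a \<Rightarrow> 'a" where
  "gradient f x = (THE D. GDERIV f x :> D)"

primrec Ck_on :: "nat \<Rightarrow> ('a::real_normed_vector \<Rightarrow> 'b::real_normed_vector) \<Rightarrow> 'a set \<Rightarrow> bool" where
  "Ck_on 0 f U \<longleftrightarrow> continuous_on U f"
| "Ck_on (Suc k) f U \<longleftrightarrow> (\<forall>x\<in>U. f differentiable (at x)) \<and>
     (\<forall>w. Ck_on k (\<lambda>x. frechet_derivative f (at x) w) U)"

text \<open>\<open>Ck_on\<close> is meant for open sets. On a set with boundary, such as a closed (curved) element,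
  \<open>C\<^sup>k\<close> means having a \<open>C\<^sup>k\<close> extension to an open neighbourhood.\<close>

definition Ck_extension_on ::
  "nat \<Rightarrow> ('a::real_normed_vector \<Rightarrow> 'b::real_normed_vector) \<Rightarrow> 'a set \<Rightarrow> ('a \<Rightarrow> 'b) \<Rightarrow> bool" where
  "Ck_extension_on k f S F \<longleftrightarrow> (\<exists>U. open U \<and> S \<subseteq> U \<and> Ck_on k F U) \<and> (\<forall>x\<in>S. F x = f x)"

text \<open>Meant for the closed elements of a mesh or their curved images: \<open>C\<^sup>k\<close> inside every element,
  \<open>C\<^sup>1\<close> up to its boundary. (Derivatives of higher order of the deformations need only be bounded,
  not continuous, at the boundary of the elements next to the cut elements.)\<close>

definition elementwise_smooth ::
  "nat \<Rightarrow> ('a::real_normed_vector \<Rightarrow> 'b::real_normed_vector) \<Rightarrow> 'a set set \<Rightarrow> bool" where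
  "elementwise_smooth k f \<T> \<longleftrightarrow>
     (\<forall>T\<in>\<T>. Ck_on k f (interior T) \<and> (\<exists>F. Ck_extension_on 1 f T F))"

definition test_function_on :: "'a::euclidean_space set \<Rightarrow> ('a \<Rightarrow> real) \<Rightarrow> bool" where
  "test_function_on U \<psi> \<longleftrightarrow> (\<forall>k. Ck_on k \<psi> UNIV) \<and>
     (\<exists>K. compact K \<and> K \<subseteq> U \<and> (\<forall>x. x \<notin> K \<longrightarrow> \<psi> x = 0))"

definition locally_integrable_on :: "('a::euclidean_space \<Rightarrow> 'b::euclidean_space) \<Rightarrow> 'a set \<Rightarrow> bool" where
  "locally_integrable_on f U \<longleftrightarrow> (\<forall>K. compact K \<and> K \<subseteq> U \<longrightarrow> f absolutely_integrable_on K)"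

definition has_weak_gradient_on ::
  "('a::euclidean_space \<Rightarrow> real) \<Rightarrow> ('a \<Rightarrow> 'a) \<Rightarrow> 'a set \<Rightarrow> bool" where
  "has_weak_gradient_on v g U \<longleftrightarrow> locally_integrable_on v U \<and> locally_integrable_on g U \<and>
     (\<forall>\<psi>. test_function_on U \<psi> \<longrightarrow>
        (LINT x|lebesgue_on U. v x *\<^sub>R gradient \<psi> x) = - (LINT x|lebesgue_on U. \<psi> x *\<^sub>R g x))"

text \<open>\<open>w\<close> is the trace on \<open>\<Gamma>\<close> of \<open>f\<close>, a function on the open set \<open>U\<close> with
  \<open>\<Gamma> \<subseteq> closure U\<close>: for almost every \<open>y \<in> \<Gamma>\<close>, \<open>w y\<close> is the Lebesgue value of \<open>f\<close> at \<open>y\<close>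
  from within \<open>U\<close>. The set \<open>U\<close> may lie on one side of \<open>\<Gamma>\<close> only.\<close>

definition has_trace_on ::
  "'a::euclidean_space set \<Rightarrow> ('a \<Rightarrow> 'b::euclidean_space) \<Rightarrow> 'a set \<Rightarrow> ('a \<Rightarrow> 'b) \<Rightarrow> bool" where
  "has_trace_on U f \<Gamma> w \<longleftrightarrow> (AE y in surface_measure \<Gamma>.
     ((\<lambda>r. (\<integral>\<^sup>+x\<in>ball y r \<inter> U. ennreal (norm (f x - w y)) \<partial>lebesgue)
           / emeasure lebesgue (ball y r \<inter> U)) \<longlongrightarrow> 0) (at_right 0))"


section \<open>Normals and tangential projections\<close>

definition tangent_cone :: "'a::real_normed_vector set \<Rightarrow> 'a \<Rightarrow> 'a set" where
  "tangent_cone S x = {w. \<exists>(y :: nat \<Rightarrow> 'a) t. (\<forall>k. y k \<in> S \<and> t k > 0) \<and> t \<longlonglongrightarrow> 0 \<and>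
     (\<lambda>k. (y k - x) /\<^sub>R t k) \<longlonglongrightarrow> w}"

text \<open>The unit normal at \<open>x\<close> of the hypersurface \<open>S\<close> separating \<open>A\<close> and \<open>B\<close>, oriented from \<open>A\<close>
  to \<open>B\<close>. It is meaningful wherever \<open>S\<close> has a tangent hyperplane, hence almost everywhere on a
  piecewise smooth surface.\<close>

definition unit_normal :: "'a::real_inner set \<Rightarrow> 'a set \<Rightarrow> 'a set \<Rightarrow> 'a \<Rightarrow> 'a" where
  "unit_normal S A B x = (THE n. norm n = 1 \<and> tangent_cone S x = {w. w \<bullet> n = 0} \<and>
     (\<forall>\<^sub>F t in at_right 0. x - t *\<^sub>R n \<in> A \<and> x + t *\<^sub>R n \<in> B))"

definition tangential_projection :: "real^'n \<Rightarrow> real^'n^'n" where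
  "tangential_projection n = mat 1 - (\<chi> i j. n $ i * n $ j)"


section \<open>Domain and interface\<close>

definition polyhedral_domain :: "'a::euclidean_space set \<Rightarrow> bool" where
  "polyhedral_domain \<Omega> \<longleftrightarrow> connected \<Omega> \<and>
     (\<exists>\<P>. finite \<P> \<and> (\<forall>P\<in>\<P>. polytope P) \<and> \<Omega> = interior (\<Union>\<P>))"

definition interface_geometry ::
  "nat \<Rightarrow> 'a::euclidean_space set \<Rightarrow> 'a set \<Rightarrow> 'a set \<Rightarrow> 'a set \<Rightarrow> ('a \<Rightarrow> real) \<Rightarrow> bool" where
  "interface_geometry q \<Omega> \<Omega>1 \<Omega>2 \<Gamma> \<phi> \<longleftrightarrow>
     polyhedral_domain \<Omega> \<and> connected \<Omega>1 \<and> connected \<Omega>2 \<and> \<Omega> = \<Omega>1 \<union> \<Gamma> \<union> \<Omega>2 \<and> \<Gamma> = frontier \<Omega>1 \<and>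
     \<Gamma> = {x \<in> \<Omega>. \<phi> x = 0} \<and> \<Omega>1 = {x \<in> \<Omega>. \<phi> x < 0} \<and> \<Omega>2 = {x \<in> \<Omega>. \<phi> x > 0} \<and>
     (\<exists>U. open U \<and> \<Gamma> \<subseteq> U \<and> Ck_on (q + 2) \<phi> U) \<and> (\<forall>x\<in>\<Gamma>. gradient \<phi> x \<noteq> 0)"


section \<open>Meshes and finite element spaces\<close>

text \<open>\<open>\<sigma>\<close> is the quasi-uniformity constant: it bounds the ratio of the mesh size \<open>h\<close>
  to the inradius of every element.\<close>

definition quasi_uniform_mesh ::
  "real \<Rightarrow> 'a::euclidean_space set \<Rightarrow> real \<Rightarrow> 'a set set \<Rightarrow> bool" where
  "quasi_uniform_mesh \<sigma> \<Omega> h \<T> \<longleftrightarrow>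
     triangulation \<T> \<and> (\<forall>T\<in>\<T>. int DIM('a) simplex T) \<and> \<Union>\<T> = closure \<Omega> \<and>
     0 < h \<and> h = Max (diameter ` \<T>) \<and> (\<forall>T\<in>\<T>. \<exists>x. ball x (h / \<sigma>) \<subseteq> T)"

definition poly_fun :: "nat \<Rightarrow> (real^'n \<Rightarrow> real) \<Rightarrow> bool" where
  "poly_fun k p \<longleftrightarrow> (\<exists>c :: ('n \<Rightarrow> nat) \<Rightarrow> real. \<forall>x.
     p x = (\<Sum>\<alpha> | sum \<alpha> UNIV \<le> k. c \<alpha> * (\<Prod>i\<in>UNIV. (x $ i) ^ \<alpha> i)))"

definition piecewise_poly :: "nat \<Rightarrow> (real^'n) set set \<Rightarrow> (real^'n \<Rightarrow> real) \<Rightarrow> bool" where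
  "piecewise_poly k \<T> f \<longleftrightarrow> (\<forall>T\<in>\<T>. \<exists>p. poly_fun k p \<and> (\<forall>x\<in>T. f x = p x))"

definition fe_space :: "nat \<Rightarrow> (real^'n) set set \<Rightarrow> (real^'n \<Rightarrow> real) set" where
  "fe_space k \<T> = {f. continuous_on (\<Union>\<T>) f \<and> piecewise_poly k \<T> f}"

definition lagrange_nodes :: "nat \<Rightarrow> 'a::euclidean_space set \<Rightarrow> 'a set" where
  "lagrange_nodes k T = {x. \<exists>m :: 'a \<Rightarrow> nat. (\<Sum>a | a extreme_point_of T. m a) = k \<and>
     x = (\<Sum>a | a extreme_point_of T. (real (m a) / real k) *\<^sub>R a)}"

definition nodal_interpolant ::
  "nat \<Rightarrow> (real^'n) set set \<Rightarrow> (real^'n \<Rightarrow> real) \<Rightarrow> (real^'n \<Rightarrow> real) \<Rightarrow> bool" where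
  "nodal_interpolant k \<T> f g \<longleftrightarrow> g \<in> fe_space k \<T> \<and> (\<forall>T\<in>\<T>. \<forall>x\<in>lagrange_nodes k T. g x = f x)"

definition element_poly :: "nat \<Rightarrow> (real^'n \<Rightarrow> real) \<Rightarrow> (real^'n) set \<Rightarrow> (real^'n \<Rightarrow> real)" where
  "element_poly k f T = (THE p. poly_fun k p \<and> (\<forall>x\<in>T. p x = f x))"


section \<open>The isoparametric mesh deformations\<close>

definition cut_elements :: "'a set set \<Rightarrow> 'a set \<Rightarrow> 'a set set" where
  "cut_elements \<T> \<Gamma>lin = {T \<in> \<T>. T \<inter> \<Gamma>lin \<noteq> {}}"

definition neighbour_elements :: "'a set set \<Rightarrow> 'a set \<Rightarrow> 'a set set" where
  "neighbour_elements \<T> \<Gamma>lin =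
     {T \<in> \<T> - cut_elements \<T> \<Gamma>lin. T \<inter> \<Union>(cut_elements \<T> \<Gamma>lin) \<noteq> {}}"

text \<open>The point \<open>x + t \<nabla>f(x)\<close>, with \<open>t\<close> the number of smallest absolute value such that
  \<open>f\<close> takes the value \<open>c\<close> there.\<close>

definition gradient_shift :: "('a::real_inner \<Rightarrow> real) \<Rightarrow> real \<Rightarrow> 'a \<Rightarrow> 'a" where
  "gradient_shift f c x =
     x + (ARG_MIN abs t. f (x + t *\<^sub>R gradient f x) = c) *\<^sub>R gradient f x"

text \<open>Linear operators extending continuous vector fields on the boundary of the union of the
  cut elements \<open>\<C>\<close> to the neighbouring elements \<open>\<N>\<close> and mapping piecewise polynomials (on the
  boundary faces) to piecewise polynomials.\<close>

definition extension_operator ::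
  "nat \<Rightarrow> (real^'n) set set \<Rightarrow> (real^'n) set set \<Rightarrow>
   ((real^'n \<Rightarrow> real^'n) \<Rightarrow> (real^'n \<Rightarrow> real^'n)) \<Rightarrow> bool" where
  "extension_operator q \<C> \<N> E \<longleftrightarrow> (let B = frontier (\<Union>\<C>) in
     (\<forall>g. continuous_on B g \<longrightarrow>
        continuous_on (\<Union>\<N>) (E g) \<and> (\<forall>x \<in> B \<inter> \<Union>\<N>. E g x = g x)) \<and>
     (\<forall>g g'. (\<forall>x\<in>B. g x = g' x) \<longrightarrow> (\<forall>x \<in> \<Union>\<N>. E g x = E g' x)) \<and>
     (\<forall>g g' a b. continuous_on B g \<and> continuous_on B g' \<longrightarrow>
        (\<forall>x \<in> \<Union>\<N>. E (\<lambda>y. a *\<^sub>R g y + b *\<^sub>R g' y) x = a *\<^sub>R E g x + b *\<^sub>R E g' x)) \<and>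
     (\<forall>g. continuous_on B g \<and>
        (\<forall>i. piecewise_poly q {F. F \<subseteq> B \<and> (\<exists>T\<in>\<C>. F face_of T)} (\<lambda>x. g x $ i)) \<longrightarrow>
        (\<forall>i. piecewise_poly q \<N> (\<lambda>x. E g x $ i))))"

definition mesh_deformations ::
  "nat \<Rightarrow> (real^'n) set \<Rightarrow> (real^'n) set set \<Rightarrow> (real^'n \<Rightarrow> real) \<Rightarrow> (real^'n \<Rightarrow> real) \<Rightarrow>
   (real^'n \<Rightarrow> real) \<Rightarrow> (real^'n \<Rightarrow> real^'n) \<Rightarrow> (real^'n \<Rightarrow> real^'n) \<Rightarrow> bool" where
  "mesh_deformations q \<Omega> \<T> \<phi> \<phi>hat \<phi>h \<Psi> \<Theta> \<longleftrightarrow>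
     (let \<Gamma>lin = {x \<in> \<Omega>. \<phi>hat x = 0};
          \<C> = cut_elements \<T> \<Gamma>lin;
          \<N> = neighbour_elements \<T> \<Gamma>lin;
          \<Psi>hT = (\<lambda>T x. gradient_shift (element_poly q \<phi>h T) (\<phi>hat x) x)
      in
        (\<forall>T\<in>\<C>. \<forall>x\<in>T. \<Psi> x = gradient_shift \<phi> (\<phi>hat x) x) \<and>
        continuous_on \<Omega> \<Psi> \<and> elementwise_smooth (q + 1) \<Psi> \<T> \<and>
        (\<forall>i. (\<lambda>x. \<Theta> x $ i) \<in> fe_space q \<T>) \<and>
        (\<forall>T\<in>\<C>. \<forall>x\<in>lagrange_nodes q T.
           \<Theta> x = (\<Sum>T' | T' \<in> \<C> \<and> x \<in> T'. \<Psi>hT T' x) /\<^sub>R real (card {T' \<in> \<C>. x \<in> T'})) \<and>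
        (\<exists>E. extension_operator q \<C> \<N> E \<and>
           (\<forall>x \<in> \<Union>\<N>. \<Psi> x - x = E (\<lambda>y. \<Psi> y - y) x \<and> \<Theta> x - x = E (\<lambda>y. \<Theta> y - y) x)) \<and>
        (\<forall>x \<in> \<Union>(\<T> - \<C> - \<N>). \<Psi> x = x \<and> \<Theta> x = x))"

definition Phi_map ::
  "'a set \<Rightarrow> ('a \<Rightarrow> 'a) \<Rightarrow> ('a \<Rightarrow> 'a) \<Rightarrow> ('a \<Rightarrow> 'a)" where
  "Phi_map \<Omega> \<Psi> \<Theta> = \<Psi> \<circ> inv_into \<Omega> \<Theta>"

text \<open>\<open>D\<close> is an elementwise Jacobian of \<open>\<Phi>\<close>: on the curved element \<open>\<Theta>(T)\<close> it is the Jacobian of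
  \<open>\<Phi>\<close> restricted to \<open>\<Theta>(T)\<close>, taken up to the boundary (and computed from any \<open>C\<^sup>1\<close> extension).
  At points shared by several curved elements, \<open>D\<close> may take the value from any of them; this
  matters when a mesh facet is contained in the discrete interface.\<close>

definition elementwise_jacobian ::
  "(real^'n) set \<Rightarrow> (real^'n) set set \<Rightarrow> (real^'n \<Rightarrow> real^'n) \<Rightarrow> (real^'n \<Rightarrow> real^'n) \<Rightarrow>
   (real^'n \<Rightarrow> real^'n^'n) \<Rightarrow> bool" where
  "elementwise_jacobian \<Omega> \<T> \<Theta> \<Phi> D \<longleftrightarrow>
     (\<forall>x\<in>\<Omega>. \<exists>T\<in>\<T>. \<exists>F. x \<in> \<Theta> ` (T \<inter> \<Omega>) \<and> Ck_extension_on 1 \<Phi> (\<Theta> ` (T \<inter> \<Omega>)) F \<and>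
        (F has_derivative (\<lambda>y. D x *v y)) (at x))"

end

theory Submission
  imports Defs
begin

text \<open>
  Write \<open>\<Gamma>\<^sub>h\<close> for the discrete interface. The map \<open>\<Phi>\<close> takes \<open>\<Gamma>\<^sub>h\<close> onto \<open>\<Gamma>\<close>, and its elementwise
  Jacobian differs from the identity by at most \<open>\<epsilon> = \<bar>C0\<bar> h\<^sup>q\<close>. All estimates come from two
  consequences of this bound.

  \<^item> On small scales \<open>\<Phi>\<close> and its inverse stretch distances by a factor of at most \<open>2\<close>. The Hausdorff
    measure of a set and of its image therefore differ by at most a fixed factor, so that integrals
    over \<open>\<Gamma>\<close> and over \<open>\<Gamma>\<^sub>h\<close> can be compared without any area formula (\<open>near_id_L2_norm\<close>). The
    elementwise bound gives such a Lipschitz bound although segments may cross the element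
    boundaries in a complicated way: near a point only finitely many elements matter, so
    \<open>\<Phi> - id\<close> is pointwise Lipschitz there with constant \<open>c > \<epsilon>\<close>
    (\<open>infinitesimally_near_id_of_jacobian_bound\<close>), and a pointwise Lipschitz bound at all points
    of a convex set is a Lipschitz bound (\<open>norm_diff_le_if_locally_le\<close>).

  \<^item> Where \<open>\<Phi>\<close> restricted to \<open>\<Gamma>\<^sub>h\<close> has the derivative \<open>D\<close>, the tangent cone of \<open>\<Gamma>\<^sub>h\<close> is the preimage
    under \<open>D\<close> of the tangent hyperplane of \<open>\<Gamma>\<close>, whence \<open>n\<^sub>h\<close> is the normalised vector \<open>D\<^sup>T n\<close>
    (\<open>unit_normal_pullback\<close>) and lies within \<open>2 \<epsilon>\<close> of \<open>n\<close>. The pulled-back gradient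
    \<open>D\<^sup>T \<nabla>v\<close> lies within \<open>\<epsilon> \<bar>\<nabla>v\<bar>\<close> of \<open>\<nabla>v\<close>. So the normal and the tangential parts of the two
    gradients differ pointwise by a multiple of \<open>\<epsilon> \<bar>\<nabla>v\<bar>\<close> (\<open>pullback_gradient_estimates\<close>), and
    integrating this gives the estimates (\<open>near_id_surface_estimates\<close>).

  It remains to see that almost every point of \<open>\<Gamma>\<^sub>h\<close> is of the second kind
  (\<open>AE_jacobian_is_derivative_within\<close>). The piecewise affine function \<open>\<phi>hat\<close> vanishes on the common
  face of two elements either in a set of dimension at most \<open>d - 2\<close>, whose image under the piecewise
  polynomial map \<open>\<Theta>\<close> is a null set, or in a set that spans a facet. In the second case \<open>\<phi>hat\<close> has
  no other zeros in the two elements, because an affine function with such zeros would vanish on a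
  whole element, which would give \<open>\<Gamma>\<close> interior points. Hence, apart from a null set, \<open>\<Gamma>\<^sub>h\<close> is
  locally contained in each of the curved elements that contain the point, and there \<open>\<Phi>\<close>
  coincides with a differentiable function.
\<close>

section \<open>Hausdorff measure under Lipschitz maps\<close>

lemma bounded_diameter_lipschitz_image:
  fixes f :: "'a::metric_space \<Rightarrow> 'b::metric_space"
  assumes "bounded S" "L \<ge> 0"
    and lip: "\<And>x y. x \<in> S \<Longrightarrow> y \<in> S \<Longrightarrow> dist (f x) (f y) \<le> L * dist x y"
  shows "bounded (f ` S) \<and> diameter (f ` S) \<le> L * diameter S"
proof -
  have le: "dist (f x) (f y) \<le> L * diameter S" if "x \<in> S" "y \<in> S" for x y
  proof -
    have "dist (f x) (f y) \<le> L * dist x y" by (rule lip[OF that])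
    also have "\<dots> \<le> L * diameter S"
      using diameter_bounded_bound[OF \<open>bounded S\<close> that] \<open>L \<ge> 0\<close> by (rule mult_left_mono)
    finally show ?thesis .
  qed
  have "bounded (f ` S)"
  proof (cases "S = {}")
    case False
    then obtain a where "a \<in> S" by blast
    then show ?thesis unfolding bounded_def by (intro exI[of _ "f a"]) (auto intro: le)
  qed simp
  moreover have "diameter (f ` S) \<le> L * diameter S"
  proof (cases "S = {}")
    case False
    then show ?thesis unfolding diameter_def[of "f ` S"]
      by (auto intro!: cSUP_least le)
  qed (simp add: diameter_def)
  ultimately show ?thesis ..
qed

text \<open>The points in one set of a cover are at most \<open>\<delta>\<close> apart, and \<open>\<delta>\<close> tends to \<open>0\<close> in the Hausdorff
  measure. So a Lipschitz bound on small scales controls the measure of the image.\<close>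

lemma hausdorff_premeasure_lipschitz_image_le:
  fixes f :: "'a::metric_space \<Rightarrow> 'b::metric_space"
  assumes L: "L > 0"
    and lip: "\<And>x y. x \<in> A \<Longrightarrow> y \<in> A \<Longrightarrow> dist x y \<le> \<delta> \<Longrightarrow> dist (f x) (f y) \<le> L * dist x y"
    and le: "L * \<delta> \<le> \<delta>'"
  shows "hausdorff_premeasure s \<delta>' (f ` A) \<le> ennreal (L ^ s) * hausdorff_premeasure s \<delta> A"
proof -
  let ?g = "\<lambda>C::'a set. if C = {} then 0 else ennreal (unit_ball_vol (real s) * (diameter C / 2) ^ s)"
  let ?h = "\<lambda>C::'b set. if C = {} then 0 else ennreal (unit_ball_vol (real s) * (diameter C / 2) ^ s)"
  let ?X = "hausdorff_premeasure s \<delta>' (f ` A)"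
  have cover: "?X \<le> ennreal (L ^ s) * (\<Sum>i. ?g (C i))"
    if C: "A \<subseteq> (\<Union>i::nat. C i)" "\<forall>i. bounded (C i) \<and> diameter (C i) \<le> \<delta>" for C
  proof -
    define B where "B i = f ` (C i \<inter> A)" for i
    have img: "bounded (B i) \<and> diameter (B i) \<le> L * diameter (C i \<inter> A)" for i
      unfolding B_def
    proof (rule bounded_diameter_lipschitz_image)
      show "dist (f x) (f y) \<le> L * dist x y" if "x \<in> C i \<inter> A" "y \<in> C i \<inter> A" for x y
        using that C(2)[rule_format, of i] diameter_bounded_bound[of "C i" x y] lip[of x y] by auto
    qed (use C L in \<open>auto intro: bounded_subset\<close>)
    have sub: "diameter (C i \<inter> A) \<le> diameter (C i)" for i
      using C(2) by (intro diameter_subset) auto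
    have B: "bounded (B i)" "diameter (B i) \<le> L * diameter (C i)" for i
      using img[of i] mult_left_mono[OF sub[of i], of L] L by linarith+
    have "diameter (B i) \<le> \<delta>'" for i
    proof -
      have "L * diameter (C i) \<le> L * \<delta>" using C(2) L by (intro mult_left_mono) auto
      then show ?thesis using B(2)[of i] le by linarith
    qed
    with B have mem: "B \<in> {C. f ` A \<subseteq> (\<Union>i. C i) \<and> (\<forall>i. bounded (C i) \<and> diameter (C i) \<le> \<delta>')}"
      using C(1) by (fastforce simp: B_def)
    have summand: "?h (B i) \<le> ennreal (L ^ s) * ?g (C i)" for i
    proof (cases "B i = {}")
      case False
      then have ne: "C i \<noteq> {}" by (auto simp: B_def)
      have "(diameter (B i) / 2) ^ s \<le> (L * diameter (C i) / 2) ^ s"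
        using B[of i] by (intro power_mono) (auto simp: diameter_ge_0)
      then have "unit_ball_vol (real s) * (diameter (B i) / 2) ^ s
          \<le> unit_ball_vol (real s) * (L * diameter (C i) / 2) ^ s"
        by (rule mult_left_mono) simp
      also have "\<dots> = L ^ s * (unit_ball_vol (real s) * (diameter (C i) / 2) ^ s)"
        by (simp only: power_mult_distrib times_divide_eq_right[symmetric] mult.left_commute)
      finally have "unit_ball_vol (real s) * (diameter (B i) / 2) ^ s
          \<le> L ^ s * (unit_ball_vol (real s) * (diameter (C i) / 2) ^ s)" .
      then have "ennreal (unit_ball_vol (real s) * (diameter (B i) / 2) ^ s)
          \<le> ennreal (L ^ s * (unit_ball_vol (real s) * (diameter (C i) / 2) ^ s))"
        by (rule ennreal_leI)
      also have "\<dots> = ennreal (L ^ s) * ennreal (unit_ball_vol (real s) * (diameter (C i) / 2) ^ s)"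
        using L C(2)[rule_format, of i]
        by (intro ennreal_mult) (auto simp: diameter_ge_0 intro!: mult_nonneg_nonneg)
      finally show ?thesis using False ne by simp
    qed simp
    have "?X \<le> (\<Sum>i. ?h (B i))"
      unfolding hausdorff_premeasure_def by (rule INF_lower2[OF mem]) simp
    also have "\<dots> \<le> (\<Sum>i. ennreal (L ^ s) * ?g (C i))" by (intro suminf_le summand) auto
    also have "\<dots> = ennreal (L ^ s) * (\<Sum>i. ?g (C i))" by (rule ennreal_suminf_cmult)
    finally show ?thesis .
  qed
  let ?r = "ennreal (1 / L ^ s)"
  have "ennreal (L ^ s) * ?r = ennreal (L ^ s * (1 / L ^ s))"
    using L by (intro ennreal_mult[symmetric]) auto
  then have r: "ennreal (L ^ s) * ?r = 1" using L by simp
  have "?r * ?X \<le> hausdorff_premeasure s \<delta> A"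
    unfolding hausdorff_premeasure_def[of s \<delta> A]
  proof (rule INF_greatest)
    fix C assume "C \<in> {C :: nat \<Rightarrow> 'a set. A \<subseteq> (\<Union>i. C i) \<and> (\<forall>i. bounded (C i) \<and> diameter (C i) \<le> \<delta>)}"
    then have "?r * ?X \<le> ?r * (ennreal (L ^ s) * (\<Sum>i. ?g (C i)))"
      by (intro mult_left_mono cover) auto
    also have "\<dots> = (ennreal (L ^ s) * ?r) * (\<Sum>i. ?g (C i))" by (simp only: ac_simps)
    finally show "?r * ?X \<le> (\<Sum>i. ?g (C i))" unfolding r by simp
  qed
  then have "ennreal (L ^ s) * (?r * ?X) \<le> ennreal (L ^ s) * hausdorff_premeasure s \<delta> A"
    by (rule mult_left_mono) simp
  then show ?thesis unfolding mult.assoc[symmetric] r by simp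
qed

lemma hausdorff_outer_lipschitz_image_le:
  fixes f :: "'a::metric_space \<Rightarrow> 'b::metric_space"
  assumes L: "L > 0" and \<delta>0: "\<delta>0 > 0"
    and lip: "\<And>x y. x \<in> A \<Longrightarrow> y \<in> A \<Longrightarrow> dist x y < \<delta>0 \<Longrightarrow> dist (f x) (f y) \<le> L * dist x y"
  shows "hausdorff_outer s (f ` A) \<le> ennreal (L ^ s) * hausdorff_outer s A"
  unfolding hausdorff_outer_def[of s "f ` A"]
proof (rule SUP_least)
  fix \<delta>' :: real assume \<delta>': "\<delta>' \<in> {0<..}"
  define \<delta> where "\<delta> = min (\<delta>0 / 2) (\<delta>' / L)"
  have \<delta>: "\<delta> > 0" "\<delta> < \<delta>0" "L * \<delta> \<le> \<delta>'"
    using L \<delta>0 \<delta>' by (auto simp: \<delta>_def min_def field_simps)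
  have "hausdorff_premeasure s \<delta>' (f ` A) \<le> ennreal (L ^ s) * hausdorff_premeasure s \<delta> A"
    using lip \<delta> by (intro hausdorff_premeasure_lipschitz_image_le[OF L]) auto
  also have "\<dots> \<le> ennreal (L ^ s) * hausdorff_outer s A"
    unfolding hausdorff_outer_def using \<delta>(1) by (intro mult_left_mono SUP_upper) auto
  finally show "hausdorff_premeasure s \<delta>' (f ` A) \<le> ennreal (L ^ s) * hausdorff_outer s A" .
qed

text \<open>Covering \<open>A\<close> by \<open>n^(s - 1)\<close> sets of diameter of order \<open>1/n\<close> is possible for bounded sets of
  dimension \<open>s - 1\<close>; such a cover contributes a term of order \<open>n^(s - 1) (1/n)^s = 1/n\<close>.\<close>

lemma hausdorff_outer_eq_0_cover:
  fixes A :: "'a::metric_space set"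
  assumes s: "s \<ge> 1" and L: "L \<ge> 0"
    and cover: "\<And>n. n \<ge> 1 \<Longrightarrow> \<exists>C. A \<subseteq> (\<Union>i<n ^ (s - 1). C i) \<and>
        (\<forall>i<n ^ (s - 1). bounded (C i) \<and> diameter (C i) \<le> L / real n)"
  shows "hausdorff_outer s A = 0"
proof -
  have "hausdorff_premeasure s \<delta> A \<le> 0" if \<delta>: "\<delta> > 0" for \<delta>
  proof (rule tendsto_lowerbound)
    let ?b = "\<lambda>n. unit_ball_vol (real s) * (L / 2) ^ s * (1 / real n)"
    show "((\<lambda>n. ennreal (?b n)) \<longlongrightarrow> 0) sequentially"
    proof -
      have "(?b \<longlongrightarrow> unit_ball_vol (real s) * (L / 2) ^ s * 0) sequentially"
        by (intro tendsto_intros lim_1_over_n)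
      then show ?thesis by (metis ennreal_0 mult_zero_right tendsto_ennrealI)
    qed
    have "\<forall>\<^sub>F n in sequentially. L / \<delta> < real n"
      using filterlim_real_sequentially by (simp add: filterlim_at_top_dense)
    then show "\<forall>\<^sub>F n in sequentially. hausdorff_premeasure s \<delta> A \<le> ennreal (?b n)"
      using eventually_ge_at_top[of 1]
    proof eventually_elim
      case (elim n)
      then have n: "n \<ge> 1" "L / real n \<le> \<delta>" using \<delta> by (auto simp: field_simps)
      let ?m = "n ^ (s - 1)"
      obtain C where C: "A \<subseteq> (\<Union>i<?m. C i)" "\<And>i. i < ?m \<Longrightarrow> bounded (C i)"
          "\<And>i. i < ?m \<Longrightarrow> diameter (C i) \<le> L / real n"
        using cover[OF n(1)] by blast
      define B where "B i = (if i < ?m then C i else {})" for i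
      let ?h = "\<lambda>C::'a set. if C = {} then 0 else ennreal (unit_ball_vol (real s) * (diameter C / 2) ^ s)"
      have "B \<in> {C. A \<subseteq> (\<Union>i. C i) \<and> (\<forall>i. bounded (C i) \<and> diameter (C i) \<le> \<delta>)}"
        using C n \<delta> by (force simp: B_def intro: order_trans)
      then have "hausdorff_premeasure s \<delta> A \<le> (\<Sum>i. ?h (B i))"
        unfolding hausdorff_premeasure_def by (rule INF_lower2) simp
      also have "\<dots> = (\<Sum>i<?m. ?h (B i))" by (rule suminf_finite) (auto simp: B_def)
      also have "\<dots> \<le> (\<Sum>i<?m. ennreal (unit_ball_vol (real s) * (L / real n / 2) ^ s))"
      proof (rule sum_mono)
        fix i assume i: "i \<in> {..<?m}"
        then have "(diameter (C i) / 2) ^ s \<le> (L / real n / 2) ^ s"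
          using C by (intro power_mono) (auto simp: diameter_ge_0 divide_right_mono)
        then show "?h (B i) \<le> ennreal (unit_ball_vol (real s) * (L / real n / 2) ^ s)"
          using i by (auto simp: B_def intro!: ennreal_leI mult_left_mono)
      qed
      also have "\<dots> = ennreal (real ?m * (unit_ball_vol (real s) * (L / real n / 2) ^ s))"
        using L by (subst sum_ennreal) (auto intro!: mult_nonneg_nonneg)
      also have "real ?m * (unit_ball_vol (real s) * (L / real n / 2) ^ s) = ?b n"
      proof -
        obtain r where r: "s = Suc r" using s by (cases s) auto
        show ?thesis using n(1) unfolding r by (simp add: power_divide field_simps)
      qed
      finally show ?case .
    qed
  qed simp
  then show ?thesis unfolding hausdorff_outer_def by (auto intro!: SUP_eq_const antisym)
qed

lemma hausdorff_outer_lipschitz_image_segment_eq_0: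
  fixes f :: "'a::euclidean_space \<Rightarrow> 'b::metric_space"
  assumes "L-lipschitz_on (closed_segment a b) f"
  shows "hausdorff_outer 2 (f ` closed_segment a b) = 0"
proof (rule hausdorff_outer_eq_0_cover)
  have L: "L \<ge> 0" by (rule lipschitz_on_nonneg[OF assms])
  show "0 \<le> L * dist a b" using L by simp
  fix n :: nat assume n: "n \<ge> 1"
  define c where "c t = a + t *\<^sub>R (b - a)" for t :: real
  have cseg: "c t \<in> closed_segment a b" if "0 \<le> t" "t \<le> 1" for t
    unfolding closed_segment_def c_def using that by (auto simp: algebra_simps intro!: exI[of _ t])
  define C where "C i = f ` c ` {real i / n .. real (Suc i) / n}" for i
  have "f ` closed_segment a b \<subseteq> (\<Union>i<n. C i)"
  proof
    fix y assume "y \<in> f ` closed_segment a b"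
    then obtain t where "0 \<le> t" "t \<le> 1" "y = f ((1 - t) *\<^sub>R a + t *\<^sub>R b)"
      by (auto simp: in_segment)
    moreover have "(1 - t) *\<^sub>R a + t *\<^sub>R b = c t" by (simp add: c_def algebra_simps)
    ultimately have t: "0 \<le> t" "t \<le> 1" "y = f (c t)" by simp_all
    show "y \<in> (\<Union>i<n. C i)"
    proof (cases "t = 1")
      case True
      then have "t \<in> {real (n - 1) / n .. real (Suc (n - 1)) / n}" using n by (auto simp: field_simps)
      then show ?thesis using n t(3) by (auto simp: C_def intro!: bexI[of _ "n - 1"])
    next
      case False
      define i where "i = nat \<lfloor>t * n\<rfloor>"
      have i: "real i \<le> t * n" "t * n < real i + 1" using t n by (auto simp: i_def)
      have "real i < n" using i(1) t False n
        by (smt (verit, best) mult_less_cancel_right2 of_nat_1 of_nat_mono)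
      moreover have "t \<in> {real i / n .. real (Suc i) / n}" using i n by (auto simp: field_simps)
      ultimately show ?thesis using t(3) by (auto simp: C_def intro!: bexI[of _ i])
    qed
  qed
  moreover have "bounded (C i) \<and> diameter (C i) \<le> L * dist a b / real n" if i: "i < n" for i
  proof -
    have 1: "bounded {real i / n .. real (Suc i) / n}" "diameter {real i / n .. real (Suc i) / n} = 1 / n"
      using divide_right_mono[of "real i" "real (Suc i)" "real n"]
      by (auto simp: diff_divide_distrib[symmetric])
    have "bounded ((f \<circ> c) ` {real i / n .. real (Suc i) / n}) \<and>
        diameter ((f \<circ> c) ` {real i / n .. real (Suc i) / n}) \<le> (L * dist a b) * diameter {real i / n .. real (Suc i) / n}"
    proof (rule bounded_diameter_lipschitz_image[OF 1(1)])
      fix t u assume tu: "t \<in> {real i / n .. real (Suc i) / n}" "u \<in> {real i / n .. real (Suc i) / n}"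
      have "real (Suc i) / n \<le> 1" "0 \<le> real i / n" using i by auto
      then have "0 \<le> t" "t \<le> 1" "0 \<le> u" "u \<le> 1" using tu unfolding atLeastAtMost_iff by linarith+
      then have "dist (f (c t)) (f (c u)) \<le> L * dist (c t) (c u)"
        by (intro lipschitz_onD[OF assms] cseg)
      also have "dist (c t) (c u) = dist t u * dist a b"
        by (simp add: c_def dist_norm scaleR_diff_left[symmetric] norm_minus_commute)
      finally show "dist ((f \<circ> c) t) ((f \<circ> c) u) \<le> L * dist a b * dist t u"
        by (simp add: mult_ac)
    qed (use L in simp)
    then show ?thesis unfolding 1(2) by (simp add: C_def image_comp)
  qed
  ultimately show "\<exists>C. f ` closed_segment a b \<subseteq> (\<Union>i<n ^ (2 - 1). C i) \<and>
        (\<forall>i<n ^ (2 - 1). bounded (C i) \<and> diameter (C i) \<le> L * dist a b / real n)"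
    by (intro exI[of _ C]) simp
qed simp

lemma hausdorff_outer_singleton_eq_0: "hausdorff_outer 1 {x} = 0"
  by (rule hausdorff_outer_eq_0_cover[where L = 0]) (auto intro!: exI[of _ "\<lambda>_. {x}"])

text \<open>This makes the kinks of the discrete interface negligible. In the two dimensions \<open>s + 1\<close> of
  interest a compact convex set of dimension less than \<open>s\<close> is a point or a segment, which can be
  covered explicitly.\<close>

lemma hausdorff_outer_lipschitz_image_lowdim_eq_0:
  fixes f :: "'a::euclidean_space \<Rightarrow> 'b::metric_space"
  assumes s: "s \<in> {1, 2}" and G: "compact G" "convex G" "aff_dim G < int s"
    and f: "L-lipschitz_on G f"
  shows "hausdorff_outer s (f ` G) = 0"
proof (cases "G = {}")
  case False
  show ?thesis
  proof (cases "s = 1")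
    case True
    then have "aff_dim G < 1" using G(3) by simp
    moreover have "0 \<le> aff_dim G" using False by (metis aff_dim_negative_iff not_less)
    ultimately have "aff_dim G = 0" by linarith
    then obtain x where "G = {x}" using aff_dim_eq_0 by blast
    then show ?thesis using True hausdorff_outer_singleton_eq_0 by simp
  next
    case False': False
    then have s: "s = 2" using s by simp
    then have "collinear G" using G(3) by (simp add: collinear_aff_dim)
    then obtain a b where "G = closed_segment a b"
      using compact_convex_collinear_segment False G by blast
    then show ?thesis using hausdorff_outer_lipschitz_image_segment_eq_0 f s by blast
  qed
qed (simp add: hausdorff_outer_empty)

section \<open>Integrals and $L^2$ norms over hypersurfaces\<close>

lemma sets_hausdorff_borel: "sets (measure_of UNIV (sets borel) (hausdorff_outer s)) = sets (borel :: 'a::metric_space measure)"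
  by (metis sets.sigma_sets_eq sets_measure_of space_borel top_greatest Pow_UNIV)

lemma sets_borel_subset_hausdorff: "A \<in> sets borel \<Longrightarrow> A \<in> sets (hausdorff_measure s)"
  by (simp add: hausdorff_measure_def sets_hausdorff_borel)

lemma space_hausdorff_measure [simp]: "space (hausdorff_measure s) = UNIV"
  by (simp add: hausdorff_measure_def space_measure_of_conv)

text \<open>The completion only adds subsets of null sets, and on these the outer measure vanishes too.
  So the measure is still given by the outer measure on sets that are not Borel sets.\<close>

lemma emeasure_hausdorff_measure_outer:
  assumes A: "A \<in> sets (hausdorff_measure s)"
  shows "emeasure (hausdorff_measure s) A = hausdorff_outer s A"
proof -
  let ?H = "measure_of UNIV (sets borel) (hausdorff_outer s) :: 'a measure"
  have A': "A \<in> sets (completion ?H)" using A by (simp add: hausdorff_measure_def)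
  have main: "main_part ?H A \<in> sets borel"
    using main_part_sets[OF A'] by (simp add: sets_hausdorff_borel)
  obtain Z where Z: "Z \<in> null_sets ?H" "null_part ?H A \<subseteq> Z" using null_part[OF A'] by blast
  have HB: "emeasure ?H B = hausdorff_outer s B" if "B \<in> sets borel" for B
    using measure_space_hausdorff[of s, where ?'a = 'a] that
    by (intro emeasure_measure_of_sigma) (auto simp: measure_space_def)
  have "hausdorff_outer s Z = 0" using HB[of Z] Z(1) by (auto simp: null_sets_def sets_hausdorff_borel)
  then have null: "hausdorff_outer s (null_part ?H A) = 0"
    using hausdorff_outer_mono[OF Z(2), of s] by simp
  have eq: "A = main_part ?H A \<union> null_part ?H A" using main_part_null_part_Un[OF A'] by simp
  have "hausdorff_outer s A \<le> hausdorff_outer s (main_part ?H A)"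
    using hausdorff_outer_Un[of s "main_part ?H A" "null_part ?H A"] null eq by simp
  moreover have "hausdorff_outer s (main_part ?H A) \<le> hausdorff_outer s A"
    using eq by (intro hausdorff_outer_mono) blast
  moreover have "emeasure (hausdorff_measure s) A = hausdorff_outer s (main_part ?H A)"
    using HB[OF main] by (simp add: hausdorff_measure_def emeasure_completion[OF A'])
  ultimately show ?thesis by simp
qed

lemma space_surface_measure [simp]: "space (surface_measure S) = S"
  by (simp add: surface_measure_def space_restrict_space)

lemma emeasure_surface_measure:
  fixes S :: "'a::euclidean_space set"
  assumes "S \<in> sets borel" "A \<in> sets (surface_measure S)"
  shows "emeasure (surface_measure S) A = hausdorff_outer (DIM('a) - 1) A"
proof -
  have S: "S \<in> sets (hausdorff_measure (DIM('a) - 1))" by (rule sets_borel_subset_hausdorff[OF assms(1)])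
  then have A: "A \<in> sets (hausdorff_measure (DIM('a) - 1))" "A \<subseteq> S"
    using assms(2) by (auto simp: surface_measure_def sets_restrict_space_iff)
  then show ?thesis
    using S by (simp add: surface_measure_def emeasure_restrict_space emeasure_hausdorff_measure_outer)
qed

lemma sets_surface_measureI:
  assumes "S \<in> sets borel" "A \<in> sets borel" "A \<subseteq> S"
  shows "A \<in> sets (surface_measure S)"
  using assms by (simp add: surface_measure_def sets_restrict_space_iff sets_borel_subset_hausdorff)

lemma complete_measure_surface_measure:
  assumes "S \<in> sets borel"
  shows "complete_measure (surface_measure S)"
proof
  fix A B assume BA: "B \<subseteq> A" and A: "A \<in> null_sets (surface_measure S)"
  let ?M = "hausdorff_measure (DIM('a) - 1) :: 'a measure"
  interpret complete_measure ?M unfolding hausdorff_measure_def by (rule completion.complete_measure_axioms)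
  have S: "S \<in> sets ?M" by (rule sets_borel_subset_hausdorff[OF assms])
  have "A \<in> null_sets ?M" "A \<subseteq> S"
    using A S by (auto simp: surface_measure_def null_sets_restrict_space)
  then have "B \<in> sets ?M" "B \<subseteq> S" using BA complete by auto
  then show "B \<in> sets (surface_measure S)" using S by (simp add: surface_measure_def sets_restrict_space_iff)
qed

lemma borel_measurable_surface_measure_continuous:
  fixes f :: "'a::euclidean_space \<Rightarrow> 'b::topological_space"
  assumes S: "S \<in> sets borel" and f: "continuous_on S f"
  shows "f \<in> borel_measurable (surface_measure S)"
proof (rule measurableI)
  fix B :: "'b set" assume "B \<in> sets borel"
  then have "f -` B \<inter> S \<in> sets (restrict_space borel S)"
    using measurable_sets[OF borel_measurable_continuous_on_restrict[OF f], of B]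
    by (simp add: space_restrict_space)
  then have "f -` B \<inter> S \<in> sets borel" using S by (simp add: sets_restrict_space_iff)
  then show "f -` B \<inter> space (surface_measure S) \<in> sets (surface_measure S)"
    using S by (auto intro: sets_surface_measureI)
qed simp

text \<open>A continuous map is Borel measurable. For measurability with respect to the completed measures
  preimages of null sets must be null sets, which the comparison of outer measures ensures.\<close>

lemma measurable_surface_map:
  fixes f :: "'a::euclidean_space \<Rightarrow> 'a"
  assumes S: "S \<in> sets borel" "S' \<in> sets borel" and f: "continuous_on S f" "f ` S \<subseteq> S'"
    and le: "\<And>B. hausdorff_outer (DIM('a) - 1) (S \<inter> f -` B) \<le> K * hausdorff_outer (DIM('a) - 1) B"
  shows "f \<in> measurable (surface_measure S) (surface_measure S')"
proof -
  let ?s = "DIM('a) - 1"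
  let ?H = "measure_of UNIV (sets borel) (hausdorff_outer ?s) :: 'a measure"
  interpret complete_measure "surface_measure S" by (rule complete_measure_surface_measure[OF S(1)])
  have fb: "f \<in> borel_measurable (surface_measure S)"
    by (rule borel_measurable_surface_measure_continuous[OF S(1) f(1)])
  then have fH: "f \<in> measurable (surface_measure S) ?H"
    using measurable_cong_sets[OF refl sets_hausdorff_borel[of ?s, where 'a='a]] by blast
  have "f \<in> measurable (surface_measure S) (completion ?H)"
  proof (rule measurable_completion2[OF fH], rule subsetI)
    fix B assume B: "B \<in> null_sets ?H"
    then have Bb: "B \<in> sets borel" by (auto simp: null_sets_def sets_hausdorff_borel)
    have "emeasure ?H B = hausdorff_outer ?s B"
      using measure_space_hausdorff[of ?s, where ?'a = 'a] Bb
      by (intro emeasure_measure_of_sigma) (auto simp: measure_space_def)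
    then have "hausdorff_outer ?s B = 0" using B by (simp add: null_sets_def)
    then have "hausdorff_outer ?s (S \<inter> f -` B) = 0" using le[of B] by simp
    moreover have "S \<inter> f -` B \<in> sets (surface_measure S)"
      using measurable_sets[OF fb Bb] by (simp add: Int_commute)
    ultimately have "emeasure (surface_measure S) (f -` B \<inter> S) = 0"
      using emeasure_surface_measure[OF S(1)] by (simp add: Int_commute)
    then show "B \<in> null_sets (distr (surface_measure S) ?H f)"
      using fH B by (auto simp: null_sets_def emeasure_distr)
  qed
  then show ?thesis
    unfolding surface_measure_def[of S'] hausdorff_measure_def
    using f(2) by (intro measurable_restrict_space2) auto
qed

text \<open>The image measure of the measure on \<open>S\<close> is at most \<open>K\<close> times the measure on \<open>S'\<close>. This
  inequality takes the place of a change of variables formula.\<close>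

lemma nn_integral_surface_map_le:
  fixes f :: "'a::euclidean_space \<Rightarrow> 'a"
  assumes S: "S \<in> sets borel" "S' \<in> sets borel" and f: "continuous_on S f" "f ` S \<subseteq> S'"
    and le: "\<And>B. hausdorff_outer (DIM('a) - 1) (S \<inter> f -` B) \<le> K * hausdorff_outer (DIM('a) - 1) B"
    and g: "g \<in> borel_measurable (surface_measure S')"
  shows "(\<integral>\<^sup>+x. g (f x) \<partial>surface_measure S) \<le> K * (\<integral>\<^sup>+x. g x \<partial>surface_measure S')"
proof -
  let ?N = "surface_measure S" and ?N' = "surface_measure S'"
  have fm: "f \<in> measurable ?N ?N'" by (rule measurable_surface_map[OF S f le])
  have "(\<integral>\<^sup>+x. g (f x) \<partial>?N) = (\<integral>\<^sup>+x. g x \<partial>distr ?N ?N' f)"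
    using fm g by (simp add: nn_integral_distr)
  also have "\<dots> \<le> (\<integral>\<^sup>+x. g x \<partial>scale_measure K ?N')"
  proof (rule nn_integral_mono_measure)
    show "distr ?N ?N' f \<le> scale_measure K ?N'"
    proof (rule le_measure[THEN iffD2], simp, intro ballI)
      fix A show "emeasure (distr ?N ?N' f) A \<le> emeasure (scale_measure K ?N') A"
      proof (cases "A \<in> sets ?N'")
        case True
        have m: "f -` A \<inter> S \<in> sets ?N" using measurable_sets[OF fm True] by simp
        have "emeasure (distr ?N ?N' f) A = emeasure ?N (f -` A \<inter> S)"
          using emeasure_distr[OF fm True] by simp
        also have "\<dots> = hausdorff_outer (DIM('a) - 1) (S \<inter> f -` A)"
          using emeasure_surface_measure[OF S(1) m] by (simp add: Int_commute)
        also have "\<dots> \<le> K * hausdorff_outer (DIM('a) - 1) A" by (rule le)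
        also have "\<dots> = emeasure (scale_measure K ?N') A"
          using emeasure_surface_measure[OF S(2) True] by simp
        finally show ?thesis .
      qed (simp add: emeasure_notin_sets)
    qed
  qed simp_all
  also have "\<dots> = K * (\<integral>\<^sup>+x. g x \<partial>?N')" using g by (rule nn_integral_scale_measure)
  finally show ?thesis .
qed

lemma L2_norm_measurable:
  "f \<in> borel_measurable M \<Longrightarrow> L2_norm M f =
     (if (\<integral>\<^sup>+x. ennreal ((norm (f x))\<^sup>2) \<partial>M) < \<infinity>
      then ennreal (sqrt (enn2real (\<integral>\<^sup>+x. ennreal ((norm (f x))\<^sup>2) \<partial>M))) else \<infinity>)"
  by (simp add: L2_norm_def)

lemma L2_norm_finiteD:
  assumes "L2_norm M f < \<infinity>"
  shows "f \<in> borel_measurable M" "(\<integral>\<^sup>+x. ennreal ((norm (f x))\<^sup>2) \<partial>M) < \<infinity>"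
  using assms unfolding L2_norm_def by (auto split: if_splits)

lemma L2_norm_le_of_integral_le:
  fixes f :: "'a \<Rightarrow> 'c::real_normed_vector" and g :: "'b \<Rightarrow> 'd::real_normed_vector"
  assumes f: "f \<in> borel_measurable M" and k: "k > 0"
    and le: "(\<integral>\<^sup>+x. ennreal ((norm (f x))\<^sup>2) \<partial>M) \<le> ennreal (k\<^sup>2) * (\<integral>\<^sup>+x. ennreal ((norm (g x))\<^sup>2) \<partial>N)"
  shows "L2_norm M f \<le> ennreal k * L2_norm N g"
proof (cases "L2_norm N g < \<infinity>")
  case True
  let ?I = "\<integral>\<^sup>+x. ennreal ((norm (f x))\<^sup>2) \<partial>M" and ?J = "\<integral>\<^sup>+x. ennreal ((norm (g x))\<^sup>2) \<partial>N"
  have g: "g \<in> borel_measurable N" and J: "?J < \<infinity>" using L2_norm_finiteD[OF True] by auto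
  have KJ: "ennreal (k\<^sup>2) * ?J < \<infinity>" using J by (simp add: ennreal_mult_less_top)
  then have I: "?I < \<infinity>" using le by (rule order.strict_trans1[rotated])
  have "enn2real ?I \<le> enn2real (ennreal (k\<^sup>2) * ?J)" using le KJ by (intro enn2real_mono) auto
  then have "sqrt (enn2real ?I) \<le> sqrt (k\<^sup>2 * enn2real ?J)" by (simp add: enn2real_mult)
  also have "\<dots> = k * sqrt (enn2real ?J)" using k by (simp add: real_sqrt_mult)
  finally show ?thesis using f g I J k
    by (simp add: L2_norm_measurable ennreal_mult[symmetric] ennreal_leI)
next
  case False
  then have "ennreal k * L2_norm N g = \<infinity>" using k by (simp add: not_less ennreal_mult_eq_top_iff top_unique)
  then show ?thesis by simp
qed

text \<open>This replaces Minkowski's inequality at the price of a factor \<open>2\<close>, which comes from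
  \<open>(x + y)\<^sup>2 \<le> 2 x\<^sup>2 + 2 y\<^sup>2\<close>.\<close>

lemma L2_norm_le_of_AE_le_add:
  fixes f :: "'a \<Rightarrow> 'b::real_normed_vector" and a :: "'a \<Rightarrow> 'c::real_normed_vector"
    and b :: "'a \<Rightarrow> 'd::real_normed_vector"
  assumes f: "f \<in> borel_measurable M" and a: "L2_norm M a < \<infinity>" and \<alpha>: "\<alpha> \<ge> 0"
    and le: "AE x in M. norm (f x) \<le> \<alpha> * norm (a x) + norm (b x)"
  shows "L2_norm M f \<le> 2 * (ennreal \<alpha> * L2_norm M a + L2_norm M b)"
proof (cases "L2_norm M b < \<infinity>")
  case b: True
  let ?I = "\<lambda>f. \<integral>\<^sup>+x. ennreal ((norm (f x))\<^sup>2) \<partial>M"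
  note am = L2_norm_finiteD[OF a] and bm = L2_norm_finiteD[OF b]
  have "?I f \<le> (\<integral>\<^sup>+x. ennreal (2 * \<alpha>\<^sup>2) * ennreal ((norm (a x))\<^sup>2) + ennreal 2 * ennreal ((norm (b x))\<^sup>2) \<partial>M)"
  proof (rule nn_integral_mono_AE, use le in eventually_elim)
    fix x assume "norm (f x) \<le> \<alpha> * norm (a x) + norm (b x)"
    then have "(norm (f x))\<^sup>2 \<le> (\<alpha> * norm (a x) + norm (b x))\<^sup>2" by (intro power_mono) auto
    also have "\<dots> \<le> 2 * (\<alpha> * norm (a x))\<^sup>2 + 2 * (norm (b x))\<^sup>2"
      using zero_le_power2[of "\<alpha> * norm (a x) - norm (b x)"]
      by (simp add: power2_sum power2_diff)
    also have "\<dots> = (2 * \<alpha>\<^sup>2) * (norm (a x))\<^sup>2 + 2 * (norm (b x))\<^sup>2" by (simp add: power_mult_distrib)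
    finally have "ennreal ((norm (f x))\<^sup>2) \<le> ennreal ((2 * \<alpha>\<^sup>2) * (norm (a x))\<^sup>2 + 2 * (norm (b x))\<^sup>2)"
      by (rule ennreal_leI)
    then show "ennreal ((norm (f x))\<^sup>2) \<le>
        ennreal (2 * \<alpha>\<^sup>2) * ennreal ((norm (a x))\<^sup>2) + ennreal 2 * ennreal ((norm (b x))\<^sup>2)"
      by (simp add: ennreal_plus ennreal_mult)
  qed
  also have "\<dots> = ennreal (2 * \<alpha>\<^sup>2) * ?I a + ennreal 2 * ?I b"
  proof -
    have "(\<lambda>x. ennreal ((norm (a x))\<^sup>2)) \<in> borel_measurable M" "(\<lambda>x. ennreal ((norm (b x))\<^sup>2)) \<in> borel_measurable M"
      using am(1) bm(1) by measurable
    then show ?thesis by (simp add: nn_integral_add nn_integral_cmult)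
  qed
  finally have le: "?I f \<le> ennreal (2 * \<alpha>\<^sup>2) * ?I a + ennreal 2 * ?I b" .
  obtain A where A: "?I a = ennreal A" "A \<ge> 0" using am(2) by (cases "?I a") auto
  obtain B where B: "?I b = ennreal B" "B \<ge> 0" using bm(2) by (cases "?I b") auto
  have If: "?I f \<le> ennreal (2 * \<alpha>\<^sup>2 * A + 2 * B)"
    using le A B by (simp add: ennreal_plus ennreal_mult)
  then obtain F where F: "?I f = ennreal F" "F \<ge> 0" by (cases "?I f") (auto simp: top_unique)
  have "F \<le> 2 * \<alpha>\<^sup>2 * A + 2 * B" using If F A B by (simp add: ennreal_le_iff del: ennreal_plus)
  also have "\<dots> \<le> (2 * (\<alpha> * sqrt A + sqrt B))\<^sup>2"
  proof -
    have "(2 * (\<alpha> * sqrt A + sqrt B))\<^sup>2 = 4 * \<alpha>\<^sup>2 * A + 4 * B + 8 * (\<alpha> * sqrt A * sqrt B)"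
      using A B by (simp add: power2_sum power_mult_distrib algebra_simps)
    moreover have "0 \<le> \<alpha> * sqrt A * sqrt B" "0 \<le> \<alpha>\<^sup>2 * A" using A B \<alpha> by simp_all
    ultimately show ?thesis using B(2) by linarith
  qed
  finally have "sqrt F \<le> 2 * (\<alpha> * sqrt A + sqrt B)"
    using A B \<alpha> by (intro real_le_lsqrt) auto
  then have "ennreal (sqrt F) \<le> ennreal (2 * (\<alpha> * sqrt A + sqrt B))" by (rule ennreal_leI)
  also have "\<dots> = 2 * (ennreal \<alpha> * ennreal (sqrt A) + ennreal (sqrt B))"
    using A B \<alpha> by (simp add: ennreal_mult ennreal_plus)
  finally have "ennreal (sqrt F) \<le> 2 * (ennreal \<alpha> * ennreal (sqrt A) + ennreal (sqrt B))" .
  then show ?thesis using f am(1) bm(1) F A B by (simp add: L2_norm_measurable)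
next
  case False
  then have "L2_norm M b = \<infinity>" by (simp add: not_less top_unique)
  then show ?thesis by (simp add: ennreal_mult_eq_top_iff)
qed

section \<open>Maps that are infinitesimally near the identity\<close>

text \<open>A mean value inequality without derivatives: on a segment the local bounds on both sides of
  each point can be chained, by bisection of the parameter interval. It applies
  to maps that are only elementwise smooth.\<close>

lemma norm_diff_le_if_locally_le:
  fixes f :: "'a::real_normed_vector \<Rightarrow> 'b::real_normed_vector"
  assumes S: "convex S" "x \<in> S" "y \<in> S"
    and loc: "\<And>z. z \<in> S \<Longrightarrow> \<forall>\<^sub>F w in at z within S. norm (f w - f z) \<le> c * norm (w - z)"
  shows "norm (f y - f x) \<le> c * norm (y - x)"
proof -
  define p where "p t = x + t *\<^sub>R (y - x)" for t :: real
  have pS: "p t \<in> S" if "0 \<le> t" "t \<le> 1" for t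
  proof -
    have "(1 - t) *\<^sub>R x + t *\<^sub>R y \<in> S" using S that by (intro convexD) auto
    then show ?thesis by (simp add: p_def algebra_simps)
  qed
  define P where "P s t \<longleftrightarrow> (0 \<le> s \<and> s \<le> t \<and> t \<le> 1 \<longrightarrow>
      norm (f (p t) - f (p s)) \<le> c * norm (y - x) * (t - s))" for s t
  have pd: "norm (p t - p s) = \<bar>t - s\<bar> * norm (y - x)" for s t
    by (simp add: p_def scaleR_diff_left[symmetric])
  have "P 0 1"
  proof (rule Bolzano)
    show "(0::real) \<le> 1" by simp
  next
    fix r s t :: real assume P: "P r s" "P s t" and le: "r \<le> s" "s \<le> t"
    show "P r t" unfolding P_def
    proof (intro impI, elim conjE)
      assume "0 \<le> r" "r \<le> t" "t \<le> 1"
      with P le have "norm (f (p s) - f (p r)) \<le> c * norm (y - x) * (s - r)"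
        "norm (f (p t) - f (p s)) \<le> c * norm (y - x) * (t - s)"
        by (auto simp: P_def)
      moreover have "norm (f (p t) - f (p r)) \<le> norm (f (p t) - f (p s)) + norm (f (p s) - f (p r))"
        using norm_triangle_ineq[of "f (p t) - f (p s)" "f (p s) - f (p r)"] by simp
      ultimately show "norm (f (p t) - f (p r)) \<le> c * norm (y - x) * (t - r)"
        by (simp add: algebra_simps)
    qed
  next
    fix r :: real assume r: "0 \<le> r" "r \<le> 1"
    obtain e where e: "e > 0"
      "\<And>w. w \<in> S \<Longrightarrow> w \<noteq> p r \<Longrightarrow> dist w (p r) < e \<Longrightarrow> norm (f w - f (p r)) \<le> c * norm (w - p r)"
      using loc[OF pS[OF r]] unfolding eventually_at by blast
    define d where "d = e / (norm (y - x) + 1)"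
    have d: "d > 0" using e(1) by (simp add: d_def add_nonneg_pos)
    have near: "norm (f (p t) - f (p r)) \<le> c * norm (y - x) * \<bar>t - r\<bar>"
      if "0 \<le> t" "t \<le> 1" "\<bar>t - r\<bar> < d" for t
    proof (cases "p t = p r")
      case True
      then have "\<bar>t - r\<bar> * norm (y - x) = 0" using pd[of t r] by simp
      then show ?thesis using True by auto
    next
      case False
      have "\<bar>t - r\<bar> * norm (y - x) \<le> \<bar>t - r\<bar> * (norm (y - x) + 1)" by (intro mult_left_mono) auto
      also have "\<dots> < e"
        using that(3) norm_ge_zero[of "y - x"] unfolding d_def
        by (subst (asm) pos_less_divide_eq) (auto simp: add_nonneg_pos)
      finally have "dist (p t) (p r) < e" by (simp add: dist_norm pd)
      from e(2)[OF pS[OF that(1,2)] False this] show ?thesis by (simp add: pd mult_ac)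
    qed
    show "\<exists>d>0. \<forall>s t. s \<le> r \<and> r \<le> t \<and> t - s < d \<longrightarrow> P s t"
    proof (intro exI[of _ d] conjI d allI impI, elim conjE)
      fix s t assume st: "s \<le> r" "r \<le> t" "t - s < d"
      show "P s t" unfolding P_def
      proof (intro impI, elim conjE)
        assume "0 \<le> s" "s \<le> t" "t \<le> 1"
        then have "norm (f (p t) - f (p r)) \<le> c * norm (y - x) * (t - r)"
          "norm (f (p s) - f (p r)) \<le> c * norm (y - x) * (r - s)"
          using near[of t] near[of s] st r by auto
        moreover have "norm (f (p t) - f (p s)) \<le> norm (f (p t) - f (p r)) + norm (f (p s) - f (p r))"
          using norm_triangle_ineq4[of "f (p t) - f (p r)" "f (p s) - f (p r)"] by simp
        ultimately show "norm (f (p t) - f (p s)) \<le> c * norm (y - x) * (t - s)"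
          by (simp add: algebra_simps)
      qed
    qed
  qed
  then show ?thesis by (simp add: P_def p_def)
qed

text \<open>This is a pointwise substitute for \<open>\<parallel>D\<Phi> - I\<parallel> \<le> c\<close> that makes sense also at points on
  element boundaries, where an elementwise smooth map has no derivative.\<close>

definition infinitesimally_near_id :: "real \<Rightarrow> ('a::real_normed_vector \<Rightarrow> 'a) \<Rightarrow> 'a set \<Rightarrow> bool" where
  "infinitesimally_near_id c \<Phi> \<Omega> \<longleftrightarrow>
     (\<forall>x\<in>\<Omega>. \<forall>\<^sub>F y in at x. norm (\<Phi> y - \<Phi> x - (y - x)) \<le> c * norm (y - x))"

lemma near_id_on_compact:
  fixes \<Phi> :: "'a::euclidean_space \<Rightarrow> 'a"
  assumes \<Omega>: "open \<Omega>" and K: "compact K" "K \<subseteq> \<Omega>" and near: "infinitesimally_near_id c \<Phi> \<Omega>"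
  shows "\<exists>\<delta>>0. \<forall>x\<in>K. \<forall>y. dist x y < \<delta> \<longrightarrow> norm (\<Phi> y - \<Phi> x - (y - x)) \<le> c * norm (y - x)"
proof -
  obtain \<delta> where \<delta>: "\<delta> > 0" "(\<Union>x\<in>K. ball x \<delta>) \<subseteq> \<Omega>"
    using compact_subset_open_imp_ball_epsilon_subset[OF K(1) \<Omega> K(2)] by blast
  have eq: "(\<Phi> y - y) - (\<Phi> x - x) = \<Phi> y - \<Phi> x - (y - x)" for x y by simp
  have "norm (\<Phi> y - \<Phi> x - (y - x)) \<le> c * norm (y - x)" if x: "x \<in> K" and y: "dist x y < \<delta>" for x y
  proof -
    have "norm ((\<Phi> y - y) - (\<Phi> x - x)) \<le> c * norm (y - x)"
    proof (rule norm_diff_le_if_locally_le)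
      show "convex (ball x \<delta>)" by (rule convex_ball)
      show "x \<in> ball x \<delta>" "y \<in> ball x \<delta>" using y \<delta>(1) by simp_all
      fix z assume "z \<in> ball x \<delta>"
      then have "z \<in> \<Omega>" using \<delta>(2) x by blast
      then have "\<forall>\<^sub>F w in at z. norm (\<Phi> w - \<Phi> z - (w - z)) \<le> c * norm (w - z)"
        using near by (simp only: infinitesimally_near_id_def)
      then show "\<forall>\<^sub>F w in at z within ball x \<delta>. norm ((\<Phi> w - w) - (\<Phi> z - z)) \<le> c * norm (w - z)"
        unfolding eq by (rule filter_leD[OF at_le[OF subset_UNIV]])
    qed
    then show ?thesis unfolding eq .
  qed
  then show ?thesis using \<delta>(1) by blast
qed

text \<open>If \<open>\<Phi> - id\<close> has the Lipschitz constant \<open>1/4\<close> on a small scale, then \<open>\<Phi>\<close> has the Lipschitz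
  constant \<open>5/4\<close> and its inverse has \<open>4/3\<close>. For the inverse the scale is passed on by its uniform
  continuity on the compact image.\<close>

lemma near_id_lipschitz_both_ways:
  fixes \<Phi> :: "'a::euclidean_space \<Rightarrow> 'a"
  assumes \<Omega>: "open \<Omega>" and K: "compact K" "K \<subseteq> \<Omega>" and near: "infinitesimally_near_id (1/4) \<Phi> \<Omega>"
    and cont: "continuous_on K \<Phi>" and inj: "inj_on \<Phi> K"
  shows "\<exists>\<delta>>0. (\<forall>x\<in>K. \<forall>y\<in>K. dist x y < \<delta> \<longrightarrow> dist (\<Phi> x) (\<Phi> y) \<le> 2 * dist x y) \<and>
    (\<forall>x\<in>\<Phi> ` K. \<forall>y\<in>\<Phi> ` K. dist x y < \<delta> \<longrightarrow>
       dist (inv_into K \<Phi> x) (inv_into K \<Phi> y) \<le> 2 * dist x y)"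
proof -
  obtain \<delta>1 where \<delta>1: "\<delta>1 > 0"
    and near1: "\<forall>x\<in>K. \<forall>y. dist x y < \<delta>1 \<longrightarrow> norm (\<Phi> y - \<Phi> x - (y - x)) \<le> 1/4 * norm (y - x)"
    using near_id_on_compact[OF \<Omega> K near] by (elim exE conjE)
  have inv: "continuous_on (\<Phi> ` K) (inv_into K \<Phi>)"
    using inj by (intro continuous_on_inv[OF cont K(1)]) simp
  have "uniformly_continuous_on (\<Phi> ` K) (inv_into K \<Phi>)"
    by (intro compact_uniformly_continuous inv compact_continuous_image cont K(1))
  then obtain \<delta>2 where "\<delta>2 > 0"
    "\<forall>x\<in>\<Phi> ` K. \<forall>y\<in>\<Phi> ` K. dist y x < \<delta>2 \<longrightarrow> dist (inv_into K \<Phi> y) (inv_into K \<Phi> x) < \<delta>1"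
    using \<delta>1 unfolding uniformly_continuous_on_def by blast
  then have \<delta>2: "\<delta>2 > 0"
    "\<And>x y. x \<in> \<Phi> ` K \<Longrightarrow> y \<in> \<Phi> ` K \<Longrightarrow> dist x y < \<delta>2 \<Longrightarrow> dist (inv_into K \<Phi> x) (inv_into K \<Phi> y) < \<delta>1"
    by blast+
  show ?thesis
  proof (intro exI[of _ "min \<delta>1 \<delta>2"] conjI ballI impI)
    show "min \<delta>1 \<delta>2 > 0" using \<delta>1 \<delta>2(1) by simp
  next
    fix x y assume "x \<in> K" "y \<in> K" "dist x y < min \<delta>1 \<delta>2"
    then have "norm (\<Phi> y - \<Phi> x - (y - x)) \<le> 1/4 * norm (y - x)" using near1 by simp
    moreover have "norm (\<Phi> y - \<Phi> x) \<le> norm (\<Phi> y - \<Phi> x - (y - x)) + norm (y - x)"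
      using norm_triangle_ineq[of "\<Phi> y - \<Phi> x - (y - x)" "y - x"] by simp
    ultimately have "norm (\<Phi> y - \<Phi> x) \<le> 2 * norm (y - x)" using norm_ge_zero[of "y - x"] by linarith
    then show "dist (\<Phi> x) (\<Phi> y) \<le> 2 * dist x y" by (simp add: dist_norm norm_minus_commute)
  next
    fix x y assume xy: "x \<in> \<Phi> ` K" "y \<in> \<Phi> ` K" "dist x y < min \<delta>1 \<delta>2"
    define x' y' where "x' = inv_into K \<Phi> x" and "y' = inv_into K \<Phi> y"
    have *: "x' \<in> K" "y' \<in> K" "x = \<Phi> x'" "y = \<Phi> y'"
      using xy by (simp_all add: x'_def y'_def inv_into_into f_inv_into_f)
    have "dist x' y' < \<delta>1" using \<delta>2(2)[OF xy(1,2)] xy(3) by (simp add: x'_def y'_def)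
    then have "norm (\<Phi> y' - \<Phi> x' - (y' - x')) \<le> 1/4 * norm (y' - x')" using near1 *(1) by blast
    moreover have "norm (y' - x') \<le> norm (\<Phi> y' - \<Phi> x') + norm (\<Phi> y' - \<Phi> x' - (y' - x'))"
      using norm_triangle_ineq4[of "\<Phi> y' - \<Phi> x'" "\<Phi> y' - \<Phi> x' - (y' - x')"] by simp
    ultimately have "norm (y' - x') \<le> 2 * norm (y - x)" using norm_ge_zero[of "y' - x'"] unfolding *(3,4) by linarith
    then show "dist (inv_into K \<Phi> x) (inv_into K \<Phi> y) \<le> 2 * dist x y"
      by (simp add: dist_norm norm_minus_commute x'_def y'_def)
  qed
qed

text \<open>The Hausdorff measures of dimension \<open>s = d - 1 \<le> 2\<close> differ by a factor of at most
  \<open>2\<^sup>s \<le> 2\<^sup>2\<close>, so the norms differ by at most its square root \<open>2\<close>.\<close>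

lemma near_id_L2_norm:
  fixes \<Phi> :: "'a::euclidean_space \<Rightarrow> 'a" and w :: "'a \<Rightarrow> 'b::{real_normed_vector, second_countable_topology}"
  assumes dim: "DIM('a) \<le> 3" and \<Omega>: "open \<Omega>" and K: "compact K" "K \<subseteq> \<Omega>"
    and near: "infinitesimally_near_id (1/4) \<Phi> \<Omega>"
    and cont: "continuous_on K \<Phi>" and inj: "inj_on \<Phi> K"
    and w: "w \<in> borel_measurable (surface_measure (\<Phi> ` K))"
  shows near_id_measurable: "(\<lambda>x. w (\<Phi> x)) \<in> borel_measurable (surface_measure K)"
    and near_id_L2_norm_le: "L2_norm (surface_measure K) (\<lambda>x. w (\<Phi> x)) \<le> 2 * L2_norm (surface_measure (\<Phi> ` K)) w"
    and near_id_L2_norm_ge: "L2_norm (surface_measure (\<Phi> ` K)) w \<le> 2 * L2_norm (surface_measure K) (\<lambda>x. w (\<Phi> x))"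
proof -
  let ?s = "DIM('a) - 1" and ?g = "inv_into K \<Phi>"
  obtain \<delta> where \<delta>: "\<delta> > 0"
    "\<forall>x\<in>K. \<forall>y\<in>K. dist x y < \<delta> \<longrightarrow> dist (\<Phi> x) (\<Phi> y) \<le> 2 * dist x y"
    "\<forall>x\<in>\<Phi> ` K. \<forall>y\<in>\<Phi> ` K. dist x y < \<delta> \<longrightarrow> dist (?g x) (?g y) \<le> 2 * dist x y"
    using near_id_lipschitz_both_ways[OF \<Omega> K near cont inj] by (elim exE conjE)
  have K': "compact (\<Phi> ` K)" by (rule compact_continuous_image[OF cont K(1)])
  have borel: "K \<in> sets borel" "\<Phi> ` K \<in> sets borel" using K(1) K' by (auto intro: borel_compact)
  have inv: "continuous_on (\<Phi> ` K) ?g"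
    using inj by (intro continuous_on_inv[OF cont K(1)]) simp
  have two: "ennreal (2 ^ ?s) \<le> ennreal (2\<^sup>2)"
    using dim by (intro ennreal_leI power_increasing) auto
  have le1: "hausdorff_outer ?s (K \<inter> \<Phi> -` B) \<le> ennreal (2\<^sup>2) * hausdorff_outer ?s B" for B
  proof -
    have "K \<inter> \<Phi> -` B = ?g ` (\<Phi> ` K \<inter> B)"
    proof (intro equalityI subsetI)
      fix x assume "x \<in> K \<inter> \<Phi> -` B"
      then have "x = ?g (\<Phi> x)" "\<Phi> x \<in> \<Phi> ` K \<inter> B" using inj by simp_all
      then show "x \<in> ?g ` (\<Phi> ` K \<inter> B)" by (rule image_eqI)
    next
      fix x assume "x \<in> ?g ` (\<Phi> ` K \<inter> B)"
      then obtain u where "u \<in> K" "\<Phi> u \<in> B" "x = ?g (\<Phi> u)" by blast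
      then show "x \<in> K \<inter> \<Phi> -` B" using inj by simp
    qed
    moreover have "hausdorff_outer ?s (?g ` (\<Phi> ` K \<inter> B)) \<le> ennreal (2 ^ ?s) * hausdorff_outer ?s (\<Phi> ` K \<inter> B)"
    proof (rule hausdorff_outer_lipschitz_image_le[OF _ \<delta>(1)])
      show "dist (?g x) (?g y) \<le> 2 * dist x y"
        if "x \<in> \<Phi> ` K \<inter> B" "y \<in> \<Phi> ` K \<inter> B" "dist x y < \<delta>" for x y
        using \<delta>(3) that by blast
    qed simp
    ultimately have "hausdorff_outer ?s (K \<inter> \<Phi> -` B) \<le> ennreal (2 ^ ?s) * hausdorff_outer ?s (\<Phi> ` K \<inter> B)"
      by (simp only:)
    also have "\<dots> \<le> ennreal (2\<^sup>2) * hausdorff_outer ?s B"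
      by (intro mult_mono two hausdorff_outer_mono) auto
    finally show ?thesis .
  qed
  have le2: "hausdorff_outer ?s (\<Phi> ` K \<inter> ?g -` B) \<le> ennreal (2\<^sup>2) * hausdorff_outer ?s B" for B
  proof -
    have "\<Phi> ` K \<inter> ?g -` B = \<Phi> ` (K \<inter> B)"
    proof (intro equalityI subsetI)
      fix x assume "x \<in> \<Phi> ` K \<inter> ?g -` B"
      then obtain u where "u \<in> K" "x = \<Phi> u" "?g (\<Phi> u) \<in> B" by blast
      then show "x \<in> \<Phi> ` (K \<inter> B)" using inj by simp
    next
      fix x assume "x \<in> \<Phi> ` (K \<inter> B)"
      then obtain u where "u \<in> K" "u \<in> B" "x = \<Phi> u" by blast
      then show "x \<in> \<Phi> ` K \<inter> ?g -` B" using inj by simp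
    qed
    moreover have "hausdorff_outer ?s (\<Phi> ` (K \<inter> B)) \<le> ennreal (2 ^ ?s) * hausdorff_outer ?s (K \<inter> B)"
    proof (rule hausdorff_outer_lipschitz_image_le[OF _ \<delta>(1)])
      show "dist (\<Phi> x) (\<Phi> y) \<le> 2 * dist x y" if "x \<in> K \<inter> B" "y \<in> K \<inter> B" "dist x y < \<delta>" for x y
        using \<delta>(2) that by blast
    qed simp
    ultimately have "hausdorff_outer ?s (\<Phi> ` K \<inter> ?g -` B) \<le> ennreal (2 ^ ?s) * hausdorff_outer ?s (K \<inter> B)"
      by (simp only:)
    also have "\<dots> \<le> ennreal (2\<^sup>2) * hausdorff_outer ?s B"
      by (intro mult_mono two hausdorff_outer_mono) auto
    finally show ?thesis .
  qed
  have "\<Phi> \<in> measurable (surface_measure K) (surface_measure (\<Phi> ` K))"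
    by (rule measurable_surface_map[OF borel cont order_refl le1])
  from measurable_compose[OF this w]
  show m: "(\<lambda>x. w (\<Phi> x)) \<in> borel_measurable (surface_measure K)" .
  have w2: "(\<lambda>x. ennreal ((norm (w x))\<^sup>2)) \<in> borel_measurable (surface_measure (\<Phi> ` K))"
    using w by measurable
  have m2: "(\<lambda>x. ennreal ((norm (w (\<Phi> x)))\<^sup>2)) \<in> borel_measurable (surface_measure K)"
    using m by measurable
  have "L2_norm (surface_measure K) (\<lambda>x. w (\<Phi> x)) \<le> ennreal 2 * L2_norm (surface_measure (\<Phi> ` K)) w"
    by (rule L2_norm_le_of_integral_le[OF m _ nn_integral_surface_map_le[OF borel cont order_refl le1 w2]]) simp
  then show "L2_norm (surface_measure K) (\<lambda>x. w (\<Phi> x)) \<le> 2 * L2_norm (surface_measure (\<Phi> ` K)) w" by simp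
  have "(\<integral>\<^sup>+x. ennreal ((norm (w x))\<^sup>2) \<partial>surface_measure (\<Phi> ` K))
      = (\<integral>\<^sup>+x. ennreal ((norm (w (\<Phi> (?g x))))\<^sup>2) \<partial>surface_measure (\<Phi> ` K))"
    by (rule nn_integral_cong) (simp add: f_inv_into_f)
  also have "\<dots> \<le> ennreal (2\<^sup>2) * (\<integral>\<^sup>+x. ennreal ((norm (w (\<Phi> x)))\<^sup>2) \<partial>surface_measure K)"
    by (rule nn_integral_surface_map_le[OF borel(2,1) inv _ le2 m2]) (auto intro: inv_into_into)
  finally have "L2_norm (surface_measure (\<Phi> ` K)) w \<le> ennreal 2 * L2_norm (surface_measure K) (\<lambda>x. w (\<Phi> x))"
    by (intro L2_norm_le_of_integral_le w) simp_all
  then show "L2_norm (surface_measure (\<Phi> ` K)) w \<le> 2 * L2_norm (surface_measure K) (\<lambda>x. w (\<Phi> x))" by simp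
qed

section \<open>Tangent cones and unit normals\<close>

lemma has_derivative_gradient:
  fixes f :: "'a::euclidean_space \<Rightarrow> real"
  assumes "f differentiable at x"
  shows "(f has_derivative (\<lambda>h. h \<bullet> gradient f x)) (at x)"
proof -
  obtain f' where f': "(f has_derivative f') (at x)" using assms by (auto simp: differentiable_def)
  then have lin: "linear f'" by (rule has_derivative_linear)
  have "\<exists>D. GDERIV f x :> D"
  proof -
    have "f' = (\<lambda>h. h \<bullet> (adjoint f' 1))"
      using adjoint_works[OF lin, of _ 1] by (auto simp: fun_eq_iff inner_real_def)
    then show ?thesis unfolding gderiv_def using f' by metis
  qed
  then obtain D where D: "GDERIV f x :> D" by blast
  have "GDERIV f x :> gradient f x"
    unfolding gradient_def
  proof (rule theI[of "\<lambda>D. GDERIV f x :> D", OF D])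
    fix D' assume "GDERIV f x :> D'"
    then have "(\<lambda>h. h \<bullet> D') = (\<lambda>h. h \<bullet> D)"
      using D unfolding gderiv_def by (rule has_derivative_unique)
    then have "(D' - D) \<bullet> (D' - D) = 0" by (metis inner_diff_right right_minus_eq)
    then show "D' = D" by simp
  qed
  then show ?thesis by (simp add: gderiv_def)
qed

lemma tangent_coneI:
  assumes "\<And>k. y k \<in> S" "\<And>k. t k > 0" "t \<longlonglongrightarrow> 0" "(\<lambda>k. (y k - x) /\<^sub>R t k) \<longlonglongrightarrow> w"
  shows "w \<in> tangent_cone S x"
  using assms unfolding tangent_cone_def by blast

lemma norm_le_of_quotient_le:
  fixes v :: "'a::real_normed_vector"
  assumes "norm (v /\<^sub>R t) \<le> M" "t > 0"
  shows "norm v \<le> M * t"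
proof -
  have "norm v / t \<le> M" using assms by (simp add: divide_inverse mult.commute)
  then show ?thesis using assms(2) by (simp add: pos_divide_le_eq)
qed

lemma tangent_cone_tendsto:
  fixes y :: "nat \<Rightarrow> 'a::real_normed_vector"
  assumes "\<And>k. t k > 0" "t \<longlonglongrightarrow> 0" "(\<lambda>k. (y k - x) /\<^sub>R t k) \<longlonglongrightarrow> w"
  shows "y \<longlonglongrightarrow> x"
proof -
  have "(\<lambda>k. x + t k *\<^sub>R ((y k - x) /\<^sub>R t k)) \<longlonglongrightarrow> x + 0 *\<^sub>R w"
    by (intro tendsto_intros assms)
  moreover have "x + t k *\<^sub>R ((y k - x) /\<^sub>R t k) = y k" for k using assms(1)[of k] by simp
  ultimately show ?thesis by simp
qed

text \<open>The derivative of a function within a set determines the limits of difference quotients along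
  sequences in the set, which are the limits that define tangent cones.\<close>

lemma has_derivative_difference_quotients:
  fixes f :: "'a::real_normed_vector \<Rightarrow> 'b::real_normed_vector"
  assumes f: "(f has_derivative f') (at x within S)"
    and y: "\<And>k. y k \<in> S" "y \<longlonglongrightarrow> x" and t: "\<And>k. t k > 0"
    and bnd: "\<And>k. norm (y k - x) \<le> M * t k"
  shows "(\<lambda>k. (f (y k) - f x) /\<^sub>R t k - f' ((y k - x) /\<^sub>R t k)) \<longlonglongrightarrow> 0"
proof (rule tendstoI)
  fix e :: real assume e: "e > 0"
  have lin: "linear f'" using f by (rule has_derivative_linear)
  have M: "M \<ge> 0" using bnd[of 0] t[of 0] norm_ge_zero[of "y 0 - x"]
    by (smt (verit) mult_neg_pos)
  define c where "c = e / (M + 1)"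
  have c: "c > 0" using e M by (simp add: c_def)
  then obtain d where d: "d > 0"
    "\<And>z. z \<in> S \<Longrightarrow> norm (z - x) < d \<Longrightarrow> norm (f z - f x - f' (z - x)) \<le> c * norm (z - x)"
    using f unfolding has_derivative_within_alt by meson
  have "\<forall>\<^sub>F k in sequentially. dist (y k) x < d" using y(2) d(1) by (rule tendstoD)
  then show "\<forall>\<^sub>F k in sequentially. dist ((f (y k) - f x) /\<^sub>R t k - f' ((y k - x) /\<^sub>R t k)) 0 < e"
  proof eventually_elim
    case (elim k)
    have "(f (y k) - f x) /\<^sub>R t k - f' ((y k - x) /\<^sub>R t k) = (f (y k) - f x - f' (y k - x)) /\<^sub>R t k"
      unfolding linear_scale[OF lin, of "inverse (t k)"] by (simp add: scaleR_diff_right)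
    moreover have "norm (f (y k) - f x - f' (y k - x)) \<le> c * norm (y k - x)"
      using d(2)[OF y(1)] elim by (simp add: dist_norm)
    moreover have "c * norm (y k - x) \<le> c * (M * t k)" using bnd[of k] c by simp
    moreover have "c * (M * t k) < e * t k"
      using e M t[of k] by (simp add: c_def field_simps)
    moreover have "norm ((f (y k) - f x - f' (y k - x)) /\<^sub>R t k) = norm (f (y k) - f x - f' (y k - x)) / t k"
      using t[of k] by (simp add: divide_inverse mult.commute)
    moreover have "norm (f (y k) - f x - f' (y k - x)) / t k < e"
      using calculation(2-4) t[of k] by (subst pos_divide_less_eq) linarith+
    ultimately show ?case by (simp only: dist_0_norm dist_norm diff_zero)
  qed
qed

text \<open>The inclusion from right to left rests on the intermediate value theorem. If \<open>w\<close> is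
  orthogonal to the gradient, then \<open>f\<close> changes its sign on a short segment through \<open>x + t w\<close> in
  the direction of the gradient, whose length is small compared with \<open>t\<close>, and so it has a zero there.\<close>

lemma tangent_cone_level_set:
  fixes f :: "'a::euclidean_space \<Rightarrow> real"
  assumes U: "open U" "x \<in> U" and f: "continuous_on U f" "(f has_derivative (\<lambda>h. h \<bullet> g)) (at x)"
    and g: "g \<noteq> 0" and fx: "f x = 0"
  shows "tangent_cone {y \<in> U. f y = 0} x = {w. w \<bullet> g = 0}"
proof (intro set_eqI iffI)
  fix w assume "w \<in> tangent_cone {y \<in> U. f y = 0} x"
  then obtain y t where yt: "\<And>k. y k \<in> U" "\<And>k. f (y k) = 0" "\<And>k::nat. t k > 0" "t \<longlonglongrightarrow> 0"
      "(\<lambda>k. (y k - x) /\<^sub>R t k) \<longlonglongrightarrow> w"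
    unfolding tangent_cone_def by blast
  have y: "y \<longlonglongrightarrow> x" by (rule tangent_cone_tendsto[OF yt(3-5)])
  have "Bseq (\<lambda>k. (y k - x) /\<^sub>R t k)" using yt(5) by (intro convergent_imp_Bseq convergentI)
  then obtain M where M: "\<And>k. norm ((y k - x) /\<^sub>R t k) \<le> M" by (auto simp: Bseq_def)
  have bnd: "norm (y k - x) \<le> M * t k" for k
    using M[of k] yt(3)[of k] by (rule norm_le_of_quotient_le)
  have "(\<lambda>k. (f (y k) - f x) /\<^sub>R t k - ((y k - x) /\<^sub>R t k) \<bullet> g) \<longlonglongrightarrow> 0"
    by (rule has_derivative_difference_quotients[OF f(2) _ y yt(3) bnd]) simp
  then have "(\<lambda>k. - (((y k - x) /\<^sub>R t k) \<bullet> g)) \<longlonglongrightarrow> 0" using yt(2) fx by simp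
  moreover have "(\<lambda>k. - (((y k - x) /\<^sub>R t k) \<bullet> g)) \<longlonglongrightarrow> - (w \<bullet> g)"
    by (intro tendsto_intros yt)
  ultimately show "w \<in> {w. w \<bullet> g = 0}" using LIMSEQ_unique by fastforce
next
  fix w assume "w \<in> {w. w \<bullet> g = 0}"
  then have w: "w \<bullet> g = 0" by simp
  have ex: "\<exists>y t. y \<in> U \<and> f y = 0 \<and> t > 0 \<and> t < e \<and> norm ((y - x) /\<^sub>R t - w) \<le> e" if e: "e > 0" for e :: real
  proof -
    define n where "n = g /\<^sub>R norm g"
    have n: "norm n = 1" "n \<bullet> g = norm g" using g
      by (auto simp: n_def inner_commute dot_square_norm power2_eq_square)
    define \<eta> where "\<eta> = min e 1"
    have \<eta>: "\<eta> > 0" "\<eta> \<le> e" "\<eta> \<le> 1" using e by (auto simp: \<eta>_def)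
    \<comment> \<open>With this accuracy the linearisation error at \<open>x + t (w + s n)\<close> is at most \<open>t \<eta> \<bar>g\<bar> / 2\<close>,
      half of the size of the linear term for \<open>s = \<plusminus>\<eta>\<close>.\<close>
    define c where "c = \<eta> * norm g / (2 * (norm w + 1))"
    have c: "c > 0" using \<eta> g by (simp add: c_def add_nonneg_pos)
    obtain d where d: "d > 0" "\<And>z. norm (z - x) < d \<Longrightarrow> norm (f z - f x - (z - x) \<bullet> g) \<le> c * norm (z - x)"
      using f(2) c unfolding has_derivative_within_alt by (metis UNIV_I)
    obtain d' where d': "d' > 0" "ball x d' \<subseteq> U" using U by (meson open_contains_ball)
    define t where "t = min (e / 2) (min d d' / (2 * (norm w + 1)))"
    have t: "t > 0" "t < e" "t * (norm w + 1) < min d d'"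
    proof -
      have "norm w + 1 > 0" by (simp add: add_nonneg_pos)
      then show "t > 0" using d d' e by (simp add: t_def)
      show "t < e" using e by (simp add: t_def)
      have "t \<le> min d d' / (2 * (norm w + 1))" by (simp add: t_def)
      then have "t * (norm w + 1) \<le> min d d' / 2" using \<open>norm w + 1 > 0\<close> by (simp add: field_simps)
      then show "t * (norm w + 1) < min d d'" using d d' by linarith
    qed
    define z where "z s = x + t *\<^sub>R (w + s *\<^sub>R n)" for s
    have zn: "norm (z s - x) \<le> t * (norm w + 1)" if "\<bar>s\<bar> \<le> \<eta>" for s
    proof -
      have "norm (w + s *\<^sub>R n) \<le> norm w + \<bar>s\<bar>" using norm_triangle_ineq[of w "s *\<^sub>R n"] n by simp
      then show ?thesis using that \<eta> t(1) by (simp add: z_def)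
    qed
    have zU: "z s \<in> U" if "\<bar>s\<bar> \<le> \<eta>" for s
      using zn[OF that] t(3) d'(2) by (auto simp: dist_norm norm_minus_commute subset_eq)
    have est: "\<bar>f (z s) - t * s * norm g\<bar> \<le> t * \<eta> * norm g / 2" if "\<bar>s\<bar> \<le> \<eta>" for s
    proof -
      have "norm (f (z s) - f x - (z s - x) \<bullet> g) \<le> c * norm (z s - x)"
        using d(2)[of "z s"] zn[OF that] t(3) by simp
      also have "\<dots> \<le> c * (t * (norm w + 1))" using zn[OF that] c by simp
      also have "\<dots> = t * \<eta> * norm g / 2" 
        using norm_ge_zero[of w] by (simp add: c_def field_simps add_nonneg_eq_0_iff)
      also have "(z s - x) \<bullet> g = t * s * norm g" using w n by (simp add: z_def inner_add_left)
      finally show ?thesis using fx by simp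
    qed
    have cont: "continuous_on {-\<eta>..\<eta>} (\<lambda>s. f (z s))"
      by (rule continuous_on_compose2[OF f(1)]) (auto simp: z_def intro!: continuous_intros zU[unfolded z_def])
    have pos: "t * \<eta> * norm g > 0" using t \<eta> g by simp
    have "\<bar>f (z (- \<eta>)) + t * \<eta> * norm g\<bar> \<le> t * \<eta> * norm g / 2" using est[of "- \<eta>"] \<eta>(1) by simp
    then have "f (z (- \<eta>)) \<le> 0" using pos by linarith
    moreover have "0 \<le> f (z \<eta>)" using est[of \<eta>] \<eta>(1) pos unfolding abs_le_iff by linarith
    ultimately obtain s where s: "- \<eta> \<le> s" "s \<le> \<eta>" "f (z s) = 0"
      using IVT'[OF _ _ _ cont, of 0] \<eta> by auto
    have "norm ((z s - x) /\<^sub>R t - w) = \<bar>s\<bar>" using t(1) n by (simp add: z_def)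
    then show ?thesis using s zU[of s] t \<eta> by (intro exI[of _ "z s"] exI[of _ t]) auto
  qed
  define e where "e k = 1 / real (Suc k)" for k
  have epos: "e k > 0" for k by (simp add: e_def)
  from ex[OF epos] obtain y t where yt: "\<And>k. y k \<in> U" "\<And>k. f (y k) = 0" "\<And>k. t k > 0" "\<And>k. t k < e k"
      "\<And>k. norm ((y k - x) /\<^sub>R t k - w) \<le> e k" by metis
  have e0: "e \<longlonglongrightarrow> 0" unfolding e_def by (rule LIMSEQ_Suc[OF lim_1_over_n])
  have t0: "t \<longlonglongrightarrow> 0"
    by (rule tendsto_sandwich[OF _ _ tendsto_const e0]) (auto intro!: always_eventually less_imp_le yt)
  have "(\<lambda>k. (y k - x) /\<^sub>R t k - w) \<longlonglongrightarrow> 0"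
    by (rule Lim_null_comparison[OF _ e0]) (auto intro!: always_eventually yt(5))
  then have "(\<lambda>k. (y k - x) /\<^sub>R t k) \<longlonglongrightarrow> w" by (simp add: LIM_zero_iff)
  then show "w \<in> tangent_cone {y \<in> U. f y = 0} x"
    using yt t0 by (intro tangent_coneI[of y _ t]) auto
qed

text \<open>The tangent hyperplane determines the normal up to its sign, and the two sides determine the
  sign.\<close>

lemma unit_normal_eqI:
  fixes S :: "'a::euclidean_space set"
  assumes n: "norm n = 1" and cone: "tangent_cone S x = {w. w \<bullet> n = 0}"
    and side: "\<forall>\<^sub>F t in at_right 0. x - t *\<^sub>R n \<in> A \<and> x + t *\<^sub>R n \<in> B" and disj: "A \<inter> B = {}"
  shows "unit_normal S A B x = n"
  unfolding unit_normal_def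
proof (rule the_equality)
  show "norm n = 1 \<and> tangent_cone S x = {w. w \<bullet> n = 0} \<and>
     (\<forall>\<^sub>F t in at_right 0. x - t *\<^sub>R n \<in> A \<and> x + t *\<^sub>R n \<in> B)" using assms by blast
next
  fix m assume m: "norm m = 1 \<and> tangent_cone S x = {w. w \<bullet> m = 0} \<and>
     (\<forall>\<^sub>F t in at_right 0. x - t *\<^sub>R m \<in> A \<and> x + t *\<^sub>R m \<in> B)"
  define c where "c = m \<bullet> n"
  have "n - c *\<^sub>R m \<in> {w. w \<bullet> m = 0}"
    using m by (simp add: c_def inner_diff_left inner_commute[of m] dot_square_norm)
  then have "(n - c *\<^sub>R m) \<bullet> n = 0" using m cone by blast
  then have "c * c = 1" using n by (simp add: c_def inner_diff_left dot_square_norm)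
  have "norm (n - c *\<^sub>R m) ^ 2 = 1 - 2 * c * c + c * c"
  proof -
    have "n \<bullet> n = 1" "m \<bullet> m = 1" "n \<bullet> m = c" "m \<bullet> n = c"
      using n m by (auto simp: dot_square_norm c_def inner_commute)
    then show ?thesis
      unfolding power2_norm_eq_inner by (simp add: inner_diff_left inner_diff_right)
  qed
  also have "\<dots> = 0" using \<open>c * c = 1\<close> by simp
  finally have nm: "n = c *\<^sub>R m" by simp
  have "c \<noteq> -1"
  proof
    assume "c = -1"
    then have "n = - m" using nm by simp
    have "\<forall>\<^sub>F t in at_right 0. x - t *\<^sub>R m \<in> A \<and> x + t *\<^sub>R m \<in> B" using m by blast
    with side have "\<forall>\<^sub>F t::real in at_right 0. False"
    proof eventually_elim
      case (elim t)
      then have "x + t *\<^sub>R m \<in> A \<inter> B" using \<open>n = - m\<close> by simp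
      then show False using disj by blast
    qed
    then show False by simp
  qed
  then have "c = 1" using \<open>c * c = 1\<close> by (metis square_eq_1_iff)
  then show "m = n" using nm by simp
qed

text \<open>The derivative of \<open>\<Phi>\<close> within \<open>S\<close> maps tangent directions of \<open>S\<close> to tangent
  directions of the image; conversely, a sequence in the image can be lifted to \<open>S\<close>, because \<open>A\<close> is
  bounded below and hence \<open>\<Phi>\<close> does not contract distances to \<open>y\<close> by more than a fixed factor.\<close>

lemma tangent_cone_preimage:
  fixes \<Phi> :: "'a::euclidean_space \<Rightarrow> 'a"
  assumes der: "(\<Phi> has_derivative A) (at y within S)" and y: "y \<in> S"
    and inj: "inj_on \<Phi> S" and inv: "continuous_on (\<Phi> ` S) (inv_into S \<Phi>)"
    and near: "\<And>w. norm (A w - w) \<le> e * norm w" and e: "e < 1" "e \<ge> 0"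
  shows "tangent_cone S y = {w. A w \<in> tangent_cone (\<Phi> ` S) (\<Phi> y)}"
proof (intro set_eqI iffI)
  have lin: "bounded_linear A" using der by (rule has_derivative_bounded_linear)
  fix w assume "w \<in> tangent_cone S y"
  then obtain z t where zt: "\<And>k. z k \<in> S" "\<And>k::nat. t k > 0" "t \<longlonglongrightarrow> 0"
      "(\<lambda>k. (z k - y) /\<^sub>R t k) \<longlonglongrightarrow> w"
    unfolding tangent_cone_def by blast
  have z: "z \<longlonglongrightarrow> y" by (rule tangent_cone_tendsto[OF zt(2-4)])
  have "Bseq (\<lambda>k. (z k - y) /\<^sub>R t k)" using zt(4) by (intro convergent_imp_Bseq convergentI)
  then obtain M where M: "\<And>k. norm ((z k - y) /\<^sub>R t k) \<le> M" by (auto simp: Bseq_def)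
  have bnd: "norm (z k - y) \<le> M * t k" for k
    using M[of k] zt(2)[of k] by (rule norm_le_of_quotient_le)
  have "(\<lambda>k. (\<Phi> (z k) - \<Phi> y) /\<^sub>R t k - A ((z k - y) /\<^sub>R t k)) \<longlonglongrightarrow> 0"
    by (rule has_derivative_difference_quotients[OF der zt(1) z zt(2) bnd])
  moreover have "(\<lambda>k. A ((z k - y) /\<^sub>R t k)) \<longlonglongrightarrow> A w" 
    by (rule bounded_linear.tendsto[OF lin zt(4)])
  ultimately have "(\<lambda>k. (\<Phi> (z k) - \<Phi> y) /\<^sub>R t k) \<longlonglongrightarrow> A w"
    using tendsto_add by fastforce
  then show "w \<in> {w. A w \<in> tangent_cone (\<Phi> ` S) (\<Phi> y)}"
    using zt by (auto intro!: tangent_coneI[of "\<lambda>k. \<Phi> (z k)" _ t])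
next
  have lin: "bounded_linear A" using der by (rule has_derivative_bounded_linear)
  have low: "(1 - e) * norm w \<le> norm (A w)" for w
    using near[of w] norm_triangle_ineq2[of w "w - A w"] by (simp add: algebra_simps norm_minus_commute)
  fix w assume "w \<in> {w. A w \<in> tangent_cone (\<Phi> ` S) (\<Phi> y)}"
  then obtain x t where xt: "\<And>k. x k \<in> \<Phi> ` S" "\<And>k::nat. t k > 0" "t \<longlonglongrightarrow> 0"
      "(\<lambda>k. (x k - \<Phi> y) /\<^sub>R t k) \<longlonglongrightarrow> A w"
    unfolding tangent_cone_def by blast
  define z where "z k = inv_into S \<Phi> (x k)" for k
  have zS: "z k \<in> S" and xz: "x k = \<Phi> (z k)" for k
    using xt(1)[of k] by (simp_all add: z_def inv_into_into f_inv_into_f)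
  have "x \<longlonglongrightarrow> \<Phi> y" by (rule tangent_cone_tendsto[OF xt(2-4)])
  then have "(\<lambda>k. inv_into S \<Phi> (x k)) \<longlonglongrightarrow> inv_into S \<Phi> (\<Phi> y)"
    using inv y xt(1) by (intro continuous_on_tendsto_compose[OF inv]) auto
  then have z: "z \<longlonglongrightarrow> y" using y inj by (simp add: z_def[abs_def])
  \<comment> \<open>The distances of the lifted points from \<open>y\<close> are bounded by a multiple of \<open>t\<close>, since \<open>A\<close> is
    bounded below by \<open>1 - e\<close> and the linearisation error is at most half as large.\<close>
  define c where "c = (1 - e) / 2"
  have c: "c > 0" using e by (simp add: c_def)
  obtain d where d: "d > 0"
    "\<And>v. v \<in> S \<Longrightarrow> norm (v - y) < d \<Longrightarrow> norm (\<Phi> v - \<Phi> y - A (v - y)) \<le> c * norm (v - y)"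
    using der c unfolding has_derivative_within_alt by meson
  have "\<forall>\<^sub>F k in sequentially. dist (z k) y < d" using z d(1) by (rule tendstoD)
  then obtain k0 where k0: "\<And>k. k \<ge> k0 \<Longrightarrow> dist (z k) y < d" by (auto simp: eventually_sequentially)
  have "Bseq (\<lambda>k. (x k - \<Phi> y) /\<^sub>R t k)" using xt(4) by (intro convergent_imp_Bseq convergentI)
  then obtain M where M: "\<And>k. norm ((x k - \<Phi> y) /\<^sub>R t k) \<le> M" by (auto simp: Bseq_def)
  have bnd: "norm (z (k + k0) - y) \<le> (M / c) * t (k + k0)" for k
  proof -
    let ?v = "z (k + k0)"
    have "norm (\<Phi> ?v - \<Phi> y - A (?v - y)) \<le> c * norm (?v - y)"
      using d(2)[OF zS, of "k + k0"] k0[of "k + k0"] by (simp add: dist_norm)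
    moreover have "norm (A (?v - y)) \<le> norm (\<Phi> ?v - \<Phi> y) + norm (\<Phi> ?v - \<Phi> y - A (?v - y))"
      using norm_triangle_ineq4[of "\<Phi> ?v - \<Phi> y" "\<Phi> ?v - \<Phi> y - A (?v - y)"] by simp
    moreover have "2 * (c * norm (?v - y)) \<le> norm (A (?v - y))" using low[of "?v - y"] by (simp add: c_def)
    moreover have "norm (\<Phi> ?v - \<Phi> y) \<le> M * t (k + k0)"
      using norm_le_of_quotient_le[OF M xt(2), of "k + k0"] by (simp add: xz)
    ultimately have "c * norm (?v - y) \<le> M * t (k + k0)" by linarith
    then show ?thesis using c by (simp add: field_simps)
  qed
  have "(\<lambda>k. (\<Phi> (z (k + k0)) - \<Phi> y) /\<^sub>R t (k + k0) - A ((z (k + k0) - y) /\<^sub>R t (k + k0))) \<longlonglongrightarrow> 0"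
    by (rule has_derivative_difference_quotients[OF der zS _ xt(2) bnd]) (rule LIMSEQ_ignore_initial_segment[OF z])
  moreover have "(\<lambda>k. (\<Phi> (z (k + k0)) - \<Phi> y) /\<^sub>R t (k + k0)) \<longlonglongrightarrow> A w"
    using LIMSEQ_ignore_initial_segment[OF xt(4), of k0] by (simp add: xz)
  ultimately have "(\<lambda>k. (\<Phi> (z (k + k0)) - \<Phi> y) /\<^sub>R t (k + k0) -
      ((\<Phi> (z (k + k0)) - \<Phi> y) /\<^sub>R t (k + k0) - A ((z (k + k0) - y) /\<^sub>R t (k + k0)))) \<longlonglongrightarrow> A w - 0"
    by (intro tendsto_diff)
  then have lim: "(\<lambda>k. A ((z (k + k0) - y) /\<^sub>R t (k + k0)) - A w) \<longlonglongrightarrow> 0"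
    by (simp add: LIM_zero_iff)
  have "(\<lambda>k. (z (k + k0) - y) /\<^sub>R t (k + k0) - w) \<longlonglongrightarrow> 0"
  proof (rule Lim_null_comparison)
    show "\<forall>\<^sub>F k in sequentially. norm ((z (k + k0) - y) /\<^sub>R t (k + k0) - w)
        \<le> norm (A ((z (k + k0) - y) /\<^sub>R t (k + k0)) - A w) / (1 - e)"
    proof (intro always_eventually allI)
      fix k
      let ?v = "(z (k + k0) - y) /\<^sub>R t (k + k0)"
      have "(1 - e) * norm (?v - w) \<le> norm (A ?v - A w)"
        using low[of "?v - w"] by (simp only: linear_diff[OF bounded_linear.linear[OF lin]])
      then show "norm (?v - w) \<le> norm (A ?v - A w) / (1 - e)"
        using e by (simp add: pos_le_divide_eq mult.commute)
    qed
    show "(\<lambda>k. norm (A ((z (k + k0) - y) /\<^sub>R t (k + k0)) - A w) / (1 - e)) \<longlonglongrightarrow> 0"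
      using tendsto_divide[OF tendsto_norm_zero[OF lim] tendsto_const[of "1 - e"]] e by simp
  qed
  then have "(\<lambda>k. (z (k + k0) - y) /\<^sub>R t (k + k0)) \<longlonglongrightarrow> w" by (simp add: LIM_zero_iff)
  then show "w \<in> tangent_cone S y"
    using zS xt(2) LIMSEQ_ignore_initial_segment[OF xt(3), of k0]
    by (intro tangent_coneI[of "\<lambda>k. z (k + k0)" _ "\<lambda>k. t (k + k0)"]) auto
qed

text \<open>The image of a straight path under \<open>\<Phi>\<close> is only known up to a deviation \<open>c t\<close> of first order.
  Its side is still determined if this deviation cannot bring the path back to the tangent
  hyperplane of the level set.\<close>

lemma eventually_pos_along_path:
  fixes \<phi> :: "'a::real_inner \<Rightarrow> real"
  assumes der: "(\<phi> has_derivative (\<lambda>h. h \<bullet> g)) (at z)" and z: "\<phi> z = 0" and c: "c \<ge> 0"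
    and p: "\<forall>\<^sub>F t in at_right 0. norm (p t - z - t *\<^sub>R v) \<le> c * t" and v: "c * norm g < v \<bullet> g"
  shows "\<forall>\<^sub>F t in at_right 0. \<phi> (p t) > 0"
proof -
  define M where "M = norm v + c + 1"
  have M: "M > 0" using c by (simp add: M_def add_nonneg_pos)
  define e where "e = (v \<bullet> g - c * norm g) / (2 * M)"
  have e: "e > 0" using v M by (simp add: e_def)
  obtain d where d: "d > 0" "\<And>y. norm (y - z) < d \<Longrightarrow> norm (\<phi> y - \<phi> z - (y - z) \<bullet> g) \<le> e * norm (y - z)"
    using der e unfolding has_derivative_within_alt by (metis UNIV_I)
  have "\<forall>\<^sub>F t in at_right 0. t < d / M" using d(1) M by (intro order_tendstoD(2)[OF tendsto_ident_at]) simp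
  then show ?thesis using p eventually_at_right_less[of 0]
  proof eventually_elim
    case (elim t)
    have tri: "norm (p t - z) \<le> norm (p t - z - t *\<^sub>R v) + norm (t *\<^sub>R v)"
      using norm_triangle_ineq[of "p t - z - t *\<^sub>R v" "t *\<^sub>R v"] by simp
    have n: "norm (p t - z) \<le> M * t" using tri elim by (simp add: M_def algebra_simps)
    moreover have "M * t < d" using elim M by (simp add: pos_less_divide_eq mult.commute)
    ultimately have "norm (\<phi> (p t) - \<phi> z - (p t - z) \<bullet> g) \<le> e * norm (p t - z)" by (intro d(2)) simp
    also have "\<dots> \<le> e * (M * t)" using n e by simp
    also have "\<dots> = (v \<bullet> g - c * norm g) * t / 2" using M by (simp add: e_def)
    finally have 1: "\<bar>\<phi> (p t) - (p t - z) \<bullet> g\<bar> \<le> (v \<bullet> g - c * norm g) * t / 2" using z by simp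
    have "\<bar>(p t - z - t *\<^sub>R v) \<bullet> g\<bar> \<le> norm (p t - z - t *\<^sub>R v) * norm g" by (rule Cauchy_Schwarz_ineq2)
    also have "\<dots> \<le> c * t * norm g" using elim by (intro mult_right_mono) auto
    finally have "- (c * t * norm g) \<le> (p t - z - t *\<^sub>R v) \<bullet> g" by linarith
    then have 2: "(v \<bullet> g - c * norm g) * t \<le> (p t - z) \<bullet> g" by (simp add: inner_diff_left algebra_simps)
    have 3: "(v \<bullet> g - c * norm g) * t > 0" using v elim by simp
    show ?case using 1 2 3 by linarith
  qed
qed

lemma eventually_neg_along_path:
  fixes \<phi> :: "'a::real_inner \<Rightarrow> real"
  assumes der: "(\<phi> has_derivative (\<lambda>h. h \<bullet> g)) (at z)" and z: "\<phi> z = 0" and c: "c \<ge> 0"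
    and p: "\<forall>\<^sub>F t in at_right 0. norm (p t - z - t *\<^sub>R v) \<le> c * t" and v: "v \<bullet> g < - (c * norm g)"
  shows "\<forall>\<^sub>F t in at_right 0. \<phi> (p t) < 0"
proof -
  have "((\<lambda>x. - \<phi> x) has_derivative (\<lambda>h. h \<bullet> (- g))) (at z)"
    using has_derivative_minus[OF der] by simp
  then have "\<forall>\<^sub>F t in at_right 0. - \<phi> (p t) > 0"
    by (rule eventually_pos_along_path[OF _ _ c p]) (use z v in auto)
  then show ?thesis by simp
qed

lemma eventually_at_right_add_scaleR_mem:
  fixes x v :: "'a::real_normed_vector"
  assumes "open S" "x \<in> S"
  shows "\<forall>\<^sub>F t::real in at_right 0. x + t *\<^sub>R v \<in> S"
proof -
  have "((\<lambda>t. x + t *\<^sub>R v) \<longlongrightarrow> x + 0 *\<^sub>R v) (at_right 0)" by (intro tendsto_intros)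
  then show ?thesis using assms by (intro topological_tendstoD[where S = S]) auto
qed

lemma unit_normal_level_set:
  fixes \<phi> :: "'a::euclidean_space \<Rightarrow> real"
  assumes \<Omega>: "open \<Omega>" and U: "open U" "{x \<in> \<Omega>. \<phi> x = 0} \<subseteq> U" "continuous_on U \<phi>"
    and z: "z \<in> \<Omega>" "\<phi> z = 0" and der: "(\<phi> has_derivative (\<lambda>h. h \<bullet> g)) (at z)" and g: "g \<noteq> 0"
  shows "tangent_cone {x \<in> \<Omega>. \<phi> x = 0} z = {w. w \<bullet> (g /\<^sub>R norm g) = 0}"
    and "unit_normal {x \<in> \<Omega>. \<phi> x = 0} {x \<in> \<Omega>. \<phi> x < 0} {x \<in> \<Omega>. \<phi> x > 0} z = g /\<^sub>R norm g"
proof -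
  let ?n = "g /\<^sub>R norm g"
  have "tangent_cone {x \<in> \<Omega> \<inter> U. \<phi> x = 0} z = {w. w \<bullet> g = 0}"
    using U z \<Omega> by (intro tangent_cone_level_set der g) (auto intro: continuous_on_subset)
  moreover have "{x \<in> \<Omega> \<inter> U. \<phi> x = 0} = {x \<in> \<Omega>. \<phi> x = 0}" using U(2) by auto
  ultimately show cone: "tangent_cone {x \<in> \<Omega>. \<phi> x = 0} z = {w. w \<bullet> ?n = 0}" using g by simp
  show "unit_normal {x \<in> \<Omega>. \<phi> x = 0} {x \<in> \<Omega>. \<phi> x < 0} {x \<in> \<Omega>. \<phi> x > 0} z = ?n"
  proof (rule unit_normal_eqI[OF _ cone])
    have ng: "?n \<bullet> g > 0" using g by (simp add: dot_square_norm)
    have "\<forall>\<^sub>F t in at_right 0. \<phi> (z + t *\<^sub>R ?n) > 0"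
      by (rule eventually_pos_along_path[OF der z(2), of 0 _ ?n]) (use ng in auto)
    moreover have "\<forall>\<^sub>F t in at_right 0. \<phi> (z + t *\<^sub>R (- ?n)) < 0"
      by (rule eventually_neg_along_path[OF der z(2), of 0 _ "- ?n"]) (use ng in auto)
    ultimately show "\<forall>\<^sub>F t in at_right 0. z - t *\<^sub>R ?n \<in> {x \<in> \<Omega>. \<phi> x < 0} \<and> z + t *\<^sub>R ?n \<in> {x \<in> \<Omega>. \<phi> x > 0}"
      using eventually_at_right_add_scaleR_mem[OF \<Omega> z(1), of ?n] eventually_at_right_add_scaleR_mem[OF \<Omega> z(1), of "- ?n"]
      by eventually_elim simp
  qed (use g in auto)
qed

section \<open>Normals and gradients pulled back by a near-identity map\<close>

lemma norm_matrix_vector_mult_le: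
  fixes A :: "real^'n^'m"
  shows "norm (A *v x) \<le> norm A * norm x"
proof -
  have "(norm (A *v x))\<^sup>2 = (\<Sum>i\<in>UNIV. (A $ i \<bullet> x)\<^sup>2)"
    by (simp add: norm_vec_def L2_set_def matrix_vector_mul_component sum_nonneg)
  also have "\<dots> \<le> (\<Sum>i\<in>UNIV. (norm (A $ i))\<^sup>2 * (norm x)\<^sup>2)"
  proof (rule sum_mono)
    fix i show "(A $ i \<bullet> x)\<^sup>2 \<le> (norm (A $ i))\<^sup>2 * (norm x)\<^sup>2"
      using Cauchy_Schwarz_ineq[of "A $ i" x] by (simp add: dot_square_norm)
  qed
  also have "\<dots> = (norm A * norm x)\<^sup>2"
    by (simp add: norm_vec_def L2_set_def sum_nonneg sum_distrib_right power_mult_distrib real_sqrt_pow2)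
  finally show ?thesis by (rule power2_le_imp_le) simp
qed

lemma norm_transpose: 
  fixes A :: "real^'n^'m"
  shows "norm (transpose A) = norm A"
  unfolding norm_vec_def L2_set_def transpose_def
  by (simp add: sum_nonneg real_sqrt_pow2) (rule sum.swap)

lemma near_id_matrix:
  fixes A :: "real^'n^'n"
  assumes "norm (A - mat 1) \<le> \<epsilon>"
  shows "norm (A *v x - x) \<le> \<epsilon> * norm x" "norm (transpose A *v x - x) \<le> \<epsilon> * norm x"
proof -
  have "norm ((A - mat 1) *v x) \<le> norm (A - mat 1) * norm x" by (rule norm_matrix_vector_mult_le)
  then show "norm (A *v x - x) \<le> \<epsilon> * norm x"
    using mult_right_mono[OF assms norm_ge_zero[of x]] by (simp add: matrix_vector_mult_diff_rdistrib)
  have "norm (transpose (A - mat 1) *v x) \<le> norm (A - mat 1) * norm x"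
    using norm_matrix_vector_mult_le[of "transpose (A - mat 1)" x] by (simp add: norm_transpose)
  moreover have "transpose (A - mat 1) = transpose A - mat 1"
    by (simp add: transpose_def mat_def vec_eq_iff)
  ultimately show "norm (transpose A *v x - x) \<le> \<epsilon> * norm x"
    using mult_right_mono[OF assms norm_ge_zero[of x]] by (simp add: matrix_vector_mult_diff_rdistrib)
qed

lemma tangential_projection_mult: "tangential_projection n *v x = x - (x \<bullet> n) *\<^sub>R n"
proof -
  have "(\<chi> i j. n $ i * n $ j) *v x = (x \<bullet> n) *\<^sub>R n"
    by (simp add: vec_eq_iff matrix_vector_mult_def inner_vec_def sum_distrib_left mult_ac)
  then show ?thesis by (simp add: tangential_projection_def matrix_vector_mult_diff_rdistrib)
qed

text \<open>The normal of the preimage of a hyperplane with the normal \<open>n\<close> under \<open>A\<close> is \<open>A\<^sup>T n\<close>, normalised.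
  Normalisation costs as much as the error of \<open>A\<^sup>T n\<close> itself.\<close>

lemma near_id_conormal:
  fixes A :: "real^'n^'n"
  assumes A: "norm (A - mat 1) \<le> \<epsilon>" and \<epsilon>: "\<epsilon> \<le> 1/8" and n: "norm n = 1"
  defines "m \<equiv> transpose A *v n"
  shows "m \<noteq> 0" "norm (m /\<^sub>R norm m - n) \<le> 2 * \<epsilon>"
proof -
  have mn: "norm (m - n) \<le> \<epsilon>" using near_id_matrix(2)[OF A, of n] n by (simp add: m_def)
  then have 1: "\<bar>norm m - 1\<bar> \<le> \<epsilon>" using norm_triangle_ineq3[of m n] n by simp
  then show m0: "m \<noteq> 0" using \<epsilon> by auto
  have "(1 - norm m) *\<^sub>R (m /\<^sub>R norm m) = m /\<^sub>R norm m - norm m *\<^sub>R (m /\<^sub>R norm m)"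
    by (rule scaleR_left_diff_distrib[of 1, unfolded scaleR_one])
  then have "m /\<^sub>R norm m - m = (1 - norm m) *\<^sub>R (m /\<^sub>R norm m)" using m0 by simp
  then have "norm (m /\<^sub>R norm m - m) = \<bar>1 - norm m\<bar> * norm (m /\<^sub>R norm m)" by (simp only: norm_scaleR)
  then have "norm (m /\<^sub>R norm m - m) = \<bar>1 - norm m\<bar>" using m0 by simp
  then show "norm (m /\<^sub>R norm m - n) \<le> 2 * \<epsilon>"
    using norm_triangle_ineq[of "m /\<^sub>R norm m - m" "m - n"] mn 1 by simp
qed

lemma pullback_gradient_estimates:
  fixes A :: "real^'n^'n" and g :: "real^'n"
  assumes A: "norm (A - mat 1) \<le> \<epsilon>" and \<epsilon>: "\<epsilon> \<le> 1/8" and n: "norm n = 1" "norm n' = 1" "norm (n' - n) \<le> 2 * \<epsilon>"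
  defines "g' \<equiv> transpose A *v g"
  shows "norm g' \<le> 2 * norm g" "norm g \<le> 2 * norm g'"
    "\<bar>g' \<bullet> n' - g \<bullet> n\<bar> \<le> 3 * \<epsilon> * norm g"
    "norm (tangential_projection n' *v g' - tangential_projection n *v g) \<le> 6 * \<epsilon> * norm g"
proof -
  have e0: "\<epsilon> \<ge> 0" using A norm_ge_zero order_trans by blast
  have d: "norm (g' - g) \<le> \<epsilon> * norm g" using near_id_matrix(2)[OF A, of g] by (simp add: g'_def)
  moreover have eg: "\<epsilon> * norm g \<le> 1/8 * norm g" using \<epsilon> by (rule mult_right_mono) simp
  ultimately show "norm g' \<le> 2 * norm g" "norm g \<le> 2 * norm g'"
    using norm_triangle_ineq3[of g' g] norm_ge_zero[of g] by linarith+
  have "\<bar>(g' - g) \<bullet> n'\<bar> \<le> norm (g' - g) * norm n'" "\<bar>g \<bullet> (n' - n)\<bar> \<le> norm g * norm (n' - n)"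
    by (rule Cauchy_Schwarz_ineq2)+
  moreover have "norm g * norm (n' - n) \<le> norm g * (2 * \<epsilon>)" using n(3) by (rule mult_left_mono) simp
  moreover have "g' \<bullet> n' - g \<bullet> n = (g' - g) \<bullet> n' + g \<bullet> (n' - n)" by (simp add: inner_diff_left inner_diff_right)
  ultimately show dn: "\<bar>g' \<bullet> n' - g \<bullet> n\<bar> \<le> 3 * \<epsilon> * norm g" using d n by (simp add: algebra_simps)
  have "\<bar>g \<bullet> n\<bar> \<le> norm g" using Cauchy_Schwarz_ineq2[of g n] n by simp
  then have "\<bar>g \<bullet> n\<bar> * norm (n' - n) \<le> norm g * (2 * \<epsilon>)" using n(3) by (intro mult_mono) auto
  then have "\<bar>g \<bullet> n\<bar> * norm (n' - n) \<le> 2 * \<epsilon> * norm g" by (simp only: ac_simps)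
  moreover have eq: "tangential_projection n' *v g' - tangential_projection n *v g
      = (g' - g) - ((g' \<bullet> n' - g \<bullet> n) *\<^sub>R n' + (g \<bullet> n) *\<^sub>R (n' - n))"
    by (simp add: tangential_projection_mult algebra_simps)
  moreover have "norm ((g' - g) - ((g' \<bullet> n' - g \<bullet> n) *\<^sub>R n' + (g \<bullet> n) *\<^sub>R (n' - n)))
      \<le> norm (g' - g) + (\<bar>g' \<bullet> n' - g \<bullet> n\<bar> + \<bar>g \<bullet> n\<bar> * norm (n' - n))"
    using norm_triangle_ineq4[of "g' - g" "(g' \<bullet> n' - g \<bullet> n) *\<^sub>R n' + (g \<bullet> n) *\<^sub>R (n' - n)"]
      norm_triangle_ineq[of "(g' \<bullet> n' - g \<bullet> n) *\<^sub>R n'" "(g \<bullet> n) *\<^sub>R (n' - n)"] n by simp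
  ultimately show "norm (tangential_projection n' *v g' - tangential_projection n *v g) \<le> 6 * \<epsilon> * norm g"
    using d dn by (simp only: eq)
qed

text \<open>The tangent hyperplane of the preimage is given by \<open>(A w) \<bullet> n = w \<bullet> (A\<^sup>T n)\<close>. The derivative of
  \<open>\<Phi>\<close> within the preimage does not control \<open>\<Phi>\<close> in the normal direction; that the two sides are
  preserved follows from the closeness of \<open>\<Phi>\<close> to the identity.\<close>

lemma unit_normal_pullback:
  fixes \<phi> :: "real^'n \<Rightarrow> real" and \<Phi> :: "real^'n \<Rightarrow> real^'n" and A :: "real^'n^'n"
  assumes \<Omega>: "open \<Omega>" and U: "open U" "{x \<in> \<Omega>. \<phi> x = 0} \<subseteq> U" "continuous_on U \<phi>"
    and hom: "homeomorphism \<Omega> \<Omega> \<Phi> \<Phi>'" and near: "infinitesimally_near_id (1/4) \<Phi> \<Omega>"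
    and y: "y \<in> \<Omega>" "\<phi> (\<Phi> y) = 0"
    and der: "(\<phi> has_derivative (\<lambda>h. h \<bullet> g)) (at (\<Phi> y))" and g: "g \<noteq> 0"
    and derA: "(\<Phi> has_derivative (\<lambda>w. A *v w)) (at y within {x \<in> \<Omega>. \<phi> (\<Phi> x) = 0})"
    and A: "norm (A - mat 1) \<le> \<epsilon>" and \<epsilon>: "\<epsilon> \<le> 1/8"
  defines "m \<equiv> transpose A *v (g /\<^sub>R norm g)"
  shows "unit_normal {x \<in> \<Omega>. \<phi> (\<Phi> x) = 0} {x \<in> \<Omega>. \<phi> (\<Phi> x) < 0} {x \<in> \<Omega>. \<phi> (\<Phi> x) > 0} y = m /\<^sub>R norm m"
proof -
  define K where "K = {x \<in> \<Omega>. \<phi> (\<Phi> x) = 0}"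
  define n where "n = g /\<^sub>R norm g"
  define nh where "nh = m /\<^sub>R norm m"
  have n1: "norm n = 1" using g by (simp add: n_def)
  have gn: "g = norm g *\<^sub>R n" using g by (simp add: n_def)
  have m: "m = transpose A *v n" by (simp add: m_def n_def)
  have m0: "m \<noteq> 0" and nh: "norm (nh - n) \<le> 2 * \<epsilon>"
    using near_id_conormal[OF A \<epsilon> n1] by (simp_all add: m nh_def)
  have nh1: "norm nh = 1" using m0 by (simp add: nh_def)
  have e0: "\<epsilon> \<ge> 0" using A norm_ge_zero order_trans by blast
  have \<Phi>: "\<Phi> ` \<Omega> = \<Omega>" "\<And>x. x \<in> \<Omega> \<Longrightarrow> \<Phi>' x \<in> \<Omega>" "\<And>x. x \<in> \<Omega> \<Longrightarrow> \<Phi>' (\<Phi> x) = x" "\<And>x. x \<in> \<Omega> \<Longrightarrow> \<Phi> (\<Phi>' x) = x"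
    "continuous_on \<Omega> \<Phi>'"
    using hom by (auto simp: homeomorphism_def)
  have \<Phi>\<Omega>: "\<Phi> x \<in> \<Omega>" if "x \<in> \<Omega>" for x using \<Phi>(1) that by blast
  have K: "\<Phi> ` K = {x \<in> \<Omega>. \<phi> x = 0}"
  proof (intro equalityI subsetI)
    fix x assume "x \<in> {x \<in> \<Omega>. \<phi> x = 0}"
    then have "x = \<Phi> (\<Phi>' x)" "\<Phi>' x \<in> K" using \<Phi>(2,4) by (simp_all add: K_def)
    then show "x \<in> \<Phi> ` K" by (rule image_eqI)
  qed (auto simp: K_def \<Phi>\<Omega>)
  have inj: "inj_on \<Phi> K" by (rule inj_on_inverseI[of _ \<Phi>']) (simp add: \<Phi>(3) K_def)
  have inv: "continuous_on (\<Phi> ` K) (inv_into K \<Phi>)"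
  proof (rule continuous_on_eq)
    show "continuous_on (\<Phi> ` K) \<Phi>'"
      unfolding K by (rule continuous_on_subset[OF \<Phi>(5)]) auto
    show "\<Phi>' x = inv_into K \<Phi> x" if "x \<in> \<Phi> ` K" for x
    proof -
      from that obtain v where v: "v \<in> K" "x = \<Phi> v" by blast
      then have "inv_into K \<Phi> x = v" using inj by simp
      moreover have "v \<in> \<Omega>" using v(1) by (simp add: K_def)
      ultimately show ?thesis using v(2) \<Phi>(3) by simp
    qed
  qed
  have cone\<Gamma>: "tangent_cone (\<Phi> ` K) (\<Phi> y) = {w. w \<bullet> n = 0}"
    unfolding K n_def using y by (intro unit_normal_level_set(1)[OF \<Omega> U _ _ der g] \<Phi>\<Omega>)
  have "tangent_cone K y = {w. A *v w \<in> tangent_cone (\<Phi> ` K) (\<Phi> y)}"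
  proof (rule tangent_cone_preimage[OF _ _ inj inv])
    show "(\<Phi> has_derivative (*v) A) (at y within K)" using derA by (simp add: K_def)
    show "y \<in> K" using y by (simp add: K_def)
    show "norm (A *v w - w) \<le> \<epsilon> * norm w" for w by (rule near_id_matrix(1)[OF A])
  qed (use \<epsilon> e0 in auto)
  also have "\<dots> = {w. w \<bullet> nh = 0}"
  proof -
    have "(A *v w) \<bullet> n = w \<bullet> m" for w
    proof -
      have "n \<bullet> (A *v w) = (n v* A) \<bullet> w" by (rule dot_lmul_matrix[symmetric])
      then show ?thesis
        unfolding m transpose_matrix_vector
        by (simp only: inner_commute[of "A *v w" n] inner_commute[of w "n v* A"])
    qed
    then show ?thesis using m0 unfolding cone\<Gamma> nh_def by simp
  qed
  finally have cone: "tangent_cone K y = {w. w \<bullet> nh = 0}" .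
  have nhn: "1/4 < nh \<bullet> n"
  proof -
    have "\<bar>(nh - n) \<bullet> n\<bar> \<le> norm (nh - n) * norm n" by (rule Cauchy_Schwarz_ineq2)
    then have "\<bar>(nh - n) \<bullet> n\<bar> \<le> 1/4" using nh \<epsilon> n1 by simp
    moreover have "n \<bullet> n = 1" using n1 by (simp add: dot_square_norm)
    ultimately show ?thesis unfolding inner_diff_left by linarith
  qed
  then have nhg: "1/4 * norm g < nh \<bullet> g"
  proof -
    have "nh \<bullet> g = norm g * (nh \<bullet> n)" by (subst gn) simp
    then show ?thesis using mult_strict_left_mono[OF nhn, of "norm g"] g by simp
  qed
  have path: "\<forall>\<^sub>F t in at_right 0. norm (\<Phi> (y + t *\<^sub>R v) - \<Phi> y - t *\<^sub>R v) \<le> 1/4 * t" if v: "norm v = 1" for v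
  proof -
    have "\<forall>\<^sub>F x in at y. norm (\<Phi> x - \<Phi> y - (x - y)) \<le> 1/4 * norm (x - y)"
      using near y(1) unfolding infinitesimally_near_id_def by blast
    then obtain d where d: "d > 0" "\<And>x. x \<noteq> y \<Longrightarrow> dist x y < d \<Longrightarrow> norm (\<Phi> x - \<Phi> y - (x - y)) \<le> 1/4 * norm (x - y)"
      unfolding eventually_at by blast
    have "\<forall>\<^sub>F t in at_right 0. t < d" using d(1) by (intro order_tendstoD(2)[OF tendsto_ident_at])
    then show ?thesis using eventually_at_right_less[of 0]
    proof eventually_elim
      case (elim t)
      have "v \<noteq> 0" using v by auto
      then have "y + t *\<^sub>R v \<noteq> y" "dist (y + t *\<^sub>R v) y < d" using v elim by (auto simp: dist_norm)
      from d(2)[OF this] show ?case using v elim by simp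
    qed
  qed
  have pos: "\<forall>\<^sub>F t in at_right 0. \<phi> (\<Phi> (y + t *\<^sub>R nh)) > 0"
    by (rule eventually_pos_along_path[OF der y(2) _ path[OF nh1] nhg]) simp
  have "norm (- nh) = 1" "- nh \<bullet> g < - (1/4 * norm g)" using nh1 nhg by simp_all
  then have "\<forall>\<^sub>F t in at_right 0. \<phi> (\<Phi> (y + t *\<^sub>R (- nh))) < 0"
    by (intro eventually_neg_along_path[OF der y(2) _ path]) simp_all
  with pos have "\<forall>\<^sub>F t in at_right 0. y - t *\<^sub>R nh \<in> {x \<in> \<Omega>. \<phi> (\<Phi> x) < 0} \<and> y + t *\<^sub>R nh \<in> {x \<in> \<Omega>. \<phi> (\<Phi> x) > 0}"
    using eventually_at_right_add_scaleR_mem[OF \<Omega> y(1), of nh] eventually_at_right_add_scaleR_mem[OF \<Omega> y(1), of "- nh"]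
    by eventually_elim simp
  then show ?thesis
    unfolding K_def[symmetric] nh_def[symmetric]
    by (rule unit_normal_eqI[OF nh1 cone]) auto
qed

section \<open>Comparison of norms on a hypersurface and on its preimage\<close>

lemma borel_measurable_AE_eq:
  assumes M: "complete_measure M" and f: "f \<in> borel_measurable M" and eq: "AE x in M. f x = g x"
  shows "g \<in> borel_measurable M"
proof (rule measurableI)
  fix B :: "'b set" assume "B \<in> sets borel"
  then have "f -` B \<inter> space M \<in> sets M" by (rule measurable_sets[OF f])
  moreover have "AE x in M. x \<in> f -` B \<inter> space M \<longleftrightarrow> x \<in> g -` B \<inter> space M"
    using eq by eventually_elim simp
  ultimately show "g -` B \<inter> space M \<in> sets M"
    using complete_measure.in_sets_AE[OF M] by blast
qed simp

lemma borel_measurable_matrix_vector_mult: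
  fixes A :: "'a \<Rightarrow> real^'n^'m"
  assumes "A \<in> borel_measurable M" "x \<in> borel_measurable M"
  shows "(\<lambda>s. A s *v x s) \<in> borel_measurable M"
  by (rule borel_measurable_continuous_Pair[OF assms])
    (auto simp: matrix_vector_mult_def intro!: continuous_intros)

lemma borel_measurable_transpose:
  fixes A :: "'a \<Rightarrow> real^'n^'m"
  assumes "A \<in> borel_measurable M"
  shows "(\<lambda>s. transpose (A s)) \<in> borel_measurable M"
  by (rule measurable_compose[OF assms], rule borel_measurable_continuous_onI)
    (auto simp: transpose_def intro!: continuous_intros)

text \<open>The left-hand side collects the factor \<open>2\<close> of \<open>L2_norm_le_of_AE_le_add\<close> and the factor \<open>2\<close> of
  a change between the two hypersurfaces. Both directions of the comparison lead to it, with these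
  steps in opposite orders.\<close>

lemma ennreal_combine_le:
  assumes "0 \<le> k" "k \<le> 12" "0 \<le> \<epsilon>"
  shows "2 * (ennreal (k * \<epsilon>) * (2 * X) + 2 * Y) \<le> 48 * (ennreal \<epsilon> * X + Y)"
proof -
  have "ennreal (k * \<epsilon>) \<le> ennreal (12 * \<epsilon>)" using assms by (intro ennreal_leI mult_right_mono)
  also have "\<dots> = 12 * ennreal \<epsilon>" using assms by (simp add: ennreal_mult)
  finally have "2 * (ennreal (k * \<epsilon>) * (2 * X) + 2 * Y) \<le> 2 * ((12 * ennreal \<epsilon>) * (2 * X) + 2 * Y)"
    by (intro mult_left_mono add_right_mono mult_right_mono) auto
  also have "\<dots> = 48 * (ennreal \<epsilon> * X) + 4 * Y" 
  proof -
    have "(48::ennreal) = 2 * (12 * 2)" "(4::ennreal) = 2 * 2" by simp_all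
    then show ?thesis by (simp only: distrib_left ac_simps)
  qed
  also have "\<dots> \<le> 48 * (ennreal \<epsilon> * X) + 48 * Y" by (intro add_left_mono mult_right_mono) auto
  finally show ?thesis by (simp add: distrib_left)
qed

text \<open>The analytic core. The meshes enter only through the closeness of \<open>\<Phi>\<close> and \<open>D\<close> to the identity
  and the existence almost everywhere on \<open>K\<close> of a derivative of \<open>\<Phi>\<close> within \<open>K\<close>.\<close>

lemma near_id_surface_estimates:
  fixes \<Omega> U :: "(real^'n) set" and \<phi> :: "real^'n \<Rightarrow> real" and \<Phi> \<Phi>' :: "real^'n \<Rightarrow> real^'n"
    and D :: "real^'n \<Rightarrow> real^'n^'n" and g :: "real^'n \<Rightarrow> real^'n" and v :: "real^'n \<Rightarrow> real"
  assumes dim: "CARD('n) \<le> 3" and \<Omega>: "open \<Omega>"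
    and \<Gamma>: "\<Gamma> = {x \<in> \<Omega>. \<phi> x = 0}" "compact \<Gamma>" and U: "open U" "\<Gamma> \<subseteq> U"
    and \<phi>: "\<And>x. x \<in> U \<Longrightarrow> \<phi> differentiable (at x)" "continuous_on \<Gamma> (gradient \<phi>)"
      "\<And>x. x \<in> \<Gamma> \<Longrightarrow> gradient \<phi> x \<noteq> 0"
    and hom: "homeomorphism \<Omega> \<Omega> \<Phi> \<Phi>'" and near: "infinitesimally_near_id (1/4) \<Phi> \<Omega>"
    and K: "K = {x \<in> \<Omega>. \<phi> (\<Phi> x) = 0}"
    and D: "AE x in surface_measure K. (\<Phi> has_derivative (\<lambda>w. D x *v w)) (at x within K)"
      "\<And>x. x \<in> K \<Longrightarrow> norm (D x - mat 1) \<le> \<epsilon>" "D \<in> borel_measurable (surface_measure K)"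
    and \<epsilon>: "0 \<le> \<epsilon>" "\<epsilon> \<le> 1/8"
    and n: "n = unit_normal \<Gamma> {x \<in> \<Omega>. \<phi> x < 0} {x \<in> \<Omega>. \<phi> x > 0}"
    and nh: "nh = unit_normal K {x \<in> \<Omega>. \<phi> (\<Phi> x) < 0} {x \<in> \<Omega>. \<phi> (\<Phi> x) > 0}"
    and v: "L2_norm (surface_measure \<Gamma>) v < \<infinity>" and g: "L2_norm (surface_measure \<Gamma>) g < \<infinity>"
    and gt: "gt = (\<lambda>x. transpose (D x) *v g (\<Phi> x))"
  shows "L2_norm (surface_measure K) (\<lambda>x. v (\<Phi> x)) \<le> 2 * L2_norm (surface_measure \<Gamma>) v"
    and "L2_norm (surface_measure \<Gamma>) v \<le> 2 * L2_norm (surface_measure K) (\<lambda>x. v (\<Phi> x))"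
    and "L2_norm (surface_measure K) gt \<le> 8 * L2_norm (surface_measure \<Gamma>) g"
    and "L2_norm (surface_measure \<Gamma>) g \<le> 8 * L2_norm (surface_measure K) gt"
    and "L2_norm (surface_measure K) (\<lambda>x. gt x \<bullet> nh x) \<le>
      48 * (ennreal \<epsilon> * L2_norm (surface_measure \<Gamma>) g + L2_norm (surface_measure \<Gamma>) (\<lambda>x. g x \<bullet> n x))"
    and "L2_norm (surface_measure \<Gamma>) (\<lambda>x. g x \<bullet> n x) \<le>
      48 * (ennreal \<epsilon> * L2_norm (surface_measure K) gt + L2_norm (surface_measure K) (\<lambda>x. gt x \<bullet> nh x))"
    and "L2_norm (surface_measure K) (\<lambda>x. tangential_projection (nh x) *v gt x) \<le>
      48 * (ennreal \<epsilon> * L2_norm (surface_measure \<Gamma>) g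
        + L2_norm (surface_measure \<Gamma>) (\<lambda>x. tangential_projection (n x) *v g x))"
    and "L2_norm (surface_measure \<Gamma>) (\<lambda>x. tangential_projection (n x) *v g x) \<le>
      48 * (ennreal \<epsilon> * L2_norm (surface_measure K) gt
        + L2_norm (surface_measure K) (\<lambda>x. tangential_projection (nh x) *v gt x))"
proof -
  let ?N = "surface_measure \<Gamma>" and ?Nh = "surface_measure K"
  have dim': "DIM(real^'n) \<le> 3" using dim by simp
  have \<Phi>: "continuous_on \<Omega> \<Phi>" "continuous_on \<Omega> \<Phi>'" "\<Phi> ` \<Omega> = \<Omega>" "\<And>x. x \<in> \<Omega> \<Longrightarrow> \<Phi>' x \<in> \<Omega>"
    "\<And>x. x \<in> \<Omega> \<Longrightarrow> \<Phi>' (\<Phi> x) = x" "\<And>x. x \<in> \<Omega> \<Longrightarrow> \<Phi> (\<Phi>' x) = x"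
    using hom by (auto simp: homeomorphism_def)
  have \<Phi>\<Omega>: "\<Phi> x \<in> \<Omega>" if "x \<in> \<Omega>" for x using \<Phi>(3) that by blast
  have K\<Omega>: "K \<subseteq> \<Omega>" and \<Gamma>\<Omega>: "\<Gamma> \<subseteq> \<Omega>" by (auto simp: K \<Gamma>(1))
  have inj: "inj_on \<Phi> K" by (rule inj_on_inverseI[of _ \<Phi>']) (simp add: \<Phi>(5) K)
  have contK: "continuous_on K \<Phi>" by (rule continuous_on_subset[OF \<Phi>(1) K\<Omega>])
  have K\<Gamma>: "\<Phi> ` K = \<Gamma>"
  proof (intro equalityI subsetI)
    fix x assume "x \<in> \<Gamma>"
    then have "x = \<Phi> (\<Phi>' x)" "\<Phi>' x \<in> K" using \<Phi>(4,6) by (simp_all add: K \<Gamma>(1))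
    then show "x \<in> \<Phi> ` K" by (rule image_eqI)
  qed (auto simp: K \<Gamma>(1) \<Phi>\<Omega>)
  have "K = \<Phi>' ` \<Gamma>"
  proof (intro equalityI subsetI)
    fix x assume "x \<in> K"
    then have "x = \<Phi>' (\<Phi> x)" "\<Phi> x \<in> \<Gamma>" using \<Phi>(5) \<Phi>\<Omega> by (simp_all add: K \<Gamma>(1))
    then show "x \<in> \<Phi>' ` \<Gamma>" by (rule image_eqI)
  qed (auto simp: K \<Gamma>(1) \<Phi>(4,6))
  then have cK: "compact K"
    using compact_continuous_image[OF continuous_on_subset[OF \<Phi>(2) \<Gamma>\<Omega>] \<Gamma>(2)] by simp
  have borel: "K \<in> sets borel" "\<Gamma> \<in> sets borel" using cK \<Gamma>(2) by (auto intro: borel_compact)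
  have L2: "(\<lambda>x. w (\<Phi> x)) \<in> borel_measurable ?Nh" "L2_norm ?Nh (\<lambda>x. w (\<Phi> x)) \<le> 2 * L2_norm ?N w"
    "L2_norm ?N w \<le> 2 * L2_norm ?Nh (\<lambda>x. w (\<Phi> x))"
    if "w \<in> borel_measurable ?N" for w :: "real^'n \<Rightarrow> 'z::{real_normed_vector, second_countable_topology}"
    using near_id_L2_norm[OF dim' \<Omega> cK K\<Omega> near contK inj, of w] that unfolding K\<Gamma> by blast+
  have U\<phi>: "continuous_on U \<phi>"
    using \<phi>(1) by (intro continuous_at_imp_continuous_on ballI differentiable_imp_continuous_within)
  have der: "(\<phi> has_derivative (\<lambda>h. h \<bullet> gradient \<phi> x)) (at x)" if "x \<in> \<Gamma>" for x
    using U(2) that by (intro has_derivative_gradient \<phi>(1)) blast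
  have n_eq: "n x = gradient \<phi> x /\<^sub>R norm (gradient \<phi> x)" if x: "x \<in> \<Gamma>" for x
    unfolding n \<Gamma>(1)
    by (rule unit_normal_level_set(2)[OF \<Omega> U(1) U(2)[unfolded \<Gamma>(1)] U\<phi> _ _ der[OF x] \<phi>(3)[OF x]])
      (use x \<Gamma>(1) in auto)
  have n1: "norm (n x) = 1" if "x \<in> \<Gamma>" for x using n_eq[OF that] \<phi>(3)[OF that] by simp
  have "continuous_on \<Gamma> n"
  proof (rule continuous_on_eq)
    show "continuous_on \<Gamma> (\<lambda>x. gradient \<phi> x /\<^sub>R norm (gradient \<phi> x))"
      using \<phi>(3) by (intro continuous_intros \<phi>(2)) auto
  qed (simp add: n_eq)
  then have nm: "n \<in> borel_measurable ?N" by (rule borel_measurable_surface_measure_continuous[OF borel(2)])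
  note vm = L2_norm_finiteD(1)[OF v] and gm = L2_norm_finiteD(1)[OF g]
  have gtm: "gt \<in> borel_measurable ?Nh"
    unfolding gt by (intro borel_measurable_matrix_vector_mult borel_measurable_transpose D(3) L2(1) gm)
  define m where "m x = transpose (D x) *v n (\<Phi> x)" for x
  have mm: "m \<in> borel_measurable ?Nh"
    unfolding m_def[abs_def]
    by (intro borel_measurable_matrix_vector_mult borel_measurable_transpose D(3) L2(1) nm)
  have AEK: "AE x in ?Nh. x \<in> K" by (rule AE_I2) simp
  have nh_eq: "AE x in ?Nh. m x /\<^sub>R norm (m x) = nh x"
    using D(1) AEK
  proof eventually_elim
    case (elim x)
    have x: "x \<in> \<Omega>" "\<phi> (\<Phi> x) = 0" "\<Phi> x \<in> \<Gamma>" using elim(2) \<Phi>\<Omega> by (auto simp: K \<Gamma>(1))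
    show ?case
      unfolding nh K m_def n_eq[OF x(3)]
      by (rule unit_normal_pullback[OF \<Omega> U(1) U(2)[unfolded \<Gamma>(1)] U\<phi> hom near x(1,2)
            der[OF x(3)] \<phi>(3)[OF x(3)] elim(1)[unfolded K] D(2)[OF elim(2)] \<epsilon>(2), symmetric])
  qed
  have nhm: "nh \<in> borel_measurable ?Nh"
  proof (rule borel_measurable_AE_eq[OF complete_measure_surface_measure[OF borel(1)] _ nh_eq])
    show "(\<lambda>x. m x /\<^sub>R norm (m x)) \<in> borel_measurable ?Nh" using mm by measurable
  qed
  have est: "AE x in ?Nh. norm (gt x) \<le> 2 * norm (g (\<Phi> x)) \<and> norm (g (\<Phi> x)) \<le> 2 * norm (gt x) \<and>
      \<bar>gt x \<bullet> nh x - g (\<Phi> x) \<bullet> n (\<Phi> x)\<bar> \<le> 3 * \<epsilon> * norm (g (\<Phi> x)) \<and>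
      norm (tangential_projection (nh x) *v gt x - tangential_projection (n (\<Phi> x)) *v g (\<Phi> x))
        \<le> 6 * \<epsilon> * norm (g (\<Phi> x))"
    using nh_eq AEK
  proof eventually_elim
    case (elim x)
    have \<Gamma>x: "\<Phi> x \<in> \<Gamma>" using elim(2) K\<Gamma> by blast
    note A = D(2)[OF elim(2)]
    have m0: "m x \<noteq> 0" and close: "norm (nh x - n (\<Phi> x)) \<le> 2 * \<epsilon>"
      using near_id_conormal[OF A \<epsilon>(2) n1[OF \<Gamma>x]] unfolding elim(1)[symmetric] m_def by simp_all
    have nh1: "norm (nh x) = 1" using m0 by (simp add: elim(1)[symmetric])
    show ?case
      unfolding gt using pullback_gradient_estimates[OF A \<epsilon>(2) n1[OF \<Gamma>x] nh1 close] by blast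
  qed
  have proj: "(\<lambda>x. tangential_projection (k x) *v w x) = (\<lambda>x. w x - (w x \<bullet> k x) *\<^sub>R k x)"
    for k w :: "real^'n \<Rightarrow> real^'n" by (simp add: tangential_projection_mult)
  have gn: "(\<lambda>x. g x \<bullet> n x) \<in> borel_measurable ?N" "(\<lambda>x. tangential_projection (n x) *v g x) \<in> borel_measurable ?N"
    unfolding proj using gm nm by measurable
  have gnh: "(\<lambda>x. gt x \<bullet> nh x) \<in> borel_measurable ?Nh"
    "(\<lambda>x. tangential_projection (nh x) *v gt x) \<in> borel_measurable ?Nh"
    unfolding proj using gtm nhm by measurable
  have zero: "L2_norm M (\<lambda>x. 0::real) = 0" for M :: "(real^'n) measure"
    by (simp add: L2_norm_def)
  have g\<Phi>: "L2_norm ?Nh (\<lambda>x. g (\<Phi> x)) < \<infinity>"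
    using L2(2)[OF gm] g by (simp add: order.strict_trans1 ennreal_mult_less_top)
  show "L2_norm ?Nh (\<lambda>x. v (\<Phi> x)) \<le> 2 * L2_norm ?N v" "L2_norm ?N v \<le> 2 * L2_norm ?Nh (\<lambda>x. v (\<Phi> x))"
    by (rule L2[OF vm])+
  have a1: "L2_norm ?Nh gt \<le> 2 * (ennreal 2 * L2_norm ?Nh (\<lambda>x. g (\<Phi> x)) + L2_norm ?Nh (\<lambda>x. 0::real))"
    by (rule L2_norm_le_of_AE_le_add[OF gtm g\<Phi>], simp, use est in eventually_elim) simp
  also have "\<dots> = 4 * L2_norm ?Nh (\<lambda>x. g (\<Phi> x))" unfolding zero by (simp flip: mult.assoc)
  also have "\<dots> \<le> 4 * (2 * L2_norm ?N g)" by (intro mult_left_mono L2(2) gm) simp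
  finally show a1: "L2_norm ?Nh gt \<le> 8 * L2_norm ?N g" by (simp flip: mult.assoc)
  then have gtf: "L2_norm ?Nh gt < \<infinity>"
    using g by (simp add: order.strict_trans1 ennreal_mult_less_top)
  have "L2_norm ?Nh (\<lambda>x. g (\<Phi> x)) \<le> 2 * (ennreal 2 * L2_norm ?Nh gt + L2_norm ?Nh (\<lambda>x. 0::real))"
    by (rule L2_norm_le_of_AE_le_add[OF L2(1)[OF gm] gtf], simp, use est in eventually_elim) simp
  then have "2 * L2_norm ?Nh (\<lambda>x. g (\<Phi> x)) \<le> 2 * (4 * L2_norm ?Nh gt)"
    unfolding zero by (intro mult_left_mono) (simp_all flip: mult.assoc)
  from order_trans[OF L2(3)[OF gm] this]
  show "L2_norm ?N g \<le> 8 * L2_norm ?Nh gt" by (simp flip: mult.assoc)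
  \<comment> \<open>The argument is the same for the normal and for the tangential parts \<open>b\<close>, \<open>b'\<close> of the two
    gradients, scalars in one case and vectors in the other.\<close>
  have transfer: "L2_norm ?Nh b' \<le> 48 * (ennreal \<epsilon> * L2_norm ?N g + L2_norm ?N b) \<and>
      L2_norm ?N b \<le> 48 * (ennreal \<epsilon> * L2_norm ?Nh gt + L2_norm ?Nh b')"
    if b: "b \<in> borel_measurable ?N" and b': "b' \<in> borel_measurable ?Nh" and k: "0 \<le> k" "k \<le> 6"
      and close: "AE x in ?Nh. norm (b' x - b (\<Phi> x)) \<le> k * \<epsilon> * norm (g (\<Phi> x))"
    for b b' :: "real^'n \<Rightarrow> 'z::{real_normed_vector, second_countable_topology}" and k
  proof
    have "L2_norm ?Nh b' \<le> 2 * (ennreal (k * \<epsilon>) * L2_norm ?Nh (\<lambda>x. g (\<Phi> x)) + L2_norm ?Nh (\<lambda>x. b (\<Phi> x)))"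
    proof (rule L2_norm_le_of_AE_le_add[OF b' g\<Phi>])
      show "AE x in ?Nh. norm (b' x) \<le> k * \<epsilon> * norm (g (\<Phi> x)) + norm (b (\<Phi> x))"
        using close
      proof eventually_elim
        case (elim x)
        then show ?case using norm_triangle_ineq[of "b' x - b (\<Phi> x)" "b (\<Phi> x)"] by simp
      qed
    qed (use k \<epsilon> in simp)
    also have "\<dots> \<le> 2 * (ennreal (k * \<epsilon>) * (2 * L2_norm ?N g) + 2 * L2_norm ?N b)"
      by (intro mult_left_mono add_mono L2(2) gm b) simp_all
    also have "\<dots> \<le> 48 * (ennreal \<epsilon> * L2_norm ?N g + L2_norm ?N b)"
      using k \<epsilon>(1) by (intro ennreal_combine_le) auto
    finally show "L2_norm ?Nh b' \<le> 48 * (ennreal \<epsilon> * L2_norm ?N g + L2_norm ?N b)" .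
    have "L2_norm ?Nh (\<lambda>x. b (\<Phi> x)) \<le> 2 * (ennreal (2 * k * \<epsilon>) * L2_norm ?Nh gt + L2_norm ?Nh b')"
    proof (rule L2_norm_le_of_AE_le_add[OF L2(1)[OF b] gtf])
      show "AE x in ?Nh. norm (b (\<Phi> x)) \<le> 2 * k * \<epsilon> * norm (gt x) + norm (b' x)"
        using close est
      proof eventually_elim
        case (elim x)
        have "k * \<epsilon> * norm (g (\<Phi> x)) \<le> k * \<epsilon> * (2 * norm (gt x))"
          using elim(2) k \<epsilon> by (intro mult_left_mono) auto
        then show ?case using elim(1) norm_triangle_ineq2[of "b (\<Phi> x)" "b' x"]
          by (simp add: norm_minus_commute)
      qed
    qed (use k \<epsilon> in simp)
    then have "2 * L2_norm ?Nh (\<lambda>x. b (\<Phi> x)) \<le> 2 * (2 * (ennreal (2 * k * \<epsilon>) * L2_norm ?Nh gt + L2_norm ?Nh b'))"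
      by (rule mult_left_mono) simp
    also have "\<dots> = 2 * (ennreal (2 * k * \<epsilon>) * (2 * L2_norm ?Nh gt) + 2 * L2_norm ?Nh b')"
      by (simp add: distrib_left mult.left_commute)
    also have "\<dots> \<le> 48 * (ennreal \<epsilon> * L2_norm ?Nh gt + L2_norm ?Nh b')"
      using k \<epsilon>(1) by (intro ennreal_combine_le) auto
    finally show "L2_norm ?N b \<le> 48 * (ennreal \<epsilon> * L2_norm ?Nh gt + L2_norm ?Nh b')"
      using L2(3)[OF b] by (rule order_trans[rotated])
  qed
  have normal: "AE x in ?Nh. norm (gt x \<bullet> nh x - g (\<Phi> x) \<bullet> n (\<Phi> x)) \<le> 3 * \<epsilon> * norm (g (\<Phi> x))"
    using est by eventually_elim simp
  from transfer[OF gn(1) gnh(1) _ _ normal]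
  show "L2_norm ?Nh (\<lambda>x. gt x \<bullet> nh x) \<le> 48 * (ennreal \<epsilon> * L2_norm ?N g + L2_norm ?N (\<lambda>x. g x \<bullet> n x))"
    "L2_norm ?N (\<lambda>x. g x \<bullet> n x) \<le> 48 * (ennreal \<epsilon> * L2_norm ?Nh gt + L2_norm ?Nh (\<lambda>x. gt x \<bullet> nh x))"
    by simp_all
  have tangential: "AE x in ?Nh. norm (tangential_projection (nh x) *v gt x -
      tangential_projection (n (\<Phi> x)) *v g (\<Phi> x)) \<le> 6 * \<epsilon> * norm (g (\<Phi> x))"
    using est by eventually_elim blast
  from transfer[OF gn(2) gnh(2) _ _ tangential]
  show "L2_norm ?Nh (\<lambda>x. tangential_projection (nh x) *v gt x) \<le>
      48 * (ennreal \<epsilon> * L2_norm ?N g + L2_norm ?N (\<lambda>x. tangential_projection (n x) *v g x))"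
    "L2_norm ?N (\<lambda>x. tangential_projection (n x) *v g x) \<le>
      48 * (ennreal \<epsilon> * L2_norm ?Nh gt + L2_norm ?Nh (\<lambda>x. tangential_projection (nh x) *v gt x))"
    by simp_all
qed

section \<open>The polyhedral domain and the level set function\<close>

lemma polyhedral_domainD:
  assumes "polyhedral_domain \<Omega>"
  shows "open \<Omega>" "bounded \<Omega>" "interior (closure \<Omega>) = \<Omega>"
proof -
  obtain P where P: "finite P" "\<forall>p\<in>P. polytope p" "\<Omega> = interior (\<Union>P)"
    using assms by (auto simp: polyhedral_domain_def)
  have c: "compact (\<Union>P)" using P(1,2) by (intro compact_Union) (auto intro: polytope_imp_compact)
  show o: "open \<Omega>" by (simp add: P(3))
  show "bounded \<Omega>"
    using compact_imp_bounded[OF c] interior_subset unfolding P(3) by (rule bounded_subset)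
  have "closure \<Omega> \<subseteq> \<Union>P"
    unfolding P(3) by (rule closure_minimal[OF interior_subset compact_imp_closed[OF c]])
  then have "interior (closure \<Omega>) \<subseteq> \<Omega>" unfolding P(3) by (rule interior_mono)
  moreover have "\<Omega> \<subseteq> interior (closure \<Omega>)" by (rule interior_maximal[OF closure_subset o])
  ultimately show "interior (closure \<Omega>) = \<Omega>" by blast
qed

lemma Ck_on_imp_continuous_on: "Ck_on k f U \<Longrightarrow> continuous_on U f"
proof (cases k)
  case (Suc j)
  assume "Ck_on k f U"
  then show ?thesis
    unfolding Suc by (intro continuous_at_imp_continuous_on ballI differentiable_imp_continuous_within) simp
qed simp

lemma continuous_on_gradient:
  fixes f :: "'a::euclidean_space \<Rightarrow> real"
  assumes "Ck_on (Suc k) f U"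
  shows "continuous_on U (gradient f)"
proof (rule continuous_on_eq)
  have "continuous_on U (\<lambda>x. frechet_derivative f (at x) b)" for b
    using assms by (intro Ck_on_imp_continuous_on[of k]) simp
  then show "continuous_on U (\<lambda>x. \<Sum>b\<in>Basis. frechet_derivative f (at x) b *\<^sub>R b)"
    by (intro continuous_intros)
  fix x assume "x \<in> U"
  then have diff: "f differentiable (at x)" using assms by simp
  have "(f has_derivative frechet_derivative f (at x)) (at x)"
    using diff by (simp add: frechet_derivative_works)
  then have "frechet_derivative f (at x) = (\<lambda>h. h \<bullet> gradient f x)"
    using has_derivative_gradient[OF diff] by (rule has_derivative_unique)
  then have "(\<Sum>b\<in>Basis. frechet_derivative f (at x) b *\<^sub>R b) = (\<Sum>b\<in>Basis. (gradient f x \<bullet> b) *\<^sub>R b)"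
    by (simp add: inner_commute)
  then show "(\<Sum>b\<in>Basis. frechet_derivative f (at x) b *\<^sub>R b) = gradient f x"
    by (simp add: euclidean_representation)
qed

section \<open>Finite element functions on one element\<close>

lemma lipschitz_bounded_mult:
  fixes f g :: "'a::metric_space \<Rightarrow> real"
  assumes S: "bounded S" and f: "\<exists>L. L-lipschitz_on S f" and g: "\<exists>L. L-lipschitz_on S g"
  shows "\<exists>L. L-lipschitz_on S (\<lambda>x. f x * g x)"
proof (cases "S = {}")
  case True
  then show ?thesis by (intro exI[of _ 0]) simp
next
  case False
  then obtain a where a: "a \<in> S" by blast
  obtain d where d: "\<And>x. x \<in> S \<Longrightarrow> dist a x \<le> d" using S unfolding bounded_any_center[of S a] by blast
  have d0: "d \<ge> 0" using d[OF a] by simp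
  have bnd: "\<bar>h x\<bar> \<le> \<bar>h a\<bar> + L * d" if "L-lipschitz_on S h" "x \<in> S" for h :: "'a \<Rightarrow> real" and L x
  proof -
    have "dist (h a) (h x) \<le> L * dist a x" by (rule lipschitz_onD[OF that(1) a that(2)])
    also have "\<dots> \<le> L * d" using d[OF that(2)] lipschitz_on_nonneg[OF that(1)] by (rule mult_left_mono)
    finally show ?thesis by (simp add: dist_real_def)
  qed
  obtain L M where L: "L-lipschitz_on S f" and M: "M-lipschitz_on S g" using f g by blast
  define A B where "A = \<bar>f a\<bar> + L * d" and "B = \<bar>g a\<bar> + M * d"
  have nn: "L \<ge> 0" "M \<ge> 0" using L M lipschitz_on_nonneg by blast+
  have AB: "A \<ge> 0" "B \<ge> 0" using nn d0 by (simp_all add: A_def B_def)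
  have "(A * M + B * L)-lipschitz_on S (\<lambda>x. f x * g x)"
  proof (rule lipschitz_onI)
    fix x y assume xy: "x \<in> S" "y \<in> S"
    have "f x * g x - f y * g y = f x * (g x - g y) + g y * (f x - f y)" by (simp add: algebra_simps)
    then have "dist (f x * g x) (f y * g y) \<le> \<bar>f x\<bar> * \<bar>g x - g y\<bar> + \<bar>g y\<bar> * \<bar>f x - f y\<bar>"
      unfolding dist_real_def by (metis abs_mult abs_triangle_ineq)
    also have "\<dots> \<le> A * (M * dist x y) + B * (L * dist x y)"
    proof (intro add_mono mult_mono)
      show "\<bar>f x\<bar> \<le> A" "\<bar>g y\<bar> \<le> B" using bnd[OF L xy(1)] bnd[OF M xy(2)] by (simp_all add: A_def B_def)
      show "\<bar>g x - g y\<bar> \<le> M * dist x y" "\<bar>f x - f y\<bar> \<le> L * dist x y"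
        using lipschitz_onD[OF M xy] lipschitz_onD[OF L xy] by (simp_all add: dist_real_def)
    qed (use AB in auto)
    finally show "dist (f x * g x) (f y * g y) \<le> (A * M + B * L) * dist x y" by (simp add: algebra_simps)
  qed (use AB nn in simp)
  then show ?thesis by blast
qed

lemma poly_fun_lipschitz_on_bounded:
  assumes S: "bounded S" and p: "poly_fun k p"
  shows "\<exists>L. L-lipschitz_on S p"
proof -
  obtain c where c: "p = (\<lambda>x. \<Sum>\<alpha> | sum \<alpha> UNIV \<le> k. c \<alpha> * (\<Prod>i\<in>UNIV. (x $ i) ^ \<alpha> i))"
    using p by (auto simp: poly_fun_def)
  have const: "\<exists>L. L-lipschitz_on S (\<lambda>x. a)" for a :: real by (rule exI[of _ 0]) (rule lipschitz_on_constant)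
  have coord: "\<exists>L. L-lipschitz_on S (\<lambda>x. x $ i)" for i
    by (intro exI[of _ 1] lipschitz_onI) (simp_all add: dist_vec_nth_le)
  have pow: "\<exists>L. L-lipschitz_on S (\<lambda>x. (x $ i) ^ m)" for i m
  proof (induction m)
    case (Suc m)
    show ?case using lipschitz_bounded_mult[OF S coord Suc.IH] by simp
  qed (simp add: const)
  have monom: "\<exists>L. L-lipschitz_on S (\<lambda>x. \<Prod>i\<in>I. (x $ i) ^ \<alpha> i)" for I \<alpha>
  proof (induction I rule: infinite_finite_induct)
    case (insert i I)
    then show ?case using lipschitz_bounded_mult[OF S pow insert.IH] by simp
  qed (simp_all add: const)
  have "\<exists>L. L-lipschitz_on S (\<lambda>x. \<Sum>\<alpha>\<in>A. c \<alpha> * (\<Prod>i\<in>UNIV. (x $ i) ^ \<alpha> i))" for A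
  proof (induction A rule: infinite_finite_induct)
    case (insert \<alpha> A)
    obtain L M where "L-lipschitz_on S (\<lambda>x. c \<alpha> * (\<Prod>i\<in>UNIV. (x $ i) ^ \<alpha> i))"
      "M-lipschitz_on S (\<lambda>x. \<Sum>\<alpha>\<in>A. c \<alpha> * (\<Prod>i\<in>UNIV. (x $ i) ^ \<alpha> i))"
      using lipschitz_bounded_mult[OF S const monom] insert.IH by blast
    then have "(L + M)-lipschitz_on S (\<lambda>x. c \<alpha> * (\<Prod>i\<in>UNIV. (x $ i) ^ \<alpha> i) +
        (\<Sum>\<alpha>\<in>A. c \<alpha> * (\<Prod>i\<in>UNIV. (x $ i) ^ \<alpha> i)))" by (rule lipschitz_on_add)
    then show ?case using insert.hyps by auto
  qed (simp_all add: const)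
  then show ?thesis by (simp add: c)
qed

text \<open>With this bound the deformation maps sets of low dimension within an element to null sets.\<close>

lemma fe_vector_lipschitz_on_element:
  assumes T: "T \<in> \<T>" "bounded T" and \<Theta>: "\<And>i. (\<lambda>x. \<Theta> x $ i) \<in> fe_space q \<T>"
  shows "\<exists>L. L-lipschitz_on T (\<Theta> :: real^'n \<Rightarrow> real^'n)"
proof -
  have "\<exists>L. L-lipschitz_on T (\<lambda>x. \<Theta> x $ i)" for i
  proof -
    have "piecewise_poly q \<T> (\<lambda>x. \<Theta> x $ i)" using \<Theta>[of i] by (simp add: fe_space_def)
    then obtain p where p: "poly_fun q p" "\<And>x. x \<in> T \<Longrightarrow> \<Theta> x $ i = p x"
      using T(1) unfolding piecewise_poly_def by blast
    from poly_fun_lipschitz_on_bounded[OF T(2) p(1)] obtain L where "L-lipschitz_on T p" by blast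
    then have "L-lipschitz_on T (\<lambda>x. \<Theta> x $ i)" by (rule lipschitz_on_transform) (simp add: p(2))
    then show ?thesis by blast
  qed
  then obtain L where L: "\<And>i. (L i)-lipschitz_on T (\<lambda>x. \<Theta> x $ i)" by metis
  have "(sum L UNIV)-lipschitz_on T \<Theta>"
  proof (rule lipschitz_onI)
    fix x y assume xy: "x \<in> T" "y \<in> T"
    have "dist (\<Theta> x) (\<Theta> y) \<le> (\<Sum>i\<in>UNIV. \<bar>(\<Theta> x - \<Theta> y) $ i\<bar>)" unfolding dist_norm by (rule norm_le_l1_cart)
    also have "\<dots> \<le> (\<Sum>i\<in>UNIV. L i * dist x y)"
      using lipschitz_onD[OF L xy] by (intro sum_mono) (simp add: dist_real_def)
    finally show "dist (\<Theta> x) (\<Theta> y) \<le> sum L UNIV * dist x y" by (simp add: sum_distrib_right)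
  qed (use lipschitz_on_nonneg[OF L] in \<open>simp add: sum_nonneg\<close>)
  then show ?thesis by blast
qed

lemma poly_fun_1_affine:
  fixes p :: "real^'n \<Rightarrow> real"
  assumes p: "poly_fun 1 p" and uv: "u + v = 1"
  shows "p (u *\<^sub>R x + v *\<^sub>R y) = u * p x + v * p y"
proof -
  obtain c where c: "p = (\<lambda>x. \<Sum>\<alpha> | sum \<alpha> UNIV \<le> 1. c \<alpha> * (\<Prod>i\<in>UNIV. (x $ i) ^ \<alpha> i))"
    using p by (auto simp: poly_fun_def)
  have monom: "(\<Prod>i\<in>UNIV. ((u *\<^sub>R x + v *\<^sub>R y) $ i) ^ \<alpha> i) =
      u * (\<Prod>i\<in>UNIV. (x $ i) ^ \<alpha> i) + v * (\<Prod>i\<in>UNIV. (y $ i) ^ \<alpha> i)"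
    if \<alpha>: "sum \<alpha> UNIV \<le> 1" for \<alpha> :: "'n \<Rightarrow> nat"
  proof (cases "\<exists>j. \<alpha> j \<noteq> 0")
    case True
    then obtain j where j: "\<alpha> j \<noteq> 0" by blast
    have "sum \<alpha> UNIV = \<alpha> j + sum \<alpha> (UNIV - {j})" by (simp add: sum.remove)
    then have 1: "\<alpha> j = 1" "sum \<alpha> (UNIV - {j}) = 0" using \<alpha> j by linarith+
    then have 0: "\<alpha> i = 0" if "i \<noteq> j" for i using that by (simp add: sum_eq_0_iff)
    have eval: "(\<Prod>i\<in>UNIV. (z $ i) ^ \<alpha> i) = z $ j" for z :: "real^'n"
    proof -
      have "(\<Prod>i\<in>UNIV. (z $ i) ^ \<alpha> i) = (z $ j) ^ \<alpha> j * (\<Prod>i\<in>UNIV - {j}. (z $ i) ^ \<alpha> i)"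
        by (simp add: prod.remove)
      also have "(\<Prod>i\<in>UNIV - {j}. (z $ i) ^ \<alpha> i) = 1" by (rule prod.neutral) (simp add: 0)
      finally show ?thesis using 1 by simp
    qed
    show ?thesis unfolding eval by simp
  next
    case False
    then show ?thesis using uv by simp
  qed
  show ?thesis
    unfolding c sum_distrib_left sum.distrib[symmetric]
  proof (rule sum.cong[OF refl])
    fix \<alpha> :: "'n \<Rightarrow> nat" assume "\<alpha> \<in> {\<alpha>. sum \<alpha> UNIV \<le> 1}"
    then have "sum \<alpha> UNIV \<le> 1" by simp
    from monom[OF this]
    show "c \<alpha> * (\<Prod>i\<in>UNIV. ((u *\<^sub>R x + v *\<^sub>R y) $ i) ^ \<alpha> i) =
        u * (c \<alpha> * (\<Prod>i\<in>UNIV. (x $ i) ^ \<alpha> i)) + v * (c \<alpha> * (\<Prod>i\<in>UNIV. (y $ i) ^ \<alpha> i))"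
      by (simp only: distrib_left mult.left_commute)
  qed
qed

text \<open>If the zeros of an affine function in a proper face span a hyperplane, then that hyperplane
  is spanned by the face as well. A zero in \<open>T\<close> outside the face lies off this hyperplane, so the
  function would vanish everywhere.\<close>

lemma zero_set_subset_face:
  fixes T F :: "(real^'n) set"
  assumes T: "convex T" "aff_dim T = int CARD('n)" and F: "F face_of T" "F \<noteq> T"
    and p: "poly_fun 1 p" and nz: "\<exists>x\<in>T. p x \<noteq> 0"
    and big: "int CARD('n) - 1 \<le> aff_dim {x \<in> F. p x = 0}"
  shows "{x \<in> T. p x = 0} \<subseteq> F"
proof (rule subsetI, rule ccontr)
  let ?G = "{x \<in> F. p x = 0}"
  fix u assume "u \<in> {x \<in> T. p x = 0}" and uF: "u \<notin> F"
  then have u: "u \<in> T" "p u = 0" by auto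
  have lt: "aff_dim F < int CARD('n)" using face_of_aff_dim_lt[OF T(1) F] T(2) by simp
  have sub: "?G \<subseteq> F" by blast
  have "aff_dim ?G = aff_dim F" using aff_dim_subset[OF sub] lt big by linarith
  then have hull: "affine hull ?G = affine hull F" using aff_dim_eq_full_gen[OF sub] by blast
  have "u \<notin> affine hull F" using face_of_imp_eq_affine_Int[OF T(1) F(1)] u uF by blast
  then have "aff_dim (insert u ?G) = aff_dim ?G + 1" by (simp add: aff_dim_insert hull)
  then have "aff_dim (insert u ?G) \<ge> int DIM(real^'n)" using big by simp
  then have "aff_dim (insert u ?G) = int DIM(real^'n)" using aff_dim_le_DIM[of "insert u ?G"] by linarith
  then have "affine hull (insert u ?G) = UNIV" by (simp only: aff_dim_eq_full)
  moreover have "affine hull (insert u ?G) \<subseteq> {x. p x = 0}"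
  proof (rule hull_minimal)
    show "affine {x. p x = 0}" unfolding affine_def by (simp add: poly_fun_1_affine[OF p])
  qed (use u in auto)
  ultimately show False using nz by blast
qed

section \<open>Elementwise smooth maps on a curved mesh\<close>

text \<open>The deformation is a homeomorphism of the open set \<open>\<Omega>\<close>, while elements may touch its boundary.
  The curved elements are therefore the images of \<open>T \<inter> \<Omega>\<close>, which are closed relative to \<open>\<Omega>\<close>.\<close>

locale curved_mesh =
  fixes \<Omega> :: "(real^'n) set" and \<T> :: "(real^'n) set set" and \<Theta> \<Theta>' :: "real^'n \<Rightarrow> real^'n"
  assumes open_\<Omega>: "open \<Omega>" and regular: "interior (closure \<Omega>) = \<Omega>"
    and mesh: "triangulation \<T>" "\<And>T. T \<in> \<T> \<Longrightarrow> int DIM(real^'n) simplex T" "\<Union>\<T> = closure \<Omega>"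
    and hom: "homeomorphism \<Omega> \<Omega> \<Theta> \<Theta>'"
begin

lemma finite_mesh: "finite \<T>" using mesh(1) by (simp add: triangulation_def)

lemma deformation:
  "continuous_on \<Omega> \<Theta>" "continuous_on \<Omega> \<Theta>'" "\<Theta> ` \<Omega> = \<Omega>"
  "\<And>x. x \<in> \<Omega> \<Longrightarrow> \<Theta> x \<in> \<Omega>" "\<And>x. x \<in> \<Omega> \<Longrightarrow> \<Theta>' x \<in> \<Omega>"
  "\<And>x. x \<in> \<Omega> \<Longrightarrow> \<Theta>' (\<Theta> x) = x" "\<And>x. x \<in> \<Omega> \<Longrightarrow> \<Theta> (\<Theta>' x) = x"
  using hom by (auto simp: homeomorphism_def)

lemma element:
  assumes "T \<in> \<T>"
  shows "convex T" "compact T" "aff_dim T = int CARD('n)" "interior T \<subseteq> \<Omega>" "closure (interior T) = T"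
    "interior T \<noteq> {}"
proof -
  have poly: "polytope T" by (rule simplex_imp_polytope[OF mesh(2)[OF assms]])
  show "convex T" "compact T" using poly by (simp_all add: polytope_imp_convex polytope_imp_compact)
  show dim: "aff_dim T = int CARD('n)" using aff_dim_simplex[OF mesh(2)[OF assms]] by simp
  have int: "interior T = rel_interior T" using dim by (simp add: interior_rel_interior_gen)
  have cl: "closed T" by (rule compact_imp_closed) fact
  show clos: "closure (interior T) = T"
    unfolding int convex_closure_rel_interior[OF \<open>convex T\<close>] using cl by simp
  show "interior T \<subseteq> \<Omega>" using assms mesh(3) by (subst regular[symmetric], intro interior_mono) blast
  have "T \<noteq> {}" using dim by auto
  then show "interior T \<noteq> {}" using clos by auto
qed

lemma face_Int: "T \<in> \<T> \<Longrightarrow> T' \<in> \<T> \<Longrightarrow> (T \<inter> T') face_of T"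
  using mesh(1) by (simp add: triangulation_def)

lemma proper_face_Int:
  assumes "T \<in> \<T>" "T' \<in> \<T>" "T \<noteq> T'"
  shows "T \<inter> T' \<noteq> T"
proof
  assume eq: "T \<inter> T' = T"
  then have "T face_of T'" using face_Int[OF assms(2,1)] by (simp add: Int_commute)
  then have "aff_dim T < aff_dim T'" using assms by (intro face_of_aff_dim_lt element(1)) auto
  then show False using element(3) assms by simp
qed

lemma element_unique_interior:
  assumes "T \<in> \<T>" "T' \<in> \<T>" "x \<in> interior T" "x \<in> T'"
  shows "T = T'"
proof (rule ccontr)
  assume ne: "T \<noteq> T'"
  have "(T \<inter> T') \<inter> interior T = {}"
    by (rule face_of_disjoint_interior[OF face_Int[OF assms(1,2)] proper_face_Int[OF assms(1,2) ne]])
  then show False using assms interior_subset by blast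
qed

lemma cover: "x \<in> \<Omega> \<Longrightarrow> \<exists>T\<in>\<T>. x \<in> \<Theta> ` (T \<inter> \<Omega>)"
proof -
  assume x: "x \<in> \<Omega>"
  then have "\<Theta>' x \<in> \<Union>\<T>" using closure_subset deformation(5) mesh(3) by blast
  then obtain T where "T \<in> \<T>" "\<Theta>' x \<in> T \<inter> \<Omega>" using deformation(5)[OF x] by blast
  moreover have "x = \<Theta> (\<Theta>' x)" using deformation(7)[OF x] by simp
  ultimately show ?thesis by (intro bexI[of _ T] image_eqI)
qed

lemma mem_image_iff: "x \<in> \<Omega> \<Longrightarrow> x \<in> \<Theta> ` (T \<inter> \<Omega>) \<longleftrightarrow> \<Theta>' x \<in> T"
proof
  assume "x \<in> \<Omega>" "\<Theta>' x \<in> T"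
  then show "x \<in> \<Theta> ` (T \<inter> \<Omega>)" using deformation(5,7) by (intro image_eqI[of _ _ "\<Theta>' x"]) auto
qed (use deformation(6) in auto)

text \<open>The curved elements are finitely many relatively closed sets, so those that do not contain \<open>x\<close>
  keep away from it.\<close>

lemma eventually_touching:
  assumes x: "x \<in> \<Omega>"
  shows "\<forall>\<^sub>F y in at x. y \<in> \<Omega> \<and> (\<forall>T\<in>\<T>. y \<in> \<Theta> ` (T \<inter> \<Omega>) \<longrightarrow> x \<in> \<Theta> ` (T \<inter> \<Omega>))"
proof -
  have in\<Omega>: "\<forall>\<^sub>F y in at x. y \<in> \<Omega>"
    using open_\<Omega> x by (rule eventually_at_in_open')
  have "\<forall>\<^sub>F y in at x. y \<in> \<Theta> ` (T \<inter> \<Omega>) \<longrightarrow> x \<in> \<Theta> ` (T \<inter> \<Omega>)" if T: "T \<in> \<T>" for T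
  proof (cases "\<Theta>' x \<in> T")
    case True
    then show ?thesis using mem_image_iff[OF x] by simp
  next
    case False
    have "open (\<Omega> \<inter> \<Theta>' -` (- T))"
      using continuous_open_preimage[OF deformation(2) open_\<Omega>] compact_imp_closed[OF element(2)[OF T]] by (simp add: open_Compl)
    then have "\<forall>\<^sub>F y in at x. y \<in> \<Omega> \<inter> \<Theta>' -` (- T)"
      by (rule eventually_at_in_open') (use x False in auto)
    then show ?thesis by eventually_elim (use mem_image_iff in auto)
  qed
  then have "\<forall>\<^sub>F y in at x. \<forall>T\<in>\<T>. y \<in> \<Theta> ` (T \<inter> \<Omega>) \<longrightarrow> x \<in> \<Theta> ` (T \<inter> \<Omega>)"
    using finite_mesh by (simp add: eventually_ball_finite)
  with in\<Omega> show ?thesis by (rule eventually_conj)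
qed

lemma open_image_interior:
  assumes "T \<in> \<T>"
  shows "open (\<Theta> ` interior T)"
proof (rule invariance_of_domain)
  show "continuous_on (interior T) \<Theta>" by (rule continuous_on_subset[OF deformation(1) element(4)[OF assms]])
  show "inj_on \<Theta> (interior T)"
    by (rule inj_on_inverseI[of _ \<Theta>']) (use deformation(6) element(4)[OF assms] in blast)
qed simp

text \<open>Inside a curved element only one element is available for the value of \<open>D\<close>, so \<open>D\<close> is the
  derivative of \<open>\<Phi>\<close> there; as this is continuous, the essential bound holds at each point, and by
  continuity up to the boundary of the element. So it holds at an interface between elements for
  the derivatives from every side.\<close>

lemma jacobian_bound:
  assumes jac: "elementwise_jacobian \<Omega> \<T> \<Theta> \<Phi> D"
    and ae: "AE x in lebesgue_on \<Omega>. norm (D x - mat 1) \<le> \<epsilon>"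
    and T: "T \<in> \<T>" and x: "x \<in> \<Theta> ` (T \<inter> \<Omega>)" and F: "Ck_extension_on 1 \<Phi> (\<Theta> ` (T \<inter> \<Omega>)) F"
    and A: "(F has_derivative (\<lambda>y. A *v y)) (at x)"
  shows "norm (A - mat 1) \<le> \<epsilon>"
proof -
  obtain W where W: "open W" "\<Theta> ` (T \<inter> \<Omega>) \<subseteq> W" "Ck_on 1 F W" and F\<Phi>: "\<And>y. y \<in> \<Theta> ` (T \<inter> \<Omega>) \<Longrightarrow> F y = \<Phi> y"
    using F unfolding Ck_extension_on_def by blast
  define J where "J y = matrix (frechet_derivative F (at y))" for y
  define N where "N y = norm (J y - mat 1)" for y
  have J: "(F has_derivative (\<lambda>w. J y *v w)) (at y)" if "y \<in> W" for y
  proof -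
    have "F differentiable (at y)" using W(3) that by simp
    then have der: "(F has_derivative frechet_derivative F (at y)) (at y)" by (simp add: frechet_derivative_works)
    have "(\<lambda>w. J y *v w) = frechet_derivative F (at y)"
      unfolding J_def by (rule matrix_vector_mul(3)[OF has_derivative_bounded_linear[OF der]])
    then show ?thesis using der by simp
  qed
  have matrix_unique: "B = J y" if "(F has_derivative (\<lambda>w. B *v w)) (at y)" "y \<in> W" for B y
    using has_derivative_unique[OF that(1) J[OF that(2)]] by (simp add: matrix_eq fun_eq_iff)
  have contN: "continuous_on W N"
    unfolding N_def J_def matrix_def
    using W(3) by (intro continuous_intros continuous_on_vec_lambda) (simp add: axis_def)
  let ?I = "\<Theta> ` interior T"
  have I: "open ?I" "?I \<subseteq> \<Theta> ` (T \<inter> \<Omega>)" "?I \<subseteq> \<Omega>"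
    using open_image_interior[OF T] element(4)[OF T] interior_subset deformation(4) by auto
  have DJ: "D y = J y" if y: "y \<in> ?I" for y
  proof -
    have y\<Omega>: "y \<in> \<Omega>" using y I by blast
    obtain z where z: "z \<in> interior T" "y = \<Theta> z" using y by blast
    obtain T' F' where T': "T' \<in> \<T>" "y \<in> \<Theta> ` (T' \<inter> \<Omega>)" "Ck_extension_on 1 \<Phi> (\<Theta> ` (T' \<inter> \<Omega>)) F'"
      and D: "(F' has_derivative (\<lambda>w. D y *v w)) (at y)"
      using jac y\<Omega> unfolding elementwise_jacobian_def by blast
    have "\<Theta>' y = z" using z deformation(6) element(4)[OF T] by blast
    then have "z \<in> T'" using T'(2) mem_image_iff[OF y\<Omega>] by blast
    then have eq: "T' = T" using element_unique_interior[OF T T'(1) z(1)] by simp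
    have "F' u = F u" if "u \<in> ?I" for u
      using that I(2) F\<Phi> T'(3) unfolding Ck_extension_on_def eq by (metis subsetD)
    then have "(F has_derivative (\<lambda>w. D y *v w)) (at y)"
      by (rule has_derivative_transform_within_open[OF D I(1) y])
    then show ?thesis using y I(2) W(2) by (intro matrix_unique) auto
  qed
  have int: "N y \<le> \<epsilon>" if y: "y \<in> ?I" for y
  proof (rule ccontr)
    assume "\<not> N y \<le> \<epsilon>"
    \<comment> \<open>A nonempty open set on which the essential bound fails.\<close>
    define V where "V = ?I \<inter> N -` {\<epsilon><..}"
    have "continuous_on ?I N" using contN I(2) W(2) by (auto intro: continuous_on_subset)
    then have "open V" unfolding V_def using I(1) by (rule continuous_open_preimage) simp
    moreover have "V \<noteq> {}" using y \<open>\<not> N y \<le> \<epsilon>\<close> by (auto simp: V_def)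
    moreover have "negligible V"
    proof -
      have "AE x in lebesgue. x \<in> \<Omega> \<longrightarrow> norm (D x - mat 1) \<le> \<epsilon>"
        using ae open_\<Omega> by (subst (asm) AE_restrict_space_iff) auto
      then obtain Z where Z: "Z \<in> null_sets lebesgue" "{x. \<not> (x \<in> \<Omega> \<longrightarrow> norm (D x - mat 1) \<le> \<epsilon>)} \<subseteq> Z"
        unfolding eventually_ae_filter by auto
      have "V \<subseteq> Z"
      proof
        fix u assume u: "u \<in> V"
        then have "u \<in> ?I" "\<epsilon> < N u" by (simp_all add: V_def)
        then have "\<not> norm (D u - mat 1) \<le> \<epsilon>" "u \<in> \<Omega>" using DJ I(3) by (auto simp: N_def)
        then show "u \<in> Z" using Z(2) by blast
      qed
      then show ?thesis using Z(1) negligible_subset unfolding negligible_iff_null_sets[symmetric] by blast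
    qed
    ultimately show False using open_not_negligible by blast
  qed
  obtain z where z: "z \<in> T" "z \<in> \<Omega>" "x = \<Theta> z" using x by blast
  have "z \<in> closure (interior T)" using z(1) element(5)[OF T] by simp
  then obtain s where s: "\<And>k::nat. s k \<in> interior T" "s \<longlonglongrightarrow> z" unfolding closure_sequential by blast
  have s\<Omega>: "s k \<in> \<Omega>" for k using s(1) element(4)[OF T] by blast
  have "(\<lambda>k. \<Theta> (s k)) \<longlonglongrightarrow> \<Theta> z"
    by (rule continuous_on_tendsto_compose[OF deformation(1) s(2) z(2)]) (simp add: s\<Omega>)
  moreover have "\<Theta> (s k) \<in> W" for k using s(1) I(2) W(2) by blast
  ultimately have "(\<lambda>k. N (\<Theta> (s k))) \<longlonglongrightarrow> N x"
    using x W(2) by (intro continuous_on_tendsto_compose[OF contN]) (auto simp: z(3))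
  moreover have "\<exists>k0. \<forall>k\<ge>k0. N (\<Theta> (s k)) \<le> \<epsilon>" using int s(1) by blast
  ultimately have "N x \<le> \<epsilon>" by (rule LIMSEQ_le_const2)
  moreover have "A = J x" using x W(2) by (intro matrix_unique[OF A]) auto
  ultimately show ?thesis by (simp add: N_def)
qed

text \<open>Every point near \<open>x\<close> lies in one of the finitely many curved elements that contain \<open>x\<close>, and on
  each of these \<open>\<Phi>\<close> agrees with a function whose Jacobian at \<open>x\<close> is close to the identity.\<close>

lemma infinitesimally_near_id_of_jacobian_bound:
  assumes jac: "elementwise_jacobian \<Omega> \<T> \<Theta> \<Phi> D"
    and smooth: "elementwise_smooth k \<Phi> {\<Theta> ` (T \<inter> \<Omega>) | T. T \<in> \<T>}"
    and ae: "AE x in lebesgue_on \<Omega>. norm (D x - mat 1) \<le> \<epsilon>" and c: "\<epsilon> < c"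
  shows "infinitesimally_near_id c \<Phi> \<Omega>"
  unfolding infinitesimally_near_id_def
proof
  fix x assume x: "x \<in> \<Omega>"
  let ?P = "\<lambda>y. norm (\<Phi> y - \<Phi> x - (y - x)) \<le> c * norm (y - x)"
  have "\<forall>\<^sub>F y in at x. y \<in> \<Theta> ` (T \<inter> \<Omega>) \<longrightarrow> x \<in> \<Theta> ` (T \<inter> \<Omega>) \<longrightarrow> ?P y" if T: "T \<in> \<T>" for T
  proof (cases "x \<in> \<Theta> ` (T \<inter> \<Omega>)")
    case xT: True
    obtain F where F: "Ck_extension_on 1 \<Phi> (\<Theta> ` (T \<inter> \<Omega>)) F"
      using smooth T unfolding elementwise_smooth_def by blast
    then obtain W where W: "\<Theta> ` (T \<inter> \<Omega>) \<subseteq> W" "Ck_on 1 F W" and F\<Phi>: "\<And>y. y \<in> \<Theta> ` (T \<inter> \<Omega>) \<Longrightarrow> F y = \<Phi> y"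
      unfolding Ck_extension_on_def by blast
    have "F differentiable (at x)" using W xT by auto
    then obtain f where f: "(F has_derivative f) (at x)" unfolding differentiable_def by blast
    have "f = (\<lambda>w. matrix f *v w)" by (rule matrix_vector_mul(3)[OF has_derivative_bounded_linear[OF f], symmetric])
    then have A: "(F has_derivative (\<lambda>w. matrix f *v w)) (at x)" using f by simp
    note bound = jacobian_bound[OF jac ae T xT F A]
    obtain d where d: "d > 0"
      "\<And>y. norm (y - x) < d \<Longrightarrow> norm (F y - F x - matrix f *v (y - x)) \<le> (c - \<epsilon>) * norm (y - x)"
      using A c unfolding has_derivative_within_alt by (metis UNIV_I diff_gt_0_iff_gt)
    have "\<forall>\<^sub>F y in at x. dist y x < d" using d(1) by (auto simp: eventually_at)
    then show ?thesis
    proof eventually_elim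
      case (elim y)
      show ?case
      proof (intro impI)
        assume y: "y \<in> \<Theta> ` (T \<inter> \<Omega>)"
        have "norm (F y - F x - matrix f *v (y - x)) \<le> (c - \<epsilon>) * norm (y - x)"
          using elim by (intro d(2)) (simp add: dist_norm)
        moreover have "norm (matrix f *v (y - x) - (y - x)) \<le> \<epsilon> * norm (y - x)"
          by (rule near_id_matrix(1)[OF bound])
        moreover have "F y - F x - (y - x) =
            (F y - F x - matrix f *v (y - x)) + (matrix f *v (y - x) - (y - x))" by simp
        then have "norm (F y - F x - (y - x)) \<le>
            norm (F y - F x - matrix f *v (y - x)) + norm (matrix f *v (y - x) - (y - x))"
          by (simp only: norm_triangle_ineq)
        moreover have "(c - \<epsilon>) * norm (y - x) + \<epsilon> * norm (y - x) = c * norm (y - x)"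
          by (simp add: left_diff_distrib)
        ultimately have "norm (F y - F x - (y - x)) \<le> c * norm (y - x)" by linarith
        then show "?P y" using F\<Phi>[OF y] F\<Phi>[OF xT] by simp
      qed
    qed
  qed simp
  then have "\<forall>\<^sub>F y in at x. \<forall>T\<in>\<T>. y \<in> \<Theta> ` (T \<inter> \<Omega>) \<longrightarrow> x \<in> \<Theta> ` (T \<inter> \<Omega>) \<longrightarrow> ?P y"
    using finite_mesh by (simp add: eventually_ball_finite)
  with eventually_touching[OF x] show "\<forall>\<^sub>F y in at x. ?P y"
  proof eventually_elim
    case (elim y)
    obtain T where T: "T \<in> \<T>" "y \<in> \<Theta> ` (T \<inter> \<Omega>)" using cover[OF conjunct1[OF elim(1)]] by (elim bexE)
    then have "x \<in> \<Theta> ` (T \<inter> \<Omega>)" using conjunct2[OF elim(1)] by blast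
    then show ?case using elim(2) T by (elim ballE[of _ _ T]) simp_all
  qed
qed

text \<open>If \<open>K\<close> stays in one curved element near a point, then \<open>\<Phi>\<close> agrees on \<open>K\<close> near this point with
  a function that is smooth there. As \<open>D\<close> may come from any element that contains the point, \<open>K\<close>
  must stay in each of them. The exceptional points lie over sets \<open>G T T'\<close> of common zeros of low
  dimension.\<close>

lemma AE_jacobian_is_derivative_within:
  assumes dim: "CARD('n) \<in> {2, 3}"
    and jac: "elementwise_jacobian \<Omega> \<T> \<Theta> \<Phi> D"
    and \<phi>hat: "\<phi>hat \<in> fe_space 1 \<T>" and nz: "\<And>T. T \<in> \<T> \<Longrightarrow> \<exists>x\<in>T. \<phi>hat x \<noteq> 0"
    and \<Theta>q: "\<And>i. (\<lambda>x. \<Theta> x $ i) \<in> fe_space q \<T>"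
    and K: "K = \<Theta> ` {x \<in> \<Omega>. \<phi>hat x = 0}" "K \<in> sets borel"
  shows "AE y in surface_measure K. (\<Phi> has_derivative (\<lambda>w. D y *v w)) (at y within K)"
proof -
  have K\<Omega>: "K \<subseteq> \<Omega>" using deformation(4) by (auto simp: K(1))
  have K0: "\<phi>hat (\<Theta>' y) = 0" if "y \<in> K" for y using that deformation(6) by (auto simp: K(1))
  have poly: "\<exists>p. poly_fun 1 p \<and> (\<forall>x\<in>T. \<phi>hat x = p x)" if "T \<in> \<T>" for T
    using \<phi>hat that by (auto simp: fe_space_def piecewise_poly_def)
  define G where "G T T' = {u \<in> T \<inter> T'. \<phi>hat u = 0}" for T T'
  define Bad where "Bad = {(T, T'). T \<in> \<T> \<and> T' \<in> \<T> \<and> aff_dim (G T T') < int CARD('n) - 1}"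
  have "finite Bad" by (rule finite_subset[of _ "\<T> \<times> \<T>"]) (auto simp: Bad_def finite_mesh)
  moreover have "AE y in surface_measure K. y \<notin> \<Theta> ` G T T'" if "(T, T') \<in> Bad" for T T'
  proof -
    have T: "T \<in> \<T>" "T' \<in> \<T>" and low: "aff_dim (G T T') < int CARD('n) - 1" using that by (auto simp: Bad_def)
    obtain p where p: "poly_fun 1 p" "\<And>x. x \<in> T \<Longrightarrow> \<phi>hat x = p x" using poly[OF T(1)] by blast
    obtain Lp where Lp: "Lp-lipschitz_on T p"
      using poly_fun_lipschitz_on_bounded[OF compact_imp_bounded[OF element(2)[OF T(1)]] p(1)] by blast
    obtain L where L: "L-lipschitz_on T \<Theta>"
      using fe_vector_lipschitz_on_element[OF T(1) compact_imp_bounded[OF element(2)[OF T(1)]] \<Theta>q] by blast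
    have G_eq: "G T T' = (T \<inter> T') \<inter> {x. p x = 0}" using p(2) by (auto simp: G_def)
    have conv: "convex (G T T')"
      unfolding G_eq
      by (intro convex_Int element(1) T affine_imp_convex) (simp add: affine_def poly_fun_1_affine[OF p(1)])
    have "closed (T \<inter> p -` {0})"
      by (rule continuous_closed_preimage[OF lipschitz_on_continuous_on[OF Lp]])
        (simp_all add: compact_imp_closed[OF element(2)[OF T(1)]])
    then have "compact (T' \<inter> (T \<inter> p -` {0}))" by (rule compact_Int_closed[OF element(2)[OF T(2)]])
    moreover have "T' \<inter> (T \<inter> p -` {0}) = G T T'" by (auto simp: G_eq)
    ultimately have comp: "compact (G T T')" by simp
    have sub: "G T T' \<subseteq> T" by (auto simp: G_def)
    have LG: "L-lipschitz_on (G T T') \<Theta>" by (rule lipschitz_on_subset[OF L sub])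
    have compi: "compact (\<Theta> ` G T T')"
      by (rule compact_continuous_image[OF lipschitz_on_continuous_on[OF LG] comp])
    have "hausdorff_outer (CARD('n) - 1) (\<Theta> ` G T T') = 0"
      using dim low by (intro hausdorff_outer_lipschitz_image_lowdim_eq_0[OF _ comp conv _ LG]) auto
    then have "hausdorff_outer (CARD('n) - 1) (\<Theta> ` G T T' \<inter> K) = 0"
      using hausdorff_outer_mono[of "\<Theta> ` G T T' \<inter> K" "\<Theta> ` G T T'" "CARD('n) - 1"] by simp
    moreover have m: "\<Theta> ` G T T' \<inter> K \<in> sets (surface_measure K)"
      using borel_compact[OF compi] K(2) by (intro sets_surface_measureI) auto
    ultimately have "\<Theta> ` G T T' \<inter> K \<in> null_sets (surface_measure K)"
      using emeasure_surface_measure[OF K(2) m] by (auto simp: null_sets_def)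
    then have "AE y in surface_measure K. y \<notin> \<Theta> ` G T T' \<inter> K" by (rule AE_not_in)
    moreover have "AE y in surface_measure K. y \<in> K" by (rule AE_I2) simp
    ultimately show ?thesis by eventually_elim blast
  qed
  ultimately have "AE y in surface_measure K. \<forall>(T, T')\<in>Bad. y \<notin> \<Theta> ` G T T'"
    by (intro AE_finite_allI) auto
  moreover have "AE y in surface_measure K. y \<in> K" by (rule AE_I2) simp
  ultimately show ?thesis
  proof eventually_elim
    case (elim y)
    have y\<Omega>: "y \<in> \<Omega>" using elim K\<Omega> by blast
    obtain T F where T: "T \<in> \<T>" "y \<in> \<Theta> ` (T \<inter> \<Omega>)" and F: "Ck_extension_on 1 \<Phi> (\<Theta> ` (T \<inter> \<Omega>)) F"
      and D: "(F has_derivative (\<lambda>w. D y *v w)) (at y)"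
      using jac y\<Omega> unfolding elementwise_jacobian_def by blast
    have F\<Phi>: "F u = \<Phi> u" if "u \<in> \<Theta> ` (T \<inter> \<Omega>)" for u using F that unfolding Ck_extension_on_def by blast
    have zT: "\<Theta>' y \<in> T" using T(2) mem_image_iff[OF y\<Omega>] by blast
    have stay: "\<Theta>' u \<in> T"
      if T': "T' \<in> \<T>" "\<Theta>' y \<in> T'" and u: "u \<in> K" "\<Theta>' u \<in> T'" for T' u
    proof (cases "T' = T")
      case ne: False
      obtain p where p: "poly_fun 1 p" "\<And>x. x \<in> T' \<Longrightarrow> \<phi>hat x = p x" using poly[OF T'(1)] by blast
      have "y \<in> \<Theta> ` G T T'"
        using zT T'(2) K0[OF elim(2)] deformation(7)[OF y\<Omega>] by (intro image_eqI[of _ _ "\<Theta>' y"]) (auto simp: G_def)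
      then have "(T, T') \<notin> Bad" using elim(1) by blast
      then have "int CARD('n) - 1 \<le> aff_dim (G T T')" using T(1) T'(1) by (simp add: Bad_def)
      moreover have "G T T' = {x \<in> T' \<inter> T. p x = 0}" using p(2) by (auto simp: G_def)
      ultimately have "int CARD('n) - 1 \<le> aff_dim {x \<in> T' \<inter> T. p x = 0}" by simp
      moreover have "\<exists>x\<in>T'. p x \<noteq> 0" using nz[OF T'(1)] p(2) by auto
      ultimately have "{x \<in> T'. p x = 0} \<subseteq> T' \<inter> T"
        using element(1,3)[OF T'(1)] face_Int[OF T'(1) T(1)] proper_face_Int[OF T'(1) T(1) ne] p(1)
        by (intro zero_set_subset_face) auto
      moreover have "\<Theta>' u \<in> {x \<in> T'. p x = 0}" using u(2) K0[OF u(1)] p(2)[OF u(2)] by simp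
      ultimately show ?thesis by blast
    qed (use u(2) in simp)
    have "\<forall>\<^sub>F u in at y within K. u \<in> \<Omega> \<and> (\<forall>T\<in>\<T>. u \<in> \<Theta> ` (T \<inter> \<Omega>) \<longrightarrow> y \<in> \<Theta> ` (T \<inter> \<Omega>))"
      by (rule filter_leD[OF at_le[OF subset_UNIV] eventually_touching[OF y\<Omega>]])
    moreover have "\<forall>\<^sub>F u in at y within K. u \<in> K" by (simp add: eventually_at_filter)
    ultimately have ev: "\<forall>\<^sub>F u in at y within K. F u = \<Phi> u"
    proof eventually_elim
      case (elim u)
      obtain T' where T': "T' \<in> \<T>" "u \<in> \<Theta> ` (T' \<inter> \<Omega>)" using cover elim(1) by blast
      then have "\<Theta>' y \<in> T'" "\<Theta>' u \<in> T'" using elim(1) mem_image_iff y\<Omega> by blast+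
      then have "\<Theta>' u \<in> T" using stay[OF T'(1)] elim(2) by blast
      then show ?case using mem_image_iff elim(1) by (intro F\<Phi>) blast
    qed
    have "(F has_derivative (\<lambda>w. D y *v w)) (at y within K)" by (rule has_derivative_at_withinI[OF D])
    then show ?case
      by (rule has_derivative_transform_eventually[OF _ ev]) (use F\<Phi>[OF T(2)] elim(2) in auto)
  qed
qed

end

section \<open>Comparison of norms on the interface and on the discrete interface\<close>

theorem lemma2p5:
  fixes \<Omega> \<Omega>1 \<Omega>2 \<Gamma> :: "(real^'n) set"
    and \<phi> :: "real^'n \<Rightarrow> real"
    and q :: nat
    and \<sigma> C0 :: real
  assumes dim: "CARD('n) \<in> {2, 3}"
    and order: "q \<ge> 1"
    and geometry: "interface_geometry q \<Omega> \<Omega>1 \<Omega>2 \<Gamma> \<phi>"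
    and sigma: "\<sigma> > 0"
  shows "\<exists>h0>0. \<exists>C>0.
    \<forall>(h::real) (\<T> :: (real^'n) set set) (\<phi>hat :: real^'n \<Rightarrow> real) (\<phi>h :: real^'n \<Rightarrow> real)
     (\<Psi> :: real^'n \<Rightarrow> real^'n) (\<Theta> :: real^'n \<Rightarrow> real^'n) (D\<Phi> :: real^'n \<Rightarrow> real^'n^'n)
     (U :: (real^'n) set) (v :: real^'n \<Rightarrow> real) (grad_v :: real^'n \<Rightarrow> real^'n)
     (v\<Gamma> :: real^'n \<Rightarrow> real) (g\<Gamma> :: real^'n \<Rightarrow> real^'n).
    let \<Gamma>lin = {x \<in> \<Omega>. \<phi>hat x = 0};
        \<Omega>1lin = {x \<in> \<Omega>. \<phi>hat x < 0};
        \<Omega>2lin = {x \<in> \<Omega>. \<phi>hat x > 0};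
        \<Gamma>h = \<Theta> ` \<Gamma>lin;
        \<Omega>1h = \<Theta> ` \<Omega>1lin;
        \<Omega>2h = \<Theta> ` \<Omega>2lin;
        \<Phi> = Phi_map \<Omega> \<Psi> \<Theta>;
        n = unit_normal \<Gamma> \<Omega>1 \<Omega>2;
        nh = unit_normal \<Gamma>h \<Omega>1h \<Omega>2h;
        P = (\<lambda>x. tangential_projection (n x));
        Ph = (\<lambda>x. tangential_projection (nh x));
        vt = (\<lambda>x. v\<Gamma> (\<Phi> x));
        gt = (\<lambda>x. transpose (D\<Phi> x) *v g\<Gamma> (\<Phi> x));
        N = surface_measure \<Gamma>;
        Nh = surface_measure \<Gamma>h;
        c = ennreal C;
        hq = ennreal (h ^ q)
    in
      h \<le> h0 \<and> quasi_uniform_mesh \<sigma> \<Omega> h \<T> \<and>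
      nodal_interpolant 1 \<T> \<phi> \<phi>hat \<and> nodal_interpolant q \<T> \<phi> \<phi>h \<and>
      mesh_deformations q \<Omega> \<T> \<phi> \<phi>hat \<phi>h \<Psi> \<Theta> \<and>
      (\<exists>\<Psi>'. homeomorphism \<Omega> \<Omega> \<Psi> \<Psi>') \<and> (\<exists>\<Theta>'. homeomorphism \<Omega> \<Omega> \<Theta> \<Theta>') \<and>
      \<Psi> ` \<Gamma>lin = \<Gamma> \<and> \<Psi> ` \<Omega>1lin = \<Omega>1 \<and> \<Psi> ` \<Omega>2lin = \<Omega>2 \<and>
      continuous_on \<Omega> \<Phi> \<and> elementwise_smooth (q + 1) \<Phi> {\<Theta> ` (T \<inter> \<Omega>) | T. T \<in> \<T>} \<and>
      elementwise_jacobian \<Omega> \<T> \<Theta> \<Phi> D\<Phi> \<and> D\<Phi> \<in> borel_measurable Nh \<and>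
      Linf_norm \<Omega> (\<lambda>x. \<Phi> x - x) + ennreal h * Linf_norm \<Omega> (\<lambda>x. D\<Phi> x - mat 1)
        \<le> ennreal (C0 * h ^ (q + 1)) \<and>
      open U \<and> U \<subseteq> \<Omega> \<and> \<Gamma> \<subseteq> closure U \<and> has_weak_gradient_on v grad_v U \<and>
      has_trace_on U v \<Gamma> v\<Gamma> \<and> has_trace_on U grad_v \<Gamma> g\<Gamma> \<and>
      L2_norm N v\<Gamma> < \<infinity> \<and> L2_norm N g\<Gamma> < \<infinity>
    \<longrightarrow>
      (L2_norm Nh vt \<le> c * L2_norm N v\<Gamma> \<and> L2_norm N v\<Gamma> \<le> c * L2_norm Nh vt) \<and>
      (L2_norm Nh gt \<le> c * L2_norm N g\<Gamma> \<and> L2_norm N g\<Gamma> \<le> c * L2_norm Nh gt) \<and>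
      L2_norm Nh (\<lambda>x. gt x \<bullet> nh x)
        \<le> c * (hq * L2_norm N g\<Gamma> + L2_norm N (\<lambda>x. g\<Gamma> x \<bullet> n x)) \<and>
      L2_norm N (\<lambda>x. g\<Gamma> x \<bullet> n x)
        \<le> c * (hq * L2_norm Nh gt + L2_norm Nh (\<lambda>x. gt x \<bullet> nh x)) \<and>
      L2_norm Nh (\<lambda>x. Ph x *v gt x)
        \<le> c * (hq * L2_norm N g\<Gamma> + L2_norm N (\<lambda>x. P x *v g\<Gamma> x)) \<and>
      L2_norm N (\<lambda>x. P x *v g\<Gamma> x)
        \<le> c * (hq * L2_norm Nh gt + L2_norm Nh (\<lambda>x. Ph x *v gt x))"
proof -
  note geo = geometry[unfolded interface_geometry_def]
  have poly: "polyhedral_domain \<Omega>" using geo by (elim conjE)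
  note \<Omega> = polyhedral_domainD[OF poly]
  have \<Gamma>f: "\<Gamma> = frontier \<Omega>1" using geo by (elim conjE)
  have \<Gamma>: "\<Gamma> = {x \<in> \<Omega>. \<phi> x = 0}" using geo by (elim conjE)
  have \<Omega>1: "\<Omega>1 = {x \<in> \<Omega>. \<phi> x < 0}" using geo by (elim conjE)
  have \<Omega>2: "\<Omega>2 = {x \<in> \<Omega>. \<phi> x > 0}" using geo by (elim conjE)
  have "\<forall>x\<in>\<Gamma>. gradient \<phi> x \<noteq> 0" using geo by (elim conjE)
  then have grad: "\<And>x. x \<in> \<Gamma> \<Longrightarrow> gradient \<phi> x \<noteq> 0" by blast
  have "\<exists>W. open W \<and> \<Gamma> \<subseteq> W \<and> Ck_on (q + 2) \<phi> W" using geo by (elim conjE)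
  then obtain W where W: "open W" "\<Gamma> \<subseteq> W" "Ck_on (q + 2) \<phi> W" by (elim exE conjE)
  have Ck: "Ck_on (Suc (Suc q)) \<phi> W" using W(3) by simp
  have diff: "\<phi> differentiable (at x)" if "x \<in> W" for x using Ck that by simp
  have contg: "continuous_on \<Gamma> (gradient \<phi>)"
    by (rule continuous_on_subset[OF continuous_on_gradient[OF Ck] W(2)])
  have c\<Gamma>: "compact \<Gamma>"
  proof -
    have "bounded \<Gamma>" by (rule bounded_subset[OF \<Omega>(2)]) (subst \<Gamma>, blast)
    moreover have "closed \<Gamma>" unfolding \<Gamma>f by (rule frontier_closed)
    ultimately show ?thesis by (simp add: compact_eq_bounded_closed)
  qed
  have int\<Gamma>: "interior \<Gamma> = {}"
  proof (rule ccontr)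
    assume "interior \<Gamma> \<noteq> {}"
    then obtain x where x: "x \<in> interior \<Gamma>" by blast
    then have x\<Gamma>: "x \<in> \<Gamma>" using interior_subset by blast
    have "(\<phi> has_derivative (\<lambda>h. 0)) (at x)"
    proof (rule has_derivative_transform_within_open[OF _ open_interior x])
      show "((\<lambda>_. 0) has_derivative (\<lambda>h. 0)) (at x)" by simp
      fix y assume "y \<in> interior \<Gamma>"
      then have "y \<in> \<Gamma>" using interior_subset by blast
      then show "0 = \<phi> y" unfolding \<Gamma> by simp
    qed
    moreover have "(\<phi> has_derivative (\<lambda>h. h \<bullet> gradient \<phi> x)) (at x)"
      using W(2) x\<Gamma> by (intro has_derivative_gradient diff) blast
    ultimately have "(\<lambda>h. 0) = (\<lambda>h. h \<bullet> gradient \<phi> x)" by (rule has_derivative_unique)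
    then have "gradient \<phi> x \<bullet> gradient \<phi> x = 0" by metis
    then show False using grad[OF x\<Gamma>] by simp
  qed
  \<comment> \<open>The choice of \<open>h0\<close> makes \<open>\<bar>C0\<bar> h\<^sup>q \<le> 1/8\<close>. In \<open>C\<close> the factor \<open>48\<close> comes from
    \<open>near_id_surface_estimates\<close>, the other one from replacing \<open>\<bar>C0\<bar> h\<^sup>q\<close> by \<open>h\<^sup>q\<close> there.\<close>
  define h0 where "h0 = 1 / (8 * (\<bar>C0\<bar> + 1))"
  define C where "C = 48 * (\<bar>C0\<bar> + 1)"
  have C: "C > 0" "C \<ge> 8" by (simp_all add: C_def)
  have h0: "h0 > 0" "h0 \<le> 1" by (simp_all add: h0_def field_simps)
  have key: "(L2_norm (surface_measure K) (\<lambda>x. v\<Gamma> (\<Phi> x)) \<le> ennreal C * L2_norm (surface_measure \<Gamma>) v\<Gamma> \<and>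
       L2_norm (surface_measure \<Gamma>) v\<Gamma> \<le> ennreal C * L2_norm (surface_measure K) (\<lambda>x. v\<Gamma> (\<Phi> x))) \<and>
      (L2_norm (surface_measure K) gt \<le> ennreal C * L2_norm (surface_measure \<Gamma>) g\<Gamma> \<and>
       L2_norm (surface_measure \<Gamma>) g\<Gamma> \<le> ennreal C * L2_norm (surface_measure K) gt) \<and>
      L2_norm (surface_measure K) (\<lambda>x. gt x \<bullet> nh x)
        \<le> ennreal C * (ennreal (h ^ q) * L2_norm (surface_measure \<Gamma>) g\<Gamma> + L2_norm (surface_measure \<Gamma>) (\<lambda>x. g\<Gamma> x \<bullet> n x)) \<and>
      L2_norm (surface_measure \<Gamma>) (\<lambda>x. g\<Gamma> x \<bullet> n x)
        \<le> ennreal C * (ennreal (h ^ q) * L2_norm (surface_measure K) gt + L2_norm (surface_measure K) (\<lambda>x. gt x \<bullet> nh x)) \<and>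
      L2_norm (surface_measure K) (\<lambda>x. tangential_projection (nh x) *v gt x)
        \<le> ennreal C * (ennreal (h ^ q) * L2_norm (surface_measure \<Gamma>) g\<Gamma>
            + L2_norm (surface_measure \<Gamma>) (\<lambda>x. tangential_projection (n x) *v g\<Gamma> x)) \<and>
      L2_norm (surface_measure \<Gamma>) (\<lambda>x. tangential_projection (n x) *v g\<Gamma> x)
        \<le> ennreal C * (ennreal (h ^ q) * L2_norm (surface_measure K) gt
            + L2_norm (surface_measure K) (\<lambda>x. tangential_projection (nh x) *v gt x))"
    if h: "h \<le> h0" and qmesh: "quasi_uniform_mesh \<sigma> \<Omega> h \<T>"
      and \<phi>hat: "nodal_interpolant 1 \<T> \<phi> \<phi>hat" and def: "mesh_deformations q \<Omega> \<T> \<phi> \<phi>hat \<phi>h \<Psi> \<Theta>"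
      and \<Psi>hom: "homeomorphism \<Omega> \<Omega> \<Psi> \<Psi>'" and \<Theta>hom: "homeomorphism \<Omega> \<Omega> \<Theta> \<Theta>'"
      and \<Psi>\<Gamma>: "\<Psi> ` {x \<in> \<Omega>. \<phi>hat x = 0} = \<Gamma>" and \<Psi>1: "\<Psi> ` {x \<in> \<Omega>. \<phi>hat x < 0} = \<Omega>1"
      and \<Psi>2: "\<Psi> ` {x \<in> \<Omega>. \<phi>hat x > 0} = \<Omega>2"
      and smooth: "elementwise_smooth (q + 1) \<Phi> {\<Theta> ` (T \<inter> \<Omega>) | T. T \<in> \<T>}"
      and jac: "elementwise_jacobian \<Omega> \<T> \<Theta> \<Phi> D\<Phi>" and Dm: "D\<Phi> \<in> borel_measurable (surface_measure K)"
      and Linf: "Linf_norm \<Omega> (\<lambda>x. \<Phi> x - x) + ennreal h * Linf_norm \<Omega> (\<lambda>x. D\<Phi> x - mat 1) \<le> ennreal (C0 * h ^ (q + 1))"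
      and v: "L2_norm (surface_measure \<Gamma>) v\<Gamma> < \<infinity>" and g: "L2_norm (surface_measure \<Gamma>) g\<Gamma> < \<infinity>"
      and \<Phi>: "\<Phi> = Phi_map \<Omega> \<Psi> \<Theta>" and K: "K = \<Theta> ` {x \<in> \<Omega>. \<phi>hat x = 0}"
      and n: "n = unit_normal \<Gamma> \<Omega>1 \<Omega>2"
      and nh: "nh = unit_normal K (\<Theta> ` {x \<in> \<Omega>. \<phi>hat x < 0}) (\<Theta> ` {x \<in> \<Omega>. \<phi>hat x > 0})"
      and gt: "gt = (\<lambda>x. transpose (D\<Phi> x) *v g\<Gamma> (\<Phi> x))"
    for h \<T> \<phi>hat \<phi>h \<Psi> \<Psi>' \<Theta> \<Theta>' D\<Phi> \<Phi> K n nh gt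
      and v\<Gamma> :: "real^'n \<Rightarrow> real" and g\<Gamma> :: "real^'n \<Rightarrow> real^'n"
  proof -
    interpret curved_mesh \<Omega> \<T> \<Theta> \<Theta>'
      using \<Omega> qmesh \<Theta>hom by unfold_locales (auto simp: quasi_uniform_mesh_def)
    have hpos: "h > 0" using qmesh by (simp add: quasi_uniform_mesh_def)
    have \<phi>fe: "\<phi>hat \<in> fe_space 1 \<T>" using \<phi>hat by (simp add: nodal_interpolant_def)
    have \<Theta>fe: "(\<lambda>x. \<Theta> x $ i) \<in> fe_space q \<T>" for i
      using def by (simp add: mesh_deformations_def Let_def)
    have \<Psi>: "continuous_on \<Omega> \<Psi>" "inj_on \<Psi> \<Omega>" "\<And>x. x \<in> \<Omega> \<Longrightarrow> \<Psi> x \<in> \<Omega>"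
      using \<Psi>hom by (auto simp: homeomorphism_def intro: inj_on_inverseI[of _ \<Psi>'])
    have \<Phi>\<Theta>: "\<Phi> (\<Theta> x) = \<Psi> x" if "x \<in> \<Omega>" for x
    proof -
      have "inj_on \<Theta> \<Omega>" by (rule inj_on_inverseI[of _ \<Theta>']) (rule deformation(6))
      then show ?thesis using that by (simp add: \<Phi> Phi_map_def)
    qed
    have hom\<Phi>: "homeomorphism \<Omega> \<Omega> \<Phi> (\<Theta> \<circ> \<Psi>')"
    proof (rule homeomorphism_cong)
      show "homeomorphism \<Omega> \<Omega> (\<Psi> \<circ> \<Theta>') (\<Theta> \<circ> \<Psi>')"
        by (rule homeomorphism_compose[OF homeomorphism_symD[OF \<Theta>hom] \<Psi>hom])
      show "\<Phi> x = (\<Psi> \<circ> \<Theta>') x" if "x \<in> \<Omega>" for x using \<Phi>\<Theta>[OF deformation(5)[OF that]] deformation(7)[OF that] by simp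
    qed auto
    have pull: "\<Theta> ` S = {x \<in> \<Omega>. \<Phi> x \<in> \<Psi> ` S}" if "S \<subseteq> \<Omega>" for S
    proof (intro equalityI subsetI)
      fix x assume "x \<in> \<Theta> ` S"
      then show "x \<in> {x \<in> \<Omega>. \<Phi> x \<in> \<Psi> ` S}" using that deformation(4) \<Phi>\<Theta> by auto
    next
      fix x assume "x \<in> {x \<in> \<Omega>. \<Phi> x \<in> \<Psi> ` S}"
      then obtain s where s: "x \<in> \<Omega>" "s \<in> S" "\<Phi> x = \<Psi> s" by blast
      have "\<Psi> (\<Theta>' x) = \<Psi> s" using \<Phi>\<Theta>[OF deformation(5)[OF s(1)]] deformation(7)[OF s(1)] s(3) by simp
      then have "\<Theta>' x = s" using inj_onD[OF \<Psi>(2)] deformation(5)[OF s(1)] s(2) that by blast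
      then have "x = \<Theta> s" using deformation(7)[OF s(1)] by simp
      then show "x \<in> \<Theta> ` S" using s(2) by blast
    qed
    have \<Phi>\<Omega>: "\<Phi> x \<in> \<Omega>" if "x \<in> \<Omega>" for x
      using hom\<Phi> that by (auto simp: homeomorphism_def)
    have K': "K = {x \<in> \<Omega>. \<phi> (\<Phi> x) = 0}"
      unfolding K by (subst pull) (auto simp: \<Psi>\<Gamma> \<Gamma> \<Phi>\<Omega>)
    have K1: "\<Theta> ` {x \<in> \<Omega>. \<phi>hat x < 0} = {x \<in> \<Omega>. \<phi> (\<Phi> x) < 0}"
      by (subst pull) (auto simp: \<Psi>1 \<Omega>1 \<Phi>\<Omega>)
    have K2: "\<Theta> ` {x \<in> \<Omega>. \<phi>hat x > 0} = {x \<in> \<Omega>. \<phi> (\<Phi> x) > 0}"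
      by (subst pull) (auto simp: \<Psi>2 \<Omega>2 \<Phi>\<Omega>)
    \<comment> \<open>The bound on the Jacobian loses one power of \<open>h\<close> against the bound on \<open>\<Phi> - id\<close>, and \<open>C0\<close> may
      be negative.\<close>
    define \<epsilon> where "\<epsilon> = \<bar>C0\<bar> * h ^ q"
    have \<epsilon>: "0 \<le> \<epsilon>" "\<epsilon> \<le> 1/8"
    proof -
      show "0 \<le> \<epsilon>" using hpos by (simp add: \<epsilon>_def)
      have "h ^ q \<le> h ^ 1" using order hpos h h0 by (intro power_decreasing) auto
      then have "\<epsilon> \<le> \<bar>C0\<bar> * h0" using h by (simp add: \<epsilon>_def mult_left_mono)
      also have "\<dots> \<le> 1/8" by (simp add: h0_def field_simps)
      finally show "\<epsilon> \<le> 1/8" .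
    qed
    have "ennreal h * Linf_norm \<Omega> (\<lambda>x. D\<Phi> x - mat 1)
        \<le> Linf_norm \<Omega> (\<lambda>x. \<Phi> x - x) + ennreal h * Linf_norm \<Omega> (\<lambda>x. D\<Phi> x - mat 1)"
      by (rule add_increasing) simp_all
    also note Linf
    also have "ennreal (C0 * h ^ (q + 1)) \<le> ennreal (h * \<epsilon>)"
    proof (rule ennreal_leI)
      have "C0 * h ^ (q + 1) \<le> \<bar>C0\<bar> * h ^ (q + 1)" using hpos by (intro mult_right_mono) auto
      then show "C0 * h ^ (q + 1) \<le> h * \<epsilon>" by (simp add: \<epsilon>_def mult.left_commute)
    qed
    also have "\<dots> = ennreal h * ennreal \<epsilon>" using hpos \<epsilon> by (simp add: ennreal_mult)
    finally have "Linf_norm \<Omega> (\<lambda>x. D\<Phi> x - mat 1) \<le> ennreal \<epsilon>"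
      using hpos by (subst (asm) ennreal_mult_le_mult_iff) auto
    then have esssup: "esssup (lebesgue_on \<Omega>) (\<lambda>x. ennreal (norm (D\<Phi> x - mat 1))) \<le> ennreal \<epsilon>"
      by (simp add: Linf_norm_def)
    have ae: "AE x in lebesgue_on \<Omega>. norm (D\<Phi> x - mat 1) \<le> \<epsilon>"
      using esssup_AE[of "\<lambda>x. ennreal (norm (D\<Phi> x - mat 1))" "lebesgue_on \<Omega>"]
    proof eventually_elim
      case (elim x)
      then have "ennreal (norm (D\<Phi> x - mat 1)) \<le> ennreal \<epsilon>" using esssup by (rule order_trans)
      then show ?case using \<epsilon>(1) by (simp add: ennreal_le_iff)
    qed
    have near: "infinitesimally_near_id (1/4) \<Phi> \<Omega>"
      by (rule infinitesimally_near_id_of_jacobian_bound[OF jac smooth ae]) (use \<epsilon> in simp)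
    have Dbound: "norm (D\<Phi> x - mat 1) \<le> \<epsilon>" if "x \<in> K" for x
    proof -
      have "x \<in> \<Omega>" using that K' by blast
      then obtain T F where "T \<in> \<T>" "x \<in> \<Theta> ` (T \<inter> \<Omega>)" "Ck_extension_on 1 \<Phi> (\<Theta> ` (T \<inter> \<Omega>)) F"
        "(F has_derivative (\<lambda>y. D\<Phi> x *v y)) (at x)"
        using jac unfolding elementwise_jacobian_def by blast
      then show ?thesis by (rule jacobian_bound[OF jac ae])
    qed
    \<comment> \<open>Otherwise \<open>\<Psi>\<close> would map the interior of \<open>T\<close> onto an open subset of \<open>\<Gamma>\<close>.\<close>
    have nz: "\<exists>x\<in>T. \<phi>hat x \<noteq> 0" if T: "T \<in> \<T>" for T
    proof (rule ccontr)
      assume zero: "\<not> (\<exists>x\<in>T. \<phi>hat x \<noteq> 0)"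
      have I: "interior T \<subseteq> \<Omega>" "interior T \<noteq> {}" using element(4,6)[OF T] by auto
      have "open (\<Psi> ` interior T)"
        by (intro invariance_of_domain continuous_on_subset[OF \<Psi>(1) I(1)] inj_on_subset[OF \<Psi>(2) I(1)]) simp
      moreover have "interior T \<subseteq> {x \<in> \<Omega>. \<phi>hat x = 0}" using I(1) zero interior_subset by blast
      then have "\<Psi> ` interior T \<subseteq> \<Gamma>" unfolding \<Psi>\<Gamma>[symmetric] by (rule image_mono)
      ultimately have "\<Psi> ` interior T \<subseteq> interior \<Gamma>" by (intro interior_maximal)
      then show False using int\<Gamma> I(2) by blast
    qed
    have Kb: "K \<in> sets borel"
    proof -
      have "K = (\<Theta> \<circ> \<Psi>') ` \<Gamma>"
      proof -
        have "{x \<in> \<Omega>. \<phi>hat x = 0} = \<Psi>' ` \<Gamma>"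
          unfolding \<Psi>\<Gamma>[symmetric] image_image
          using \<Psi>hom by (auto simp: homeomorphism_def image_iff)
        then show ?thesis by (simp add: K image_comp)
      qed
      moreover have "continuous_on \<Gamma> (\<Theta> \<circ> \<Psi>')"
        using hom\<Phi> \<Gamma> by (auto simp: homeomorphism_def intro: continuous_on_subset)
      ultimately show ?thesis using compact_continuous_image[OF _ c\<Gamma>] borel_compact by metis
    qed
    have good: "AE x in surface_measure K. (\<Phi> has_derivative (\<lambda>w. D\<Phi> x *v w)) (at x within K)"
      by (rule AE_jacobian_is_derivative_within[OF dim jac \<phi>fe nz \<Theta>fe K Kb])
    have dim3: "CARD('n) \<le> 3" using dim by auto
    note est = near_id_surface_estimates[OF dim3 \<Omega>(1) \<Gamma> c\<Gamma> W(1,2) diff contg grad hom\<Phi> near K' good Dbound Dm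
        \<epsilon> n[unfolded \<Omega>1 \<Omega>2] nh[unfolded K1 K2] v g gt]
    have up: "X \<le> ennreal C * Y" if "X \<le> of_nat k * Y" "k \<le> 8" for X Y :: ennreal and k :: nat
    proof -
      have "(of_nat k :: ennreal) \<le> ennreal C" using that(2) C by (simp add: ennreal_of_nat_eq_real_of_nat ennreal_leI)
      then have "of_nat k * Y \<le> ennreal C * Y" by (rule mult_right_mono) simp
      then show ?thesis using that(1) by (rule order_trans[rotated])
    qed
    have up': "X \<le> ennreal C * (ennreal (h ^ q) * Y + Z)" if "X \<le> 48 * (ennreal \<epsilon> * Y + Z)" for X Y Z :: ennreal
    proof -
      let ?c = "ennreal (\<bar>C0\<bar> + 1)"
      have "ennreal \<epsilon> \<le> ennreal ((\<bar>C0\<bar> + 1) * h ^ q)"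
        unfolding \<epsilon>_def using hpos by (intro ennreal_leI mult_right_mono) auto
      also have "\<dots> = ?c * ennreal (h ^ q)" using hpos by (intro ennreal_mult) auto
      finally have "ennreal \<epsilon> * Y \<le> ?c * ennreal (h ^ q) * Y" by (rule mult_right_mono) simp
      moreover have "1 * Z \<le> ?c * Z"
        using ennreal_leI[of 1 "\<bar>C0\<bar> + 1"] by (intro mult_right_mono) simp_all
      ultimately have "ennreal \<epsilon> * Y + Z \<le> ?c * ennreal (h ^ q) * Y + ?c * Z"
        by (intro add_mono) simp_all
      also have "\<dots> = ?c * (ennreal (h ^ q) * Y + Z)" by (simp only: distrib_left mult.assoc)
      finally have "48 * (ennreal \<epsilon> * Y + Z) \<le> 48 * (?c * (ennreal (h ^ q) * Y + Z))" by (rule mult_left_mono) simp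
      also have "\<dots> = ennreal C * (ennreal (h ^ q) * Y + Z)"
      proof -
        have "ennreal C = 48 * ?c" unfolding C_def by (subst ennreal_mult) simp_all
        then show ?thesis by (simp only: mult.assoc)
      qed
      finally show ?thesis using that by (rule order_trans[rotated])
    qed
    show ?thesis
      using up[of _ 2, simplified, OF est(1)] up[of _ 2, simplified, OF est(2)]
        up[of _ 8, simplified, OF est(3)] up[of _ 8, simplified, OF est(4)]
        up'[OF est(5)] up'[OF est(6)] up'[OF est(7)] up'[OF est(8)] by blast
  qed
  show ?thesis
    unfolding Let_def
    by (rule exI[of _ h0], rule conjI, rule h0(1), rule exI[of _ C], rule conjI, rule C(1),
        (rule allI)+, rule impI, elim conjE exE, rule key) (assumption | rule refl)+
qed

end
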